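(* Let $G=Spin_{2n+1}$ and $N=2n+1$. Start from the seed for $\mathrm{Conf}_3\mathcal A_{Spin_{2n+1}}$ described in the context and perform the following mutations: for $r=n-1,n-2,\dots,1$ in turn, and for each such $r$ for $m=1,2,\dots,r$ in turn, mutate all vertices $x_{ij}$ ($1\le i,j\le n-1$) with $\max(i,j)=m$ (order among these immaterial). Then a vertex $x_{ij}$ with $\max(i,j)=k$ is mutated $n-k$ times in total, and the function attached to it transforms as follows (for the vertices that are mutated). (1) If $i\ge j$: for $0\le t\le n-i$, after $t$ mutations the function is $[2n+1-t,\,n-i-t;\;n+1+i-j+t;\;j+t]$. Thus it starts as $[n-i;n+1+i-j;j]$ and ends as $[n+i+1;2n+1-j;n-i+j]=[n-i;j;n+1+i-j]$. (2) If $i<j$ and $i\ne0$: for $0\le t\le n-j$, after $t$ mutations the function is $[n-i-t,\,2n+1+i-j-t;\;n+1+t;\;j+t]$. Thus it starts as $[n-i,2n+1+i-j;n+1;j]$ and ends as $[j-i,n+i+1;2n+1-j;n]=[n-i,2n+1+i-j;j;n+1]$.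
   Context: **Flags.** $V=\mathbb C^{N}$, $N=2n+1$, with symmetric form $\langle e_i,e_{2n+2-i}\rangle=(-1)^{i-1}$, other pairings of basis vectors zero. $Spin_{2n+1}\to SO_{2n+1}\subset SL_{2n+1}$. A point of $\mathcal A_{SO_{2n+1}}$ is given by $v_1,\dots,v_n$ spanning isotropic subspaces (each $v_i$ modulo the previous ones), completed to a basis $v_1,\dots,v_{2n+1}$ of volume 1 with $\langle v_i,v_{2n+2-i}\rangle=(-1)^{i-1}$, other pairings zero; this gives $\mathcal A_{Spin_{2n+1}}\to\mathcal A_{SO_{2n+1}}\hookrightarrow\mathcal A_{SL_{2n+1}}$ and $\mathrm{Conf}_3\mathcal A_{Spin_{2n+1}}\to\mathrm{Conf}_3\mathcal A_{SL_{2n+1}}$ ($\mathrm{Conf}_3\mathcal A_G=G\backslash(G/U)^3$), along which functions are pulled back. Write $V_a=v_1\wedge\dots\wedge v_a$. **Square roots.** $\sqrt f$ is the function on $\mathrm{Conf}_3\mathcal A_{Spin_{2n+1}}$ with square $f$ that is positive on positive configurations $(U^-,h\overline{w_0}U^-,b\overline{w_0}U^-)$, $h\in H_{>0}$, $b\in B^-_{>0}$ (Lusztig positivity for the pinning mapping to $E_{\alpha_i}=E_{i,i+1}+E_{2n+1-i,2n+2-i}$ ($i<n$), $E_{\alpha_n}=\sqrt2(E_{n,n+1}+E_{n+1,n+2})$, $F_{\alpha_i}=E_{\alpha_i}^T$). **Three-flag functions.** Identify $\bigwedge^NV=\mathbb C$; $\phi_{p,q}:\bigwedge^{p+q}V\to\bigwedge^pV\otimes\bigwedge^qV$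 is the natural (signed shuffle) comultiplication. For three flags with forms $U_\bullet,V_\bullet,W_\bullet$: (i) if $a+b+c=N$, $[a;b;c]=U_a\wedge V_b\wedge W_c$; (ii) if $a+b+c=2N$, $[a;b;c]$ is obtained by applying $V_b\wedge-$, $W_c\wedge-$ to the two factors of $\phi_{N-b,N-c}(U_a)$ and multiplying; (iii) if $a+b+c+d=2N$ and $b\le N-c,N-d\le a$, $[a,b;c;d]=[b,a;c;d]$ is obtained by applying $U_b\wedge-\wedge W_d$, $U_a\wedge-$ to the two factors of $\phi_{a+c-N,N-a}(V_c)$ and multiplying. Convention: $[N,a;b;c]=[a;b;c]=[a,0;b;c]$. **Seed.** Vertices $x_{ij}$ ($0\le i\le n$, $1\le j\le n$), $y_k$ ($1\le k\le n$); frozen: all $y_k$, $x_{0j}$, $x_{nj}$. The vertices $x_{in}$ and $y_n$ are black, the others white. Solid arrows: $x_{ij}\to x_{i-1,j}$ ($1\le i\le n$); $x_{ij}\to x_{i,j-1}$ ($1\le i\le n-1$, $j\ge2$); $x_{i1}\to y_{n-i}$ ($1\le i\le n-1$); $y_n\to x_{1n}$; $x_{ij}\to x_{i+1,j+1}$ ($0\le i\le n-1$, $j\le n-1$); $x_{0n}\to y_n$; $y_k\to x_{n-k+1,1}$ ($1\le k\le n-1$). Dotted arrows: $x_{0j}\to x_{0,j-1}$, $x_{nj}\to x_{n,j-1}$, $y_k\to y_{k+1}$. An arrow $p\to q$ means $b_{pq}>0>b_{qp}$; $|b_{pq}|=2$ if $p$ is white and $q$ black, $|b_{pq}|=1$ otherwise;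 dotted arrows have half these values. Functions: $y_k$: $U_k\wedge V_{2n+1-k}$; $x_{0j}$: $[2n+1-j;0;j]$; $x_{ij}$, $i\ge j$: $[n-i;n+1+i-j;j]$; $x_{ij}$, $0<i<j$: $[n-i,2n+1+i-j;n+1;j]$; except that for $x_{in}$ and $y_n$ one takes the square root of these. **Mutation at unfrozen $k$.** $A_kA_k'=\prod_{b_{kj}>0}A_j^{b_{kj}}+\prod_{b_{kj}<0}A_j^{-b_{kj}}$; $b'_{ij}=-b_{ij}$ if $k\in\{i,j\}$, $b'_{ij}=b_{ij}$ if $b_{ik}b_{kj}\le0$, $b'_{ij}=b_{ij}+|b_{ik}|b_{kj}$ otherwise. *)

theory Defs
  imports Complex_Main
begin

section \<open>The quadratic space and its exterior algebra\<close>

text \<open>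
  Throughout \<open>V = \<complex>\<^sup>N\<close> with \<open>N = 2n+1\<close>. A vector is a function of its index, of which only the values
  on \<open>{1..N}\<close> are used. An element of the exterior algebra of \<open>V\<close> is the function sending a set
  \<open>S = {s\<^sub>1 < \<dots> < s\<^sub>k}\<close> to its coefficient at \<open>e\<^sub>S = e\<^bsub>s\<^sub>1\<^esub> \<and> \<dots> \<and> e\<^bsub>s\<^sub>k\<^esub>\<close>.
\<close>

type_synonym vec = "nat \<Rightarrow> complex"
type_synonym ext = "nat set \<Rightarrow> complex"

abbreviation NN :: "nat \<Rightarrow> nat" where
  "NN n \<equiv> 2 * n + 1"

definition unit_vec :: "nat \<Rightarrow> vec" where
  "unit_vec i = (\<lambda>k. if k = i then 1 else 0)"

definition bform :: "nat \<Rightarrow> vec \<Rightarrow> vec \<Rightarrow> complex" where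
  "bform n v w = (\<Sum>i = 1..NN n. (-1) ^ (i - 1) * v i * w (2 * n + 2 - i))"

text \<open>\<open>e\<^sub>S \<and> e\<^sub>T = shuffle_sign S T \<cdot> e\<^bsub>S \<union> T\<^esub>\<close> for disjoint \<open>S\<close>, \<open>T\<close>.\<close>

definition shuffle_sign :: "nat set \<Rightarrow> nat set \<Rightarrow> complex" where
  "shuffle_sign S T = (-1) ^ card {(s, t). s \<in> S \<and> t \<in> T \<and> t < s}"

definition wedge :: "ext \<Rightarrow> ext \<Rightarrow> ext" where
  "wedge x y = (\<lambda>R. \<Sum>S\<in>Pow R. shuffle_sign S (R - S) * x S * y (R - S))"

definition basis_ext :: "nat set \<Rightarrow> ext" where
  "basis_ext S = (\<lambda>R. if R = S then 1 else 0)"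

definition ext_of_vec :: "nat \<Rightarrow> vec \<Rightarrow> ext" where
  "ext_of_vec n v = (\<lambda>S. \<Sum>i = 1..NN n. v i * basis_ext {i} S)"

fun wedge_upto :: "nat \<Rightarrow> (nat \<Rightarrow> vec) \<Rightarrow> nat \<Rightarrow> ext" where
  "wedge_upto n v 0 = basis_ext {}"
| "wedge_upto n v (Suc a) = wedge (wedge_upto n v a) (ext_of_vec n (v (Suc a)))"

text \<open>The identification of the top exterior power with \<open>\<complex>\<close>, sending \<open>e\<^sub>1 \<and> \<dots> \<and> e\<^sub>N\<close> to 1.\<close>

definition vol :: "nat \<Rightarrow> ext \<Rightarrow> complex" where
  "vol n x = x {1..NN n}"

text \<open>
  The comultiplication \<open>\<phi>\<^bsub>p,q\<^esub>\<close>, with values in the tensor square (coefficient at \<open>e\<^sub>S \<otimes> e\<^sub>T\<close>). On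
  \<open>u\<^sub>1 \<and> \<dots> \<and> u\<^bsub>p+q\<^esub>\<close> it is the signed sum over all \<open>(p,q)\<close>-shuffles.
\<close>

definition comult :: "nat \<Rightarrow> nat \<Rightarrow> ext \<Rightarrow> nat set \<Rightarrow> nat set \<Rightarrow> complex" where
  "comult p q x = (\<lambda>S T. if card S = p \<and> card T = q \<and> S \<inter> T = {}
                          then shuffle_sign S T * x (S \<union> T) else 0)"

text \<open>The linear functional \<open>f \<otimes> g\<close> (for linear \<open>f\<close>, \<open>g\<close>) on the tensor square.\<close>

definition tensor_apply ::
  "nat \<Rightarrow> (ext \<Rightarrow> complex) \<Rightarrow> (ext \<Rightarrow> complex) \<Rightarrow> (nat set \<Rightarrow> nat set \<Rightarrow> complex) \<Rightarrow> complex" where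
  "tensor_apply n f g z =
     (\<Sum>S\<in>Pow {1..NN n}. \<Sum>T\<in>Pow {1..NN n}. z S T * f (basis_ext S) * g (basis_ext T))"


section \<open>Three-flag functions\<close>

text \<open>A flag with forms enters through its sequence of forms \<open>a \<mapsto> V\<^sub>a = v\<^sub>1 \<and> \<dots> \<and> v\<^sub>a\<close>.\<close>

definition triple ::
  "nat \<Rightarrow> (nat \<Rightarrow> ext) \<Rightarrow> (nat \<Rightarrow> ext) \<Rightarrow> (nat \<Rightarrow> ext) \<Rightarrow> nat \<Rightarrow> nat \<Rightarrow> nat \<Rightarrow> complex" where
  "triple n U V W a b c =
     (if a + b + c = NN n then vol n (wedge (wedge (U a) (V b)) (W c))
      else if a + b + c = 2 * NN n then
        tensor_apply n (\<lambda>x. vol n (wedge (V b) x)) (\<lambda>x. vol n (wedge (W c) x))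
          (comult (NN n - b) (NN n - c) (U a))
      else 0)"

definition quad_ordered ::
  "nat \<Rightarrow> (nat \<Rightarrow> ext) \<Rightarrow> (nat \<Rightarrow> ext) \<Rightarrow> (nat \<Rightarrow> ext) \<Rightarrow> nat \<Rightarrow> nat \<Rightarrow> nat \<Rightarrow> nat \<Rightarrow> complex" where
  "quad_ordered n U V W a b c d =
     tensor_apply n (\<lambda>x. vol n (wedge (wedge (U b) x) (W d))) (\<lambda>x. vol n (wedge (U a) x))
       (comult (a + c - NN n) (NN n - a) (V c))"

text \<open>
  \<open>[a,b;c;d]\<close>. The first four cases are the conventions \<open>[N,a;b;c] = [a;b;c] = [a,0;b;c]\<close> together with
  \<open>[a,b;c;d] = [b,a;c;d]\<close>.
\<close>

definition quad ::
  "nat \<Rightarrow> (nat \<Rightarrow> ext) \<Rightarrow> (nat \<Rightarrow> ext) \<Rightarrow> (nat \<Rightarrow> ext) \<Rightarrow> nat \<Rightarrow> nat \<Rightarrow> nat \<Rightarrow> nat \<Rightarrow> complex" where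
  "quad n U V W a b c d =
     (if a = NN n then triple n U V W b c d
      else if b = NN n then triple n U V W a c d
      else if b = 0 then triple n U V W a c d
      else if a = 0 then triple n U V W b c d
      else if a + b + c + d \<noteq> 2 * NN n then 0
      else if b \<le> NN n - c \<and> b \<le> NN n - d \<and> NN n - c \<le> a \<and> NN n - d \<le> a
        then quad_ordered n U V W a b c d
      else if a \<le> NN n - c \<and> a \<le> NN n - d \<and> NN n - c \<le> b \<and> NN n - d \<le> b
        then quad_ordered n U V W b a c d
      else 0)"


section \<open>The spin group\<close>

text \<open>
  The Clifford algebra of \<open>V\<close> (with \<open>v\<^sup>2 = \<langle>v,v\<rangle>\<close>) is realized by its faithful action on the exterior
  algebra, a vector \<open>v\<close> acting as the exterior product with \<open>v\<close> plus the contraction with \<open>\<langle>v,-\<rangle>\<close>.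
  Endomorphisms of the exterior algebra are matrices indexed by the subsets of \<open>{1..N}\<close>,
  with entries 0 at all other indices.
\<close>

type_synonym emat = "nat set \<Rightarrow> nat set \<Rightarrow> complex"

definition emul :: "nat \<Rightarrow> emat \<Rightarrow> emat \<Rightarrow> emat" where
  "emul n g h = (\<lambda>S T. \<Sum>R\<in>Pow {1..NN n}. g S R * h R T)"

definition eone :: "nat \<Rightarrow> emat" where
  "eone n = (\<lambda>S T. if S = T \<and> S \<subseteq> {1..NN n} then 1 else 0)"

definition cliff :: "nat \<Rightarrow> vec \<Rightarrow> emat" where
  "cliff n v = (\<lambda>S T. if S \<subseteq> {1..NN n} \<and> T \<subseteq> {1..NN n} then
      (\<Sum>i = 1..NN n. (if i \<notin> T \<and> S = insert i T then shuffle_sign {i} T * v i else 0)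
                   + (if i \<notin> S \<and> T = insert i S then shuffle_sign {i} S * bform n v (unit_vec i) else 0))
     else 0)"

inductive_set spin :: "nat \<Rightarrow> emat set" for n :: nat where
  one: "eone n \<in> spin n"
| mult: "g \<in> spin n \<Longrightarrow> bform n v v = 1 \<Longrightarrow> bform n w w = 1 \<Longrightarrow>
           emul n (emul n g (cliff n v)) (cliff n w) \<in> spin n"

text \<open>
  The column \<open>\<pi>(g) e\<^sub>i\<close> of the image of \<open>g\<close> under \<open>\<pi> : Spin\<^sub>N \<rightarrow> SO\<^sub>N\<close>, which is characterized by
  \<open>g v g\<^sup>-\<^sup>1 = \<pi>(g) v\<close> in the Clifford algebra.
\<close>

definition so_column :: "nat \<Rightarrow> emat \<Rightarrow> nat \<Rightarrow> vec" where
  "so_column n g i = (THE v. (\<forall>k. k \<notin> {1..NN n} \<longrightarrow> v k = 0) \<and>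
                         emul n g (cliff n (unit_vec i)) = emul n (cliff n v) g)"

text \<open>
  The infinitesimal version of \<open>\<pi>\<^sup>-\<^sup>1\<close>: \<open>E\<close> in the Lie algebra of \<open>SO\<^sub>N\<close> lifts to
  \<open>1/4 \<Sum>\<^sub>i (E e\<^sub>i) e\<^sup>i\<close> in the Clifford algebra, whose commutator with \<open>v\<close> is \<open>E v\<close>. Here
  \<open>e\<^sup>i = (-1)\<^bsup>i-1\<^esup> e\<^bsub>N+1-i\<^esub>\<close> is the dual basis.
\<close>

definition spin_lie :: "nat \<Rightarrow> (nat \<Rightarrow> nat \<Rightarrow> complex) \<Rightarrow> emat" where
  "spin_lie n E = (\<lambda>S T. \<Sum>i = 1..NN n.
      (1 / 4) * emul n (cliff n (\<lambda>k. E k i))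
                       (cliff n (\<lambda>k. (-1) ^ (i - 1) * unit_vec (2 * n + 2 - i) k)) S T)"

definition E_root :: "nat \<Rightarrow> nat \<Rightarrow> nat \<Rightarrow> nat \<Rightarrow> complex" where
  "E_root n i = (\<lambda>r c.
     if i < n then (if (r, c) = (i, i + 1) \<or> (r, c) = (2 * n + 1 - i, 2 * n + 2 - i) then 1 else 0)
     else (if (r, c) = (n, n + 1) \<or> (r, c) = (n + 1, n + 2) then of_real (sqrt 2) else 0))"

text \<open>
  The one-parameter subgroups \<open>exp (t E\<^sub>i)\<close> and \<open>exp (t F\<^sub>i)\<close> of the spin group, \<open>F\<^sub>i\<close> being the transpose
  of \<open>E\<^sub>i\<close>; the exponential series stops because the lifts of \<open>E\<^sub>i\<close> and \<open>F\<^sub>i\<close> to the Clifford algebra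
  have square 0.
\<close>

definition x_root :: "nat \<Rightarrow> nat \<Rightarrow> complex \<Rightarrow> emat" where
  "x_root n i t = (\<lambda>S T. eone n S T + t * spin_lie n (E_root n i) S T)"

definition y_root :: "nat \<Rightarrow> nat \<Rightarrow> complex \<Rightarrow> emat" where
  "y_root n i t = (\<lambda>S T. eone n S T + t * spin_lie n (\<lambda>r c. E_root n i c r) S T)"

inductive_set unip :: "nat \<Rightarrow> emat set" for n :: nat where
  one: "eone n \<in> unip n"
| mult: "u \<in> unip n \<Longrightarrow> i \<in> {1..n} \<Longrightarrow> emul n u (x_root n i t) \<in> unip n"


section \<open>Functions on the space of configurations of three flags\<close>

text \<open>
  A point of \<open>Conf\<^sub>3 = G \ (G/U)\<^sup>3\<close> is represented by a triple in \<open>G\<^sup>3\<close>. The coset \<open>g U\<close> is the flag with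
  basis \<open>\<pi>(g) e\<^sub>1, \<dots>, \<pi>(g) e\<^sub>N\<close>.
\<close>

type_synonym point = "emat \<times> emat \<times> emat"

definition spin3 :: "nat \<Rightarrow> point set" where
  "spin3 n = spin n \<times> spin n \<times> spin n"

definition flag_form :: "nat \<Rightarrow> emat \<Rightarrow> nat \<Rightarrow> ext" where
  "flag_form n g = wedge_upto n (so_column n g)"

definition triple_fun :: "nat \<Rightarrow> nat \<Rightarrow> nat \<Rightarrow> nat \<Rightarrow> point \<Rightarrow> complex" where
  "triple_fun n a b c = (\<lambda>(g1, g2, g3).
     triple n (flag_form n g1) (flag_form n g2) (flag_form n g3) a b c)"

definition quad_fun :: "nat \<Rightarrow> nat \<Rightarrow> nat \<Rightarrow> nat \<Rightarrow> nat \<Rightarrow> point \<Rightarrow> complex" where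
  "quad_fun n a b c d = (\<lambda>(g1, g2, g3).
     quad n (flag_form n g1) (flag_form n g2) (flag_form n g3) a b c d)"

text \<open>The spin group is a closed subvariety of the space of matrices.\<close>

inductive poly_fun :: "(point \<Rightarrow> complex) \<Rightarrow> bool" where
  const: "poly_fun (\<lambda>_. c)"
| coord1: "poly_fun (\<lambda>(g1, g2, g3). g1 S T)"
| coord2: "poly_fun (\<lambda>(g1, g2, g3). g2 S T)"
| coord3: "poly_fun (\<lambda>(g1, g2, g3). g3 S T)"
| add: "poly_fun f \<Longrightarrow> poly_fun g \<Longrightarrow> poly_fun (\<lambda>p. f p + g p)"
| mult: "poly_fun f \<Longrightarrow> poly_fun g \<Longrightarrow> poly_fun (\<lambda>p. f p * g p)"

definition regular_fun :: "nat \<Rightarrow> (point \<Rightarrow> complex) \<Rightarrow> bool" where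
  "regular_fun n f \<longleftrightarrow> (\<exists>P. poly_fun P \<and> (\<forall>p\<in>spin3 n. f p = P p))"

definition conf_fun :: "nat \<Rightarrow> (point \<Rightarrow> complex) \<Rightarrow> bool" where
  "conf_fun n f \<longleftrightarrow> regular_fun n f \<and>
     (\<forall>g\<in>spin n. \<forall>g1\<in>spin n. \<forall>g2\<in>spin n. \<forall>g3\<in>spin n. \<forall>u1\<in>unip n. \<forall>u2\<in>unip n. \<forall>u3\<in>unip n.
        f (emul n g (emul n g1 u1), emul n g (emul n g2 u2), emul n g (emul n g3 u3)) = f (g1, g2, g3))"

text \<open>
  Equality of rational functions: \<open>Spin\<^sub>N\<^sup>3\<close> is irreducible, so two rational functions are equal iff
  they agree on a nonempty principal open subset. This makes pointwise division harmless.
\<close>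

definition rat_eq :: "nat \<Rightarrow> (point \<Rightarrow> complex) \<Rightarrow> (point \<Rightarrow> complex) \<Rightarrow> bool" where
  "rat_eq n f g \<longleftrightarrow> (\<exists>h. regular_fun n h \<and> (\<exists>p\<in>spin3 n. h p \<noteq> 0) \<and>
     (\<forall>p\<in>spin3 n. h p \<noteq> 0 \<longrightarrow> f p = g p))"


section \<open>Positive configurations and square roots\<close>

definition eprod :: "nat \<Rightarrow> emat list \<Rightarrow> emat" where
  "eprod n gs = foldr (emul n) gs (eone n)"

text \<open>The images of \<open>(0, -1; 1, 0)\<close> and of \<open>diag(t, 1/t)\<close> under the i-th \<open>SL\<^sub>2 \<rightarrow> G\<close>.\<close>

definition s_bar :: "nat \<Rightarrow> nat \<Rightarrow> emat" where
  "s_bar n i = eprod n [x_root n i (-1), y_root n i 1, x_root n i (-1)]"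

definition coroot :: "nat \<Rightarrow> nat \<Rightarrow> complex \<Rightarrow> emat" where
  "coroot n i t = eprod n [x_root n i t, y_root n i (- 1 / t), x_root n i t, s_bar n i]"

text \<open>\<open>(s\<^sub>1 \<dots> s\<^sub>n)\<^sup>n\<close> is a reduced word for the longest Weyl group element.\<close>

definition w0_word :: "nat \<Rightarrow> nat list" where
  "w0_word n = concat (replicate n [1..<Suc n])"

definition w0_bar :: "nat \<Rightarrow> emat" where
  "w0_bar n = eprod n (map (s_bar n) (w0_word n))"

definition H_pos :: "nat \<Rightarrow> emat set" where
  "H_pos n = {eprod n (map (\<lambda>i. coroot n i (of_real (t i))) [1..<Suc n]) | t :: nat \<Rightarrow> real.
                \<forall>i\<in>{1..n}. 0 < t i}"

definition U_minus_pos :: "nat \<Rightarrow> emat set" where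
  "U_minus_pos n = {eprod n (map2 (\<lambda>i t. y_root n i (of_real t)) (w0_word n) ts) | ts :: real list.
                length ts = length (w0_word n) \<and> (\<forall>t\<in>set ts. 0 < t)}"

definition B_minus_pos :: "nat \<Rightarrow> emat set" where
  "B_minus_pos n = {emul n u h | u h. u \<in> U_minus_pos n \<and> h \<in> H_pos n}"

text \<open>
  \<open>(U\<^sup>-, h w\<^sub>0 U\<^sup>-, b w\<^sub>0 U\<^sup>-)\<close>, read in \<open>(G/U)\<^sup>3\<close> through \<open>G/U\<^sup>- \<cong> G/U\<close>, \<open>g U\<^sup>- \<mapsto> g w\<^sub>0 U\<close>
  (where \<open>w\<^sub>0\<close> stands for its lift \<open>w0_bar\<close>).
\<close>

definition positive_configs :: "nat \<Rightarrow> point set" where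
  "positive_configs n =
     {(w0_bar n, emul n (emul n h (w0_bar n)) (w0_bar n), emul n (emul n b (w0_bar n)) (w0_bar n)) | h b.
        h \<in> H_pos n \<and> b \<in> B_minus_pos n}"

text \<open>\<open>r = \<surd>f\<close>; this determines \<open>r\<close> on \<open>spin3 n\<close>, as a regular square root is unique up to sign.\<close>

definition is_sqrt_fun :: "nat \<Rightarrow> (point \<Rightarrow> complex) \<Rightarrow> (point \<Rightarrow> complex) \<Rightarrow> bool" where
  "is_sqrt_fun n f r \<longleftrightarrow> conf_fun n r \<and> (\<forall>p\<in>spin3 n. (r p)\<^sup>2 = f p) \<and>
     (\<forall>p\<in>positive_configs n. \<exists>c>0. r p = of_real c)"


section \<open>The initial seed\<close>

datatype vertex = X nat nat | Y nat

definition vertices :: "nat \<Rightarrow> vertex set" where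
  "vertices n = {X i j | i j. i \<le> n \<and> 1 \<le> j \<and> j \<le> n} \<union> {Y k | k. 1 \<le> k \<and> k \<le> n}"

definition black :: "nat \<Rightarrow> vertex \<Rightarrow> bool" where
  "black n v \<longleftrightarrow> (case v of X i j \<Rightarrow> j = n | Y k \<Rightarrow> k = n)"

definition solid_arrows :: "nat \<Rightarrow> (vertex \<times> vertex) set" where
  "solid_arrows n =
     {(X i j, X (i - 1) j) | i j. 1 \<le> i \<and> i \<le> n \<and> 1 \<le> j \<and> j \<le> n}
   \<union> {(X i j, X i (j - 1)) | i j. 1 \<le> i \<and> i \<le> n - 1 \<and> 2 \<le> j \<and> j \<le> n}
   \<union> {(X i 1, Y (n - i)) | i. 1 \<le> i \<and> i \<le> n - 1}
   \<union> {(Y n, X 1 n)}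
   \<union> {(X i j, X (i + 1) (j + 1)) | i j. i + 1 \<le> n \<and> 1 \<le> j \<and> j \<le> n - 1}
   \<union> {(X 0 n, Y n)}
   \<union> {(Y k, X (n - k + 1) 1) | k. 1 \<le> k \<and> k \<le> n - 1}"

definition dotted_arrows :: "nat \<Rightarrow> (vertex \<times> vertex) set" where
  "dotted_arrows n =
     {(X 0 j, X 0 (j - 1)) | j. 2 \<le> j \<and> j \<le> n}
   \<union> {(X n j, X n (j - 1)) | j. 2 \<le> j \<and> j \<le> n}
   \<union> {(Y k, Y (k + 1)) | k. 1 \<le> k \<and> k \<le> n - 1}"

definition arrow_weight :: "nat \<Rightarrow> vertex \<Rightarrow> vertex \<Rightarrow> rat" where
  "arrow_weight n p q = (if \<not> black n p \<and> black n q then 2 else 1)"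

definition initial_matrix :: "nat \<Rightarrow> vertex \<Rightarrow> vertex \<Rightarrow> rat" where
  "initial_matrix n p q =
     (if (p, q) \<in> solid_arrows n then arrow_weight n p q
      else if (q, p) \<in> solid_arrows n then - arrow_weight n p q
      else if (p, q) \<in> dotted_arrows n then arrow_weight n p q / 2
      else if (q, p) \<in> dotted_arrows n then - (arrow_weight n p q / 2)
      else 0)"

text \<open>The functions of the initial seed, before taking square roots at the black vertices.\<close>

definition base_fun :: "nat \<Rightarrow> vertex \<Rightarrow> point \<Rightarrow> complex" where
  "base_fun n v = (case v of
      Y k \<Rightarrow> (\<lambda>(g1, g2, g3). vol n (wedge (flag_form n g1 k) (flag_form n g2 (2 * n + 1 - k))))
    | X i j \<Rightarrow> (if i = 0 then triple_fun n (2 * n + 1 - j) 0 j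
                else if j \<le> i then triple_fun n (n - i) (n + 1 + i - j) j
                else quad_fun n (n - i) (2 * n + 1 + i - j) (n + 1) j))"

definition initial_functions :: "nat \<Rightarrow> (vertex \<Rightarrow> point \<Rightarrow> complex) \<Rightarrow> bool" where
  "initial_functions n A \<longleftrightarrow> (\<forall>v\<in>vertices n.
      if black n v then is_sqrt_fun n (base_fun n v) (A v)
      else (\<forall>p\<in>spin3 n. A v p = base_fun n v p))"


section \<open>Mutation\<close>

type_synonym seed = "(vertex \<Rightarrow> vertex \<Rightarrow> rat) \<times> (vertex \<Rightarrow> point \<Rightarrow> complex)"

definition mutate_matrix :: "vertex \<Rightarrow> (vertex \<Rightarrow> vertex \<Rightarrow> rat) \<Rightarrow> vertex \<Rightarrow> vertex \<Rightarrow> rat" where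
  "mutate_matrix k b i j =
     (if k = i \<or> k = j then - b i j
      else if b i k * b k j \<le> 0 then b i j
      else b i j + \<bar>b i k\<bar> * b k j)"

text \<open>The row of an unfrozen \<open>k\<close> is integral (half-integers occur only between frozen vertices).\<close>

definition mutate_fun ::
  "nat \<Rightarrow> vertex \<Rightarrow> (vertex \<Rightarrow> vertex \<Rightarrow> rat) \<Rightarrow> (vertex \<Rightarrow> point \<Rightarrow> complex) \<Rightarrow> point \<Rightarrow> complex" where
  "mutate_fun n k b A = (\<lambda>p.
     ((\<Prod>j\<in>{j \<in> vertices n. b k j > 0}. A j p ^ nat \<lfloor>b k j\<rfloor>)
      + (\<Prod>j\<in>{j \<in> vertices n. b k j < 0}. A j p ^ nat \<lfloor>- b k j\<rfloor>)) / A k p)"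

definition mutate :: "nat \<Rightarrow> vertex \<Rightarrow> seed \<Rightarrow> seed" where
  "mutate n k s = (mutate_matrix k (fst s), (snd s)(k := mutate_fun n k (fst s) (snd s)))"

definition mutate_along :: "nat \<Rightarrow> vertex list \<Rightarrow> seed \<Rightarrow> seed" where
  "mutate_along n ks s = fold (mutate n) ks s"

definition layer :: "nat \<Rightarrow> nat \<Rightarrow> vertex set" where
  "layer n m = {X i j | i j. 1 \<le> i \<and> i \<le> n - 1 \<and> 1 \<le> j \<and> j \<le> n - 1 \<and> max i j = m}"

text \<open>
  The sequence of mutations, for \<open>r = n-1, \<dots>, 1\<close> and \<open>m = 1, \<dots>, r\<close>; \<open>L r m\<close> lists the layer \<open>m\<close> in the
  order in which it is mutated in round \<open>r\<close>.
\<close>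

definition layer_orders :: "nat \<Rightarrow> (nat \<Rightarrow> nat \<Rightarrow> vertex list) \<Rightarrow> bool" where
  "layer_orders n L \<longleftrightarrow>
     (\<forall>r m. 1 \<le> m \<longrightarrow> m \<le> r \<longrightarrow> r \<le> n - 1 \<longrightarrow> distinct (L r m) \<and> set (L r m) = layer n m)"

definition mutation_sequence :: "nat \<Rightarrow> (nat \<Rightarrow> nat \<Rightarrow> vertex list) \<Rightarrow> vertex list" where
  "mutation_sequence n L = concat (map (\<lambda>r. concat (map (L r) [1..<Suc r])) (rev [1..<n]))"

text \<open>The function attached to \<open>v\<close> after the first \<open>l\<close> mutations of the sequence.\<close>

definition function_at ::
  "nat \<Rightarrow> (vertex \<Rightarrow> point \<Rightarrow> complex) \<Rightarrow> (nat \<Rightarrow> nat \<Rightarrow> vertex list) \<Rightarrow> nat \<Rightarrow> vertex \<Rightarrow> point \<Rightarrow> complex" where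
  "function_at n A L l v = snd (mutate_along n (take l (mutation_sequence n L)) (initial_matrix n, A)) v"

definition times_mutated :: "nat \<Rightarrow> (nat \<Rightarrow> nat \<Rightarrow> vertex list) \<Rightarrow> nat \<Rightarrow> vertex \<Rightarrow> nat" where
  "times_mutated n L l v = count_list (take l (mutation_sequence n L)) v"

end

theory Submission
  imports Defs "HOL-Computational_Algebra.Polynomial"
begin

text \<open>
  Up to sign, \<open>[a,b;c;d]\<close> is the coefficient of the volume form in the exterior algebra of
  \<open>V \<oplus> V = \<complex>\<^sup>2 \<otimes> V\<close> of the product of \<open>U\<^sub>b \<and> W\<^sub>d\<close> in the first copy of \<open>V\<close>, \<open>V\<^sub>c\<close> on the diagonal and
  \<open>U\<^sub>a\<close> in the second copy. The functions in an exchange relation differ by two of the four next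
  vectors of these products, so that the exchange relation becomes the three-term Pluecker relation.
  Linear maps of the factor \<open>\<complex>\<^sup>2\<close> exchange the roles of \<open>V\<^sub>c\<close> and \<open>W\<^sub>d\<close>, which gives the relation on the
  diagonal \<open>i = j\<close>. The flags of \<open>SO\<^sub>N\<close> are fixed by the Hodge star, and this yields the two dualities.

  Row \<open>(i, j)\<close> of the exchange matrix has the same hexagonal shape everywhere if one allows the virtual positions
  \<open>i = 0\<close> and \<open>j = 0\<close>, at which the three-flag function is a product of two frozen variables, and counts a black
  vertex twice in the monomials. Mutation of a layer changes the rows in this layer and its two neighbours only.

  Division is harmless on the locus where none of the functions vanishes. It contains the configuration of the
  reversed flag, the standard flag, and the flag of the exponential of the nilpotent shift.
\<close>

section \<open>Exterior multiplication and contraction\<close>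

text \<open>The computation takes place at one point where no function of the family vanishes: there
  the cluster variables are complex numbers and an exchange relation is an equation between them.
  Passing back to rational functions needs two facts about \<open>Spin\<close>. The locus must be
  cut out by a regular function, although the columns of \<pi>(g) are given only by a definite
  description; this is why they are rewritten as polynomials in the entries of g. And it must be
  nonempty, which requires elements of the spin group with prescribed columns, hence the
  decomposition of isometries into reflections.

  The main obstacle is signs: the comultiplication, the passage to the doubled space and the
  reordering of factors each produce one. That N is odd is what makes them cancel in the dualities
  and at the degenerate indices; in the exchange relation all three products carry the same sign.

  Square roots never have to be handled as functions: in the exchange relations that occur, a black
  variable has exponent 2.\<close>

definition above_sign :: "nat set \<Rightarrow> nat \<Rightarrow> complex" where
  "above_sign S s = (-1) ^ card {t \<in> S. s < t}"

text \<open>Exterior multiplication by v on the right; \<open>above_sign\<close> is the sign of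
  moving e_s to the end of e_S.\<close>

definition wedge_right :: "vec \<Rightarrow> ext \<Rightarrow> ext" where
  "wedge_right v x = (\<lambda>S. \<Sum>s\<in>S. above_sign S s * v s * x (S - {s}))"

text \<open>Contraction from the right with the functional whose coordinates on I are \<xi>. The set
  I is a parameter because the same calculus serves V, its double and single coordinates.\<close>

definition contract :: "nat set \<Rightarrow> vec \<Rightarrow> ext \<Rightarrow> ext" where
  "contract I \<xi> x = (\<lambda>S. \<Sum>s\<in>I - S. above_sign S s * \<xi> s * x (insert s S))"

lemma above_sign_sq [simp]: "above_sign S s * above_sign S s = 1"
  by (simp add: above_sign_def flip: power_add)

lemma above_sign_sq_left [simp]: "above_sign S s * (above_sign S s * z) = z"
  by (simp flip: mult.assoc)

lemma above_sign_insert: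
  assumes "finite S" "t \<notin> S"
  shows "above_sign (insert t S) s = (if s < t then - above_sign S s else above_sign S s)"
proof -
  have "{u \<in> insert t S. s < u} = (if s < t then insert t {u \<in> S. s < u} else {u \<in> S. s < u})"
    by auto
  then show ?thesis using assms by (simp add: above_sign_def)
qed

lemma above_sign_remove:
  assumes "finite S" "t \<in> S"
  shows "above_sign (S - {t}) s = (if s < t then - above_sign S s else above_sign S s)"
  using above_sign_insert[of "S - {t}" t s] assms by (simp add: insert_absorb split: if_splits)

lemma sum_swap_Diff:
  fixes f :: "'a \<Rightarrow> 'a \<Rightarrow> 'b::comm_monoid_add"
  assumes "finite S"
  shows "(\<Sum>s\<in>S. \<Sum>t\<in>S - {s}. f s t) = (\<Sum>s\<in>S. \<Sum>t\<in>S - {s}. f t s)"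
proof -
  have "(\<Sum>s\<in>S. \<Sum>t\<in>S - {s}. f s t) = (\<Sum>s\<in>S. \<Sum>t\<in>S. if t \<noteq> s then f s t else 0)"
    by (rule sum.cong[OF refl], rule sum.mono_neutral_cong_left) (use assms in auto)
  also have "\<dots> = (\<Sum>t\<in>S. \<Sum>s\<in>S. if t \<noteq> s then f s t else 0)" by (rule sum.swap)
  also have "\<dots> = (\<Sum>t\<in>S. \<Sum>s\<in>S - {t}. f s t)"
    by (rule sum.cong[OF refl], rule sum.mono_neutral_cong_right) (use assms in auto)
  finally show ?thesis .
qed

lemma wedge_right_infinite: "infinite S \<Longrightarrow> wedge_right v x S = 0"
  by (simp add: wedge_right_def)

text \<open>Both sides are sums over ordered pairs of distinct indices of S. Removing one index
  changes the sign of the other only if the other is smaller, so precisely one of the two orders of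
  removal acquires a minus sign.\<close>

lemma wedge_right_anticommute: "wedge_right v (wedge_right w x) = (\<lambda>S. - wedge_right w (wedge_right v x) S)"
proof
  fix S :: "nat set"
  show "wedge_right v (wedge_right w x) S = - wedge_right w (wedge_right v x) S"
  proof (cases "finite S")
    case True
    have A: "wedge_right v (wedge_right w x) S = (\<Sum>s\<in>S. \<Sum>t\<in>S - {s}.
        above_sign S s * above_sign (S - {s}) t * v s * w t * x (S - {s} - {t}))" for v w
      by (simp add: wedge_right_def sum_distrib_left mult_ac)
    have "wedge_right v (wedge_right w x) S = (\<Sum>s\<in>S. \<Sum>t\<in>S - {s}.
        above_sign S t * above_sign (S - {t}) s * v t * w s * x (S - {t} - {s}))"
      unfolding A by (rule sum_swap_Diff[OF True])
    also have "\<dots> = (\<Sum>s\<in>S. \<Sum>t\<in>S - {s}.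
        - (above_sign S s * above_sign (S - {s}) t * w s * v t * x (S - {s} - {t})))"
    proof (intro sum.cong refl)
      fix s t assume "s \<in> S" "t \<in> S - {s}"
      moreover have "S - {t} - {s} = S - {s} - {t}" by auto
      ultimately show "above_sign S t * above_sign (S - {t}) s * v t * w s * x (S - {t} - {s})
          = - (above_sign S s * above_sign (S - {s}) t * w s * v t * x (S - {s} - {t}))"
        using True by (auto simp: above_sign_remove)
    qed
    also have "\<dots> = - wedge_right w (wedge_right v x) S"
      unfolding A by (simp add: sum_negf)
    finally show ?thesis .
  qed (simp add: wedge_right_infinite)
qed

lemma wedge_right_twice: "wedge_right v (wedge_right v x) = (\<lambda>S. 0)"
  using wedge_right_anticommute[of v v x] by (auto simp: fun_eq_iff)

lemma contract_anticommute:
  assumes I: "finite I" and S: "finite S"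
  shows "contract I \<xi> (contract I \<zeta> x) S = - contract I \<zeta> (contract I \<xi> x) S"
proof -
  have I': "finite (I - S)" using I by simp
  have A: "contract I \<xi> (contract I \<zeta> x) S = (\<Sum>s\<in>I - S. \<Sum>t\<in>I - S - {s}.
      above_sign S s * above_sign (insert s S) t * \<xi> s * \<zeta> t * x (insert t (insert s S)))" for \<xi> \<zeta>
    unfolding contract_def sum_distrib_left
    by (intro sum.cong) (auto simp: mult_ac)
  have "contract I \<xi> (contract I \<zeta> x) S = (\<Sum>s\<in>I - S. \<Sum>t\<in>I - S - {s}.
      above_sign S t * above_sign (insert t S) s * \<xi> t * \<zeta> s * x (insert s (insert t S)))"
    unfolding A by (rule sum_swap_Diff[OF I'])
  also have "\<dots> = (\<Sum>s\<in>I - S. \<Sum>t\<in>I - S - {s}.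
      - (above_sign S s * above_sign (insert s S) t * \<zeta> s * \<xi> t * x (insert t (insert s S))))"
  proof (intro sum.cong refl)
    fix s t assume "s \<in> I - S" "t \<in> I - S - {s}"
    moreover have "insert s (insert t S) = insert t (insert s S)" by auto
    ultimately show "above_sign S t * above_sign (insert t S) s * \<xi> t * \<zeta> s * x (insert s (insert t S))
        = - (above_sign S s * above_sign (insert s S) t * \<zeta> s * \<xi> t * x (insert t (insert s S)))"
      using S by (auto simp: above_sign_insert)
  qed
  also have "\<dots> = - contract I \<zeta> (contract I \<xi> x) S"
    unfolding A by (simp add: sum_negf)
  finally show ?thesis .
qed

text \<open>The Clifford relation between multiplication and contraction. Off-diagonal terms cancel;
  the diagonal ones come from the left side for indices outside S and from the right side for
  indices in S, and together make up the full pairing.\<close>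

lemma contract_wedge_right:
  assumes I: "finite I" and S: "finite S"
  shows "contract I \<xi> (wedge_right v x) S = (\<Sum>s\<in>I. \<xi> s * v s) * x S - wedge_right v (contract I \<xi> x) S"
proof -
  let ?c = "\<lambda>s t. above_sign S s * above_sign (insert s S) t * \<xi> s * v t * x (insert s S - {t})"
  have "contract I \<xi> (wedge_right v x) S = (\<Sum>s\<in>I - S. \<Sum>t\<in>insert s S. ?c s t)"
    by (simp add: contract_def wedge_right_def sum_distrib_left mult_ac)
  also have "\<dots> = (\<Sum>s\<in>I - S. \<xi> s * v s * x S + (\<Sum>t\<in>S. ?c s t))"
  proof (rule sum.cong[OF refl])
    fix s assume "s \<in> I - S"
    then show "(\<Sum>t\<in>insert s S. ?c s t) = \<xi> s * v s * x S + (\<Sum>t\<in>S. ?c s t)"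
      using S by (simp add: above_sign_insert)
  qed
  finally have 1: "contract I \<xi> (wedge_right v x) S =
      (\<Sum>s\<in>I - S. \<xi> s * v s * x S) + (\<Sum>s\<in>I - S. \<Sum>t\<in>S. ?c s t)"
    by (simp add: sum.distrib)
  let ?d = "\<lambda>t s. above_sign S t * above_sign (S - {t}) s * v t * \<xi> s * x (insert s (S - {t}))"
  have "wedge_right v (contract I \<xi> x) S = (\<Sum>t\<in>S. \<Sum>s\<in>I - (S - {t}). ?d t s)"
    by (simp add: contract_def wedge_right_def sum_distrib_left mult_ac)
  also have "\<dots> = (\<Sum>t\<in>S. (if t \<in> I then \<xi> t * v t * x S else 0) + (\<Sum>s\<in>I - S. ?d t s))"
  proof (rule sum.cong[OF refl])
    fix t assume t: "t \<in> S"
    show "(\<Sum>s\<in>I - (S - {t}). ?d t s) = (if t \<in> I then \<xi> t * v t * x S else 0) + (\<Sum>s\<in>I - S. ?d t s)"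
    proof (cases "t \<in> I")
      case True
      then have "I - (S - {t}) = insert t (I - S)" using t by auto
      then show ?thesis using t True I S
        by (simp add: above_sign_remove insert_absorb)
    next
      case False
      then have "I - (S - {t}) = I - S" by auto
      then show ?thesis using False by simp
    qed
  qed
  also have "\<dots> = (\<Sum>t\<in>I \<inter> S. \<xi> t * v t * x S) + (\<Sum>t\<in>S. \<Sum>s\<in>I - S. ?d t s)"
  proof -
    have "(\<Sum>t\<in>S. if t \<in> I then \<xi> t * v t * x S else 0) = (\<Sum>t\<in>I \<inter> S. \<xi> t * v t * x S)"
      by (rule sum.mono_neutral_cong_right) (use S in auto)
    then show ?thesis by (simp add: sum.distrib)
  qed
  also have "(\<Sum>t\<in>S. \<Sum>s\<in>I - S. ?d t s) = (\<Sum>s\<in>I - S. \<Sum>t\<in>S. - ?c s t)"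
  proof (subst sum.swap, intro sum.cong refl)
    fix s t assume st: "s \<in> I - S" "t \<in> S"
    then have "insert s (S - {t}) = insert s S - {t}" by auto
    then show "?d t s = - ?c s t" using st S by (auto simp: above_sign_remove above_sign_insert)
  qed
  finally have 2: "wedge_right v (contract I \<xi> x) S =
      (\<Sum>t\<in>I \<inter> S. \<xi> t * v t * x S) - (\<Sum>s\<in>I - S. \<Sum>t\<in>S. ?c s t)"
    by (simp add: sum_negf)
  have "(\<Sum>s\<in>I. \<xi> s * v s) = (\<Sum>s\<in>I \<inter> S. \<xi> s * v s) + (\<Sum>s\<in>I - S. \<xi> s * v s)"
    by (rule sum.Int_Diff[OF I])
  then have "(\<Sum>s\<in>I. \<xi> s * v s) * x S = (\<Sum>s\<in>I - S. \<xi> s * v s * x S) + (\<Sum>t\<in>I \<inter> S. \<xi> t * v t * x S)"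
    by (simp add: distrib_right sum_distrib_right)
  then show ?thesis using 1 2 by simp
qed

lemma wedge_right_add: "wedge_right v (\<lambda>S. x S + y S) = (\<lambda>S. wedge_right v x S + wedge_right v y S)"
  by (simp add: wedge_right_def fun_eq_iff algebra_simps sum.distrib)

lemma wedge_right_scale: "wedge_right v (\<lambda>S. c * x S) = (\<lambda>S. c * wedge_right v x S)"
  by (simp add: wedge_right_def fun_eq_iff sum_distrib_left mult_ac)

lemma wedge_right_add_vec: "wedge_right (\<lambda>k. v k + w k) x = (\<lambda>S. wedge_right v x S + wedge_right w x S)"
  by (simp add: wedge_right_def fun_eq_iff algebra_simps sum.distrib)

lemma wedge_right_scale_vec: "wedge_right (\<lambda>k. c * v k) x = (\<lambda>S. c * wedge_right v x S)"
  by (simp add: wedge_right_def fun_eq_iff sum_distrib_left mult_ac)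

lemma contract_add: "contract I \<xi> (\<lambda>S. x S + y S) = (\<lambda>S. contract I \<xi> x S + contract I \<xi> y S)"
  by (simp add: contract_def fun_eq_iff algebra_simps sum.distrib)

lemma contract_scale: "contract I \<xi> (\<lambda>S. c * x S) = (\<lambda>S. c * contract I \<xi> x S)"
  by (simp add: contract_def fun_eq_iff sum_distrib_left mult_ac)

section \<open>Exterior products of lists of vectors\<close>

definition wedge_list :: "vec list \<Rightarrow> ext" where
  "wedge_list vs = foldl (\<lambda>x v. wedge_right v x) (basis_ext {}) vs"

lemma wedge_list_Nil [simp]: "wedge_list [] = basis_ext {}"
  by (simp add: wedge_list_def)

lemma wedge_list_snoc [simp]: "wedge_list (vs @ [v]) = wedge_right v (wedge_list vs)"
  by (simp add: wedge_list_def)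

lemma wedge_list_infinite: "infinite S \<Longrightarrow> wedge_list vs S = 0"
  by (cases vs rule: rev_cases) (auto simp: wedge_right_infinite basis_ext_def)

lemma wedge_list_degree: "wedge_list vs S \<noteq> 0 \<Longrightarrow> card S = length vs"
proof (induction vs arbitrary: S rule: rev_induct)
  case (snoc v vs)
  then obtain s where s: "s \<in> S" "wedge_list vs (S - {s}) \<noteq> 0"
    by (force simp: wedge_right_def elim: sum.not_neutral_contains_not_neutral)
  moreover have "finite S" using snoc.prems wedge_list_infinite by blast
  ultimately show ?case using snoc.IH[of "S - {s}"]
    by (metis Suc_eq_plus1 card_Suc_Diff1 length_append_singleton Suc_eq_plus1)
qed (simp add: basis_ext_def split: if_splits)

lemma wedge_list_support: 
  assumes "\<And>v k. v \<in> set vs \<Longrightarrow> k \<notin> I \<Longrightarrow> v k = 0" "\<not> S \<subseteq> I"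
  shows "wedge_list vs S = 0"
  using assms
proof (induction vs arbitrary: S rule: rev_induct)
  case (snoc v vs)
  obtain k where k: "k \<in> S" "k \<notin> I" using snoc.prems(2) by blast
  have "v s * wedge_list vs (S - {s}) = 0" if "s \<in> S" for s
  proof (cases "s = k")
    case True then show ?thesis using snoc.prems k by auto
  next
    case False
    then have "\<not> S - {s} \<subseteq> I" using k by auto
    then show ?thesis using snoc.IH[of "S - {s}"] snoc.prems(1) by auto
  qed
  then show ?case unfolding wedge_list_snoc wedge_right_def mult.assoc by (intro sum.neutral) auto
qed (auto simp: basis_ext_def)

text \<open>Associativity at the level of signs: the last factor e_t may be split off before or
  after merging S with the rest.\<close>

lemma shuffle_sign_remove_right:
  assumes "finite R" "S \<subseteq> R" "t \<in> R - S"
  shows "shuffle_sign S (R - S) * above_sign (R - S) t = above_sign R t * shuffle_sign S (R - {t} - S)"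
proof -
  let ?I = "\<lambda>T. {(s, t). s \<in> S \<and> t \<in> T \<and> t < s}"
  have fS: "finite S" using assms finite_subset by blast
  have fin: "finite (?I (R - {t} - S))"
    by (rule finite_subset[of _ "S \<times> R"]) (use fS assms in auto)
  have "?I (R - S) = ?I (R - {t} - S) \<union> (\<lambda>s. (s, t)) ` {s \<in> S. t < s}" using assms by auto
  also have "card \<dots> = card (?I (R - {t} - S)) + card ((\<lambda>s. (s, t)) ` {s \<in> S. t < s})"
    by (rule card_Un_disjoint) (use fin fS in auto)
  also have "card ((\<lambda>s. (s, t)) ` {s \<in> S. t < s}) = card {s \<in> S. t < s}"
    by (rule card_image) (auto simp: inj_on_def)
  finally have "card (?I (R - S)) = card (?I (R - {t} - S)) + card {s \<in> S. t < s}" .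
  moreover have "card {u \<in> R. t < u} = card {u \<in> R - S. t < u} + card {s \<in> S. t < s}"
  proof -
    have "{u \<in> R. t < u} = {u \<in> R - S. t < u} \<union> {s \<in> S. t < s}" using assms by auto
    then show ?thesis using assms(1) fS by (simp, subst card_Un_disjoint) auto
  qed
  ultimately show ?thesis
    by (simp add: shuffle_sign_def above_sign_def power_add mult_ac flip: power_mult_distrib)
qed

lemma wedge_infinite: "infinite R \<Longrightarrow> wedge x y R = 0"
  by (simp add: wedge_def)

text \<open>Associativity with a vector as third factor, which is all that the induction for
  \<open>wedge_list_append\<close> needs.\<close>

lemma wedge_wedge_right: "wedge x (wedge_right v y) = wedge_right v (wedge x y)"
proof
  fix R :: "nat set"
  show "wedge x (wedge_right v y) R = wedge_right v (wedge x y) R"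
  proof (cases "finite R")
    case True
    have "wedge x (wedge_right v y) R = (\<Sum>S\<in>Pow R. \<Sum>t\<in>R - S.
        shuffle_sign S (R - S) * above_sign (R - S) t * v t * x S * y (R - S - {t}))"
      by (simp add: wedge_def wedge_right_def sum_distrib_left mult_ac)
    also have "\<dots> = (\<Sum>S\<in>Pow R. \<Sum>t\<in>R - S.
        above_sign R t * shuffle_sign S (R - {t} - S) * v t * x S * y (R - {t} - S))"
    proof (intro sum.cong refl)
      fix S t assume "S \<in> Pow R" "t \<in> R - S"
      moreover have "R - S - {t} = R - {t} - S" by auto
      ultimately show "shuffle_sign S (R - S) * above_sign (R - S) t * v t * x S * y (R - S - {t}) =
         above_sign R t * shuffle_sign S (R - {t} - S) * v t * x S * y (R - {t} - S)"
        using shuffle_sign_remove_right[OF True, of S t] by simp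
    qed
    also have "\<dots> = (\<Sum>t\<in>R. \<Sum>S\<in>Pow (R - {t}).
        above_sign R t * shuffle_sign S (R - {t} - S) * v t * x S * y (R - {t} - S))"
      by (subst (1 2) sum.Sigma)
        (use True in \<open>auto intro!: sum.reindex_bij_witness[where i=prod.swap and j=prod.swap]\<close>)
    also have "\<dots> = wedge_right v (wedge x y) R"
      by (simp add: wedge_def wedge_right_def sum_distrib_left mult_ac)
    finally show ?thesis .
  qed (simp add: wedge_infinite wedge_right_infinite)
qed

lemma wedge_basis_empty_right: "finite R \<Longrightarrow> wedge x (basis_ext {}) R = x R"
  unfolding wedge_def by (subst sum.mono_neutral_right[of _ "{R}"]) (auto simp: basis_ext_def shuffle_sign_def)

lemma wedge_list_append: "wedge_list (xs @ ys) = wedge (wedge_list xs) (wedge_list ys)"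
proof (induction ys rule: rev_induct)
  case Nil
  show ?case
  proof
    fix S show "wedge_list (xs @ []) S = wedge (wedge_list xs) (wedge_list []) S"
      by (cases "finite S") (simp_all add: wedge_basis_empty_right wedge_infinite wedge_list_infinite)
  qed
next
  case (snoc v ys)
  then show ?case using wedge_list_snoc[of "xs @ ys" v] by (simp add: wedge_wedge_right)
qed

lemma wedge_right_cong:
  assumes "\<And>T. T \<subseteq> S \<Longrightarrow> x T = y T"
  shows "wedge_right v x S = wedge_right v y S"
  unfolding wedge_right_def using assms by (intro sum.cong) auto

lemma foldl_wedge_right_scale:
  "foldl (\<lambda>x v. wedge_right v x) (\<lambda>S. c * x S) vs = (\<lambda>S. c * foldl (\<lambda>x v. wedge_right v x) x vs S)"
  by (induction vs arbitrary: x) (simp_all add: wedge_right_scale)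

lemma wedge_list_move:
  "wedge_list (xs @ v # ys @ zs) S = (-1) ^ length ys * wedge_list (xs @ ys @ v # zs) S"
proof (induction ys arbitrary: xs)
  case (Cons y ys)
  have "wedge_list (xs @ v # y # ys @ zs) = (\<lambda>S. - wedge_list (xs @ y # v # ys @ zs) S)"
  proof -
    have "wedge_list (xs @ v # y # us) = (\<lambda>S. (-1) * wedge_list (xs @ y # v # us) S)" for us
      unfolding wedge_list_def foldl_append foldl_Cons
        foldl_wedge_right_scale[symmetric] by (subst wedge_right_anticommute) simp
    then show ?thesis by simp
  qed
  then show ?case using Cons[of "xs @ [y]"] by simp
qed simp

lemma wedge_list_swap:
  "wedge_list (ps @ xs @ ys @ qs) S = (-1) ^ (length xs * length ys) * wedge_list (ps @ ys @ xs @ qs) S"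
proof (induction xs arbitrary: ps qs rule: rev_induct)
  case (snoc x xs)
  have "wedge_list (ps @ (xs @ [x]) @ ys @ qs) S = (-1) ^ length ys * wedge_list (ps @ xs @ ys @ x # qs) S"
    using wedge_list_move[of "ps @ xs" x ys qs] by simp
  also have "\<dots> = (-1) ^ length ys * ((-1) ^ (length xs * length ys) * wedge_list (ps @ ys @ xs @ x # qs) S)"
    by (simp add: snoc)
  finally show ?case by (simp add: power_add)
qed simp

lemma wedge_right_zero [simp]: "wedge_right v (\<lambda>S. 0) = (\<lambda>S. 0)"
  by (simp add: wedge_right_def)

lemma wedge_right_member: "v \<in> set vs \<Longrightarrow> wedge_right v (wedge_list vs) = (\<lambda>S. 0)"
proof (induction vs rule: rev_induct)
  case (snoc w vs)
  then show ?case
    by (cases "v = w") (auto simp: wedge_right_twice wedge_right_anticommute[of v w])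
qed simp

section \<open>The three-term Pluecker relation\<close>

lemma contract_wedge_list_0:
  assumes I: "finite I" and "\<And>v. v \<in> set vs \<Longrightarrow> (\<Sum>s\<in>I. \<xi> s * v s) = 0" and S: "finite S"
  shows "contract I \<xi> (wedge_list vs) S = 0"
  using assms(2,3)
proof (induction vs arbitrary: S rule: rev_induct)
  case Nil
  then show ?case by (simp add: contract_def basis_ext_def)
next
  case (snoc v vs)
  have "wedge_right v (contract I \<xi> (wedge_list vs)) S = wedge_right v (\<lambda>S. 0) S"
    by (rule wedge_right_cong) (use snoc finite_subset[OF _ snoc.prems(2)] in auto)
  then show ?case using snoc I by (simp add: contract_wedge_right)
qed

text \<open>The functional p |-> f p z kills all of \<open>vs\<close>. Contracting the product of
  \<open>vs\<close>, u, x, y with it gives 0 at the full set I, since I - I is empty; moving the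
  contraction through one factor at a time produces the three terms.\<close>

lemma plucker_three_term:
  fixes vs :: "vec list"
  assumes I: "finite I"
  defines "f \<equiv> \<lambda>p q. wedge_list (vs @ [p, q]) I"
  shows "f u y * f x z = f u x * f y z + f u z * f x y"
proof -
  let ?W = "wedge_list vs"
  have f: "f p q = wedge_right q (wedge_right p ?W) I" for p q
    using wedge_list_snoc[of "vs @ [p]" q] by (simp add: f_def)
  \<comment> \<open>Coordinates of the functional p |-> f p z; the minus sign comes from exchanging
    p and z.\<close>
  define \<xi> where "\<xi> = (\<lambda>s. - (above_sign I s * wedge_right z ?W (I - {s})))"
  let ?X = "\<lambda>p. \<Sum>s\<in>I. \<xi> s * p s"
  have \<xi>: "?X p = f p z" for p
    unfolding f by (subst wedge_right_anticommute) (simp add: \<xi>_def wedge_right_def sum_negf mult_ac)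
  have "?X v = 0" if "v \<in> set vs" for v
    unfolding \<xi> f wedge_right_member[OF that] by (simp add: wedge_right_def)
  then have 0: "contract I \<xi> ?W S = 0" if "finite S" for S
    using contract_wedge_list_0[OF I] that by blast
  have 1: "contract I \<xi> (wedge_right u ?W) S = ?X u * ?W S" if "finite S" for S
  proof -
    have "wedge_right u (contract I \<xi> ?W) S = wedge_right u (\<lambda>S. 0) S"
      by (rule wedge_right_cong) (rule 0, rule finite_subset[OF _ that])
    then show ?thesis using contract_wedge_right[OF I that] by simp
  qed
  have 2: "contract I \<xi> (wedge_right x (wedge_right u ?W)) S =
      ?X x * wedge_right u ?W S + (- ?X u) * wedge_right x ?W S" if "finite S" for S
  proof -
    have "wedge_right x (contract I \<xi> (wedge_right u ?W)) S = wedge_right x (\<lambda>S. ?X u * ?W S) S"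
      by (rule wedge_right_cong) (rule 1, rule finite_subset[OF _ that])
    then show ?thesis using contract_wedge_right[OF I that] by (simp add: wedge_right_scale)
  qed
  have "contract I \<xi> (wedge_right y (wedge_right x (wedge_right u ?W))) I =
      ?X y * wedge_right x (wedge_right u ?W) I - wedge_right y (\<lambda>S. ?X x * wedge_right u ?W S + (- ?X u) * wedge_right x ?W S) I"
    unfolding contract_wedge_right[OF I I]
    by (rule arg_cong2[of _ _ _ _ minus], rule refl, rule wedge_right_cong) (rule 2, rule finite_subset[OF _ I])
  then have "0 = f y z * f u x - (f x z * f u y - f u z * f x y)"
    unfolding wedge_right_add wedge_right_scale \<xi> by (simp add: contract_def f)
  then show ?thesis by (simp add: algebra_simps)
qed

section \<open>Rank one perturbations of the identity\<close>

text \<open>The map induced on the exterior algebra by id + a \<otimes> \<xi>: products with two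
  factors a vanish, so nothing beyond the linear term survives.\<close>

definition rank_one :: "nat set \<Rightarrow> vec \<Rightarrow> vec \<Rightarrow> ext \<Rightarrow> ext" where
  "rank_one I \<xi> a x = (\<lambda>S. x S + wedge_right a (contract I \<xi> x) S)"

definition rank_one_vec :: "nat set \<Rightarrow> vec \<Rightarrow> vec \<Rightarrow> vec \<Rightarrow> vec" where
  "rank_one_vec I \<xi> a v = (\<lambda>k. v k + (\<Sum>s\<in>I. \<xi> s * v s) * a k)"

lemma rank_one_wedge_right:
  assumes I: "finite I"
  shows "rank_one I \<xi> a (wedge_right v x) = wedge_right (rank_one_vec I \<xi> a v) (rank_one I \<xi> a x)"
proof
  fix S
  let ?c = "\<Sum>s\<in>I. \<xi> s * v s"
  show "rank_one I \<xi> a (wedge_right v x) S = wedge_right (rank_one_vec I \<xi> a v) (rank_one I \<xi> a x) S"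
  proof (cases "finite S")
    case True
    have "wedge_right a (contract I \<xi> (wedge_right v x)) S =
        wedge_right a (\<lambda>S. ?c * x S + (-1) * wedge_right v (contract I \<xi> x) S) S"
      by (rule wedge_right_cong) (simp add: contract_wedge_right[OF I finite_subset[OF _ True]])
    then show ?thesis
      unfolding rank_one_def rank_one_vec_def wedge_right_add_vec wedge_right_scale_vec
        wedge_right_add wedge_right_scale wedge_right_twice
      by (subst (asm) wedge_right_anticommute) simp
  qed (simp add: rank_one_def wedge_right_infinite)
qed

lemma rank_one_wedge_list:
  assumes I: "finite I"
  shows "rank_one I \<xi> a (wedge_list vs) = wedge_list (map (rank_one_vec I \<xi> a) vs)"
proof (induction vs rule: rev_induct)
  case Nil
  have "contract I \<xi> (basis_ext {}) = (\<lambda>S. 0)" by (simp add: contract_def basis_ext_def fun_eq_iff)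
  then show ?case by (simp add: rank_one_def wedge_right_def)
next
  case (snoc v vs)
  then show ?case by (simp add: rank_one_wedge_right[OF I])
qed

text \<open>The determinant of id + a \<otimes> \<xi>. In top degree the contraction of x \<and> a
  is 0, so the Clifford relation evaluates multiplication after contraction.\<close>

lemma rank_one_top:
  assumes I: "finite I"
  shows "rank_one I \<xi> a x I = (1 + (\<Sum>s\<in>I. \<xi> s * a s)) * x I"
proof -
  have "contract I \<xi> (wedge_right a x) I = 0" by (simp add: contract_def)
  then show ?thesis
    using contract_wedge_right[OF I I, of \<xi> a x] by (simp add: rank_one_def algebra_simps)
qed

section \<open>Shuffle signs\<close>

lemma finite_inversions: "finite S \<Longrightarrow> finite T \<Longrightarrow> finite {(s, t). s \<in> S \<and> t \<in> T \<and> (t::nat) < s}"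
  by (rule finite_subset[of _ "S \<times> T"]) auto

lemma shuffle_sign_sq [simp]: "shuffle_sign S T * shuffle_sign S T = 1"
  by (simp add: shuffle_sign_def flip: power_add)

lemma shuffle_sign_Un_left:
  assumes "finite A" "finite B" "finite C" "A \<inter> B = {}"
  shows "shuffle_sign (A \<union> B) C = shuffle_sign A C * shuffle_sign B C"
proof -
  have "{(s, t). s \<in> A \<union> B \<and> t \<in> C \<and> t < s} =
      {(s, t). s \<in> A \<and> t \<in> C \<and> t < s} \<union> {(s, t). s \<in> B \<and> t \<in> C \<and> t < s}" by auto
  then show ?thesis unfolding shuffle_sign_def power_add[symmetric]
    by (subst card_Un_disjoint[symmetric]) (use assms finite_inversions in auto)
qed

lemma shuffle_sign_Un_right:
  assumes "finite A" "finite B" "finite C" "B \<inter> C = {}"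
  shows "shuffle_sign A (B \<union> C) = shuffle_sign A B * shuffle_sign A C"
proof -
  have "{(s, t). s \<in> A \<and> t \<in> B \<union> C \<and> t < s} =
      {(s, t). s \<in> A \<and> t \<in> B \<and> t < s} \<union> {(s, t). s \<in> A \<and> t \<in> C \<and> t < s}" by auto
  then show ?thesis unfolding shuffle_sign_def power_add[symmetric]
    by (subst card_Un_disjoint[symmetric]) (use assms finite_inversions in auto)
qed

text \<open>Every pair in A \<times> B is an inversion for exactly one of the two orders of the
  blocks.\<close>

lemma shuffle_sign_swap:
  assumes "finite A" "finite B" "A \<inter> B = {}"
  shows "shuffle_sign B A = (-1) ^ (card A * card B) * shuffle_sign A B"
proof -
  let ?i = "\<lambda>S T. {(s, t). s \<in> S \<and> t \<in> T \<and> (t::nat) < s}"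
  have "A \<times> B = ?i A B \<union> prod.swap ` ?i B A" using assms(3) by (force simp: image_iff)
  then have "card (A \<times> B) = card (?i A B) + card (prod.swap ` ?i B A)"
    by (simp, subst card_Un_disjoint) (use assms finite_inversions in auto)
  then have "card A * card B = card (?i A B) + card (?i B A)"
    using assms by (simp add: card_cartesian_product card_image)
  then show ?thesis by (simp add: shuffle_sign_def power_add)
qed

lemma shuffle_sign_empty [simp]: "shuffle_sign {} T = 1" "shuffle_sign S {} = 1"
  by (simp_all add: shuffle_sign_def)

section \<open>Coordinates of the three-flag functions\<close>

lemma wedge_list_unit_vec:
  "sorted l \<Longrightarrow> distinct l \<Longrightarrow> wedge_list (map unit_vec l) = basis_ext (set l)"
proof (induction l rule: rev_induct)
  case (snoc m l)
  have IH: "wedge_list (map unit_vec l) = basis_ext (set l)" using snoc by (simp add: sorted_append)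
  show ?case
  proof
    fix S :: "nat set"
    have m: "m \<notin> set l" "\<And>t. t \<in> set l \<Longrightarrow> t \<le> m" using snoc.prems by (auto simp: sorted_append)
    have "wedge_right (unit_vec m) (basis_ext (set l)) S = basis_ext (insert m (set l)) S"
    proof (cases "S = insert m (set l)")
      case True
      have "{t \<in> S. m < t} = {}" using m True by force
      then have "above_sign S m = 1" by (simp only: above_sign_def card.empty power_0)
      moreover have "wedge_right (unit_vec m) (basis_ext (set l)) S = (\<Sum>s\<in>{m}. above_sign S s * unit_vec m s * basis_ext (set l) (S - {s}))"
        unfolding wedge_right_def by (rule sum.mono_neutral_right) (use True in \<open>auto simp: unit_vec_def\<close>)
      ultimately show ?thesis using True m by (simp add: basis_ext_def unit_vec_def)
    next
      case False
      then have "unit_vec m s * basis_ext (set l) (S - {s}) = 0" if "s \<in> S" for s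
        using that by (auto simp: unit_vec_def basis_ext_def split: if_splits)
      then show ?thesis using False unfolding wedge_right_def mult.assoc
        by (subst sum.neutral) (auto simp: basis_ext_def)
    qed
    then show "wedge_list (map unit_vec (l @ [m])) S = basis_ext (set (l @ [m])) S" by (simp add: IH)
  qed
qed simp

lemma basis_ext_wedge_list:
  "finite S \<Longrightarrow> basis_ext S = wedge_list (map unit_vec (sorted_list_of_set S))"
  using wedge_list_unit_vec[of "sorted_list_of_set S"] by simp

lemma wedge_basis_right:
  "finite R \<Longrightarrow> wedge x (basis_ext T) R = (if T \<subseteq> R then shuffle_sign (R - T) T * x (R - T) else 0)"
proof -
  assume R: "finite R"
  show ?thesis
  proof (cases "T \<subseteq> R")
    case True
    then have "R - (R - T) = T" by auto
    moreover have "wedge x (basis_ext T) R = (\<Sum>S\<in>{R - T}. shuffle_sign S (R - S) * x S * basis_ext T (R - S))"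
      unfolding wedge_def by (rule sum.mono_neutral_right) (use R True in \<open>auto simp: basis_ext_def\<close>)
    ultimately show ?thesis using True by (simp add: basis_ext_def)
  next
    case False
    then show ?thesis unfolding wedge_def by (subst sum.neutral) (auto simp: basis_ext_def)
  qed
qed

lemma wedge_swap_basis:
  assumes "finite S"
  shows "wedge (wedge (wedge_list xs) (basis_ext S)) (wedge_list ys) R =
    (-1) ^ (card S * length ys) * wedge (wedge (wedge_list xs) (wedge_list ys)) (basis_ext S) R"
  using wedge_list_swap[of xs "map unit_vec (sorted_list_of_set S)" ys "[]" R]
  unfolding basis_ext_wedge_list[OF assms] wedge_list_append[symmetric] by simp

lemma ext_of_vec_singleton:
  assumes "\<And>k. k \<notin> {1..NN n} \<Longrightarrow> v k = 0"
  shows "ext_of_vec n v {i} = v i"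
proof -
  have "ext_of_vec n v {i} = (\<Sum>j = 1..NN n. if i = j then v j else 0)"
    unfolding ext_of_vec_def by (rule sum.cong) (auto simp: basis_ext_def)
  also have "\<dots> = (if i \<in> {1..NN n} then v i else 0)" by (subst sum.delta') auto
  finally show ?thesis using assms[of i] by (simp split: if_splits)
qed

lemma ext_of_vec_other: "(\<And>i. S \<noteq> {i}) \<Longrightarrow> ext_of_vec n v S = 0"
  by (simp add: ext_of_vec_def basis_ext_def)

text \<open>\<open>ext_of_vec\<close> sees only the coordinates up to N while
  \<open>wedge_right\<close> uses all of them, hence the support condition.\<close>

lemma wedge_ext_of_vec:
  assumes "\<And>k. k \<notin> {1..NN n} \<Longrightarrow> v k = 0"
  shows "wedge x (ext_of_vec n v) = wedge_right v x"
proof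
  fix R :: "nat set"
  show "wedge x (ext_of_vec n v) R = wedge_right v x R"
  proof (cases "finite R")
    case True
    have inj: "inj_on (\<lambda>t. R - {t}) R" by (auto simp: inj_on_def)
    have "wedge x (ext_of_vec n v) R =
        (\<Sum>S\<in>(\<lambda>t. R - {t}) ` R. shuffle_sign S (R - S) * x S * ext_of_vec n v (R - S))"
      unfolding wedge_def
    proof (rule sum.mono_neutral_right)
      show "\<forall>S\<in>Pow R - (\<lambda>t. R - {t}) ` R. shuffle_sign S (R - S) * x S * ext_of_vec n v (R - S) = 0"
      proof
        fix S assume S: "S \<in> Pow R - (\<lambda>t. R - {t}) ` R"
        have "R - S \<noteq> {i}" for i
        proof
          assume i: "R - S = {i}"
          then have "S = R - {i}" "i \<in> R" using S by auto
          then show False using S by blast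
        qed
        then show "shuffle_sign S (R - S) * x S * ext_of_vec n v (R - S) = 0"
          by (simp add: ext_of_vec_other)
      qed
    qed (use True in auto)
    also have "\<dots> = (\<Sum>t\<in>R. shuffle_sign (R - {t}) (R - (R - {t})) * x (R - {t}) * ext_of_vec n v (R - (R - {t})))"
      by (subst sum.reindex[OF inj]) simp
    also have "\<dots> = wedge_right v x R"
      unfolding wedge_right_def
    proof (rule sum.cong[OF refl])
      fix t assume t: "t \<in> R"
      then have e: "R - (R - {t}) = {t}" by auto
      have "{(s, u). s \<in> R - {t} \<and> u \<in> {t} \<and> u < s} = (\<lambda>s. (s, t)) ` {s \<in> R. t < s}" by auto
      then have "shuffle_sign (R - {t}) {t} = above_sign R t"
        by (simp add: shuffle_sign_def above_sign_def card_image inj_on_def)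
      then show "shuffle_sign (R - {t}) (R - (R - {t})) * x (R - {t}) * ext_of_vec n v (R - (R - {t}))
          = above_sign R t * v t * x (R - {t})"
        using ext_of_vec_singleton[of n v t] assms unfolding e by simp
    qed
    finally show ?thesis .
  qed (simp add: wedge_infinite wedge_right_infinite)
qed

definition supported :: "nat \<Rightarrow> (nat \<Rightarrow> vec) \<Rightarrow> bool" where
  "supported N u \<longleftrightarrow> (\<forall>i k. k \<notin> {1..N} \<longrightarrow> u i k = 0)"

definition initial :: "(nat \<Rightarrow> vec) \<Rightarrow> nat \<Rightarrow> vec list" where
  "initial u a = map u [1..<Suc a]"

lemma initial_0 [simp]: "initial u 0 = []"
  by (simp add: initial_def)

lemma initial_Suc: "initial u (Suc a) = initial u a @ [u (Suc a)]"
  by (simp add: initial_def)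

lemma length_initial [simp]: "length (initial u a) = a"
  by (simp add: initial_def)

lemma wedge_upto_eq: "supported (NN n) u \<Longrightarrow> wedge_upto n u a = wedge_list (initial u a)"
proof (induction a)
  case (Suc a)
  have "wedge x (ext_of_vec n (u (Suc a))) = wedge_right (u (Suc a)) x" for x
    by (rule wedge_ext_of_vec) (use Suc.prems in \<open>auto simp only: supported_def\<close>)
  then show ?case using Suc by (simp add: initial_Suc)
qed simp

text \<open>The common shape of all the three-flag functions: \<open>comult\<close> is applied to \<open>z\<close>, and the two factors
  are paired with \<open>x\<close> and \<open>y\<close>.\<close>

definition pairing :: "nat \<Rightarrow> ext \<Rightarrow> ext \<Rightarrow> ext \<Rightarrow> complex" where
  "pairing N x y z = (\<Sum>S\<in>Pow {1..N}. \<Sum>T\<in>Pow {1..N}.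
     (if S \<inter> T = {} then shuffle_sign S T * z (S \<union> T) else 0) *
     (shuffle_sign ({1..N} - S) S * x ({1..N} - S)) * (shuffle_sign ({1..N} - T) T * y ({1..N} - T)))"

lemma vol_wedge_basis:
  "S \<subseteq> {1..NN n} \<Longrightarrow> vol n (wedge x (basis_ext S)) = shuffle_sign ({1..NN n} - S) S * x ({1..NN n} - S)"
  by (simp add: vol_def wedge_basis_right)

lemma card_complement: "S \<subseteq> {1..NN n} \<Longrightarrow> card ({1..NN n} - S) = NN n - card S"
  by (simp add: card_Diff_subset finite_subset)

lemma card_le_NN: "S \<subseteq> {1..NN n} \<Longrightarrow> card S \<le> NN n"
  using card_mono[of "{1..NN n}" S] by simp

text \<open>\<open>comult\<close> restricts to the cardinalities p and q, \<open>pairing\<close>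
  does not: homogeneity of x and y makes the restriction automatic. The scalar c leaves room for the
  sign of moving a basis form from the middle of a product to its end.\<close>

lemma tensor_apply_pairing:
  assumes x: "\<And>S. x S \<noteq> 0 \<Longrightarrow> card S = NN n - p" and y: "\<And>S. y S \<noteq> 0 \<Longrightarrow> card S = NN n - q"
    and p: "p \<le> NN n" "q \<le> NN n"
    and f: "\<And>S. S \<subseteq> {1..NN n} \<Longrightarrow> card S = p \<Longrightarrow> f (basis_ext S) = c * vol n (wedge x (basis_ext S))"
    and g: "\<And>S. S \<subseteq> {1..NN n} \<Longrightarrow> g (basis_ext S) = vol n (wedge y (basis_ext S))"
  shows "tensor_apply n f g (comult p q z) = c * pairing (NN n) x y z"
  unfolding tensor_apply_def pairing_def sum_distrib_left
proof (intro sum.cong refl)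
  fix S T assume "S \<in> Pow {1..NN n}" "T \<in> Pow {1..NN n}"
  then have S: "S \<subseteq> {1..NN n}" and T: "T \<subseteq> {1..NN n}" by auto
  have "card S = p" if "x ({1..NN n} - S) \<noteq> 0"
    using x[OF that] card_complement[OF S] card_le_NN[OF S] p by simp
  moreover have "card T = q" if "y ({1..NN n} - T) \<noteq> 0"
    using y[OF that] card_complement[OF T] card_le_NN[OF T] p by simp
  ultimately show "comult p q z S T * f (basis_ext S) * g (basis_ext T) =
      c * ((if S \<inter> T = {} then shuffle_sign S T * z (S \<union> T) else 0) *
       (shuffle_sign ({1..NN n} - S) S * x ({1..NN n} - S)) *
       (shuffle_sign ({1..NN n} - T) T * y ({1..NN n} - T)))"
    by (cases "x ({1..NN n} - S) = 0"; cases "y ({1..NN n} - T) = 0"; cases "card S = p")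
       (use S T in \<open>auto simp: comult_def f g vol_wedge_basis\<close>)
qed

text \<open>The sign comes from moving the first factor of the comultiplication, of degree a + c -
  N, past W_d.\<close>

lemma quad_ordered_pairing:
  assumes u: "supported (NN n) u" and v: "supported (NN n) v" and w: "supported (NN n) w"
    and sum: "a + b + c + d = 2 * NN n" and a: "a \<le> NN n" and ac: "NN n \<le> a + c"
  shows "quad_ordered n (wedge_upto n u) (wedge_upto n v) (wedge_upto n w) a b c d =
    (-1) ^ ((a + c - NN n) * d) *
    pairing (NN n) (wedge_list (initial u b @ initial w d)) (wedge_list (initial u a)) (wedge_list (initial v c))"
  unfolding quad_ordered_def wedge_upto_eq[OF u] wedge_upto_eq[OF v] wedge_upto_eq[OF w]
proof (rule tensor_apply_pairing)
  fix S assume S: "S \<subseteq> {1..NN n}" "card S = a + c - NN n"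
  then have "finite S" using finite_subset by blast
  then show "vol n (wedge (wedge (wedge_list (initial u b)) (basis_ext S)) (wedge_list (initial w d))) =
      (-1) ^ ((a + c - NN n) * d) * vol n (wedge (wedge_list (initial u b @ initial w d)) (basis_ext S))"
    unfolding vol_def wedge_swap_basis[OF \<open>finite S\<close>] wedge_list_append S(2) by simp
next
  fix S assume "wedge_list (initial u b @ initial w d) S \<noteq> 0"
  from wedge_list_degree[OF this] show "card S = NN n - (a + c - NN n)" using sum ac by simp
next
  fix S assume "wedge_list (initial u a) S \<noteq> 0"
  from wedge_list_degree[OF this] show "card S = NN n - (NN n - a)" using a by simp
qed (use a sum ac in auto)

lemma triple_pairing:
  assumes u: "supported (NN n) u" and v: "supported (NN n) v" and w: "supported (NN n) w"
    and sum: "a + b + c = 2 * NN n" and le: "b \<le> NN n" "c \<le> NN n"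
  shows "triple n (wedge_upto n u) (wedge_upto n v) (wedge_upto n w) a b c =
    pairing (NN n) (wedge_list (initial v b)) (wedge_list (initial w c)) (wedge_list (initial u a))"
proof -
  have "tensor_apply n (\<lambda>x. vol n (wedge (wedge_list (initial v b)) x)) (\<lambda>x. vol n (wedge (wedge_list (initial w c)) x))
      (comult (NN n - b) (NN n - c) (wedge_list (initial u a))) =
      1 * pairing (NN n) (wedge_list (initial v b)) (wedge_list (initial w c)) (wedge_list (initial u a))"
    by (rule tensor_apply_pairing) (use le in \<open>auto dest: wedge_list_degree\<close>)
  moreover have "\<not> a + b + c = NN n" using sum by simp
  ultimately show ?thesis using sum unfolding triple_def wedge_upto_eq[OF u] wedge_upto_eq[OF v] wedge_upto_eq[OF w]
    by (simp only: if_True if_False mult_1 simp_thms)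
qed

lemma triple_vol:
  assumes u: "supported (NN n) u" and v: "supported (NN n) v" and w: "supported (NN n) w" and sum: "a + b + c = NN n"
  shows "triple n (wedge_upto n u) (wedge_upto n v) (wedge_upto n w) a b c =
    vol n (wedge_list (initial u a @ initial v b @ initial w c))"
  using sum wedge_list_append[of "initial u a @ initial v b" "initial w c"]
  unfolding triple_def wedge_upto_eq[OF u] wedge_upto_eq[OF v] wedge_upto_eq[OF w] by (simp add: wedge_list_append)

section \<open>Passage to the doubled space\<close>

definition first_copy :: "nat \<Rightarrow> vec \<Rightarrow> vec" where
  "first_copy N v = (\<lambda>k. if k \<in> {1..N} then v k else 0)"

definition second_copy :: "nat \<Rightarrow> vec \<Rightarrow> vec" where
  "second_copy N v = (\<lambda>k. if k \<in> {N + 1..2 * N} then v (k - N) else 0)"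

definition diagonal :: "nat \<Rightarrow> vec \<Rightarrow> vec" where
  "diagonal N v = (\<lambda>k. first_copy N v k + second_copy N v k)"

abbreviation shift :: "nat \<Rightarrow> nat set \<Rightarrow> nat set" where
  "shift N T \<equiv> (+) (N) ` T"

lemma shift_remove: "t \<in> T \<Longrightarrow> shift N T - {N + t} = shift N (T - {t})"
  by auto

lemma above_sign_shift: "above_sign (shift N T) (N + t) = above_sign T t"
proof -
  have "{u \<in> shift N T. N + t < u} = shift N {u \<in> T. t < u}" by auto
  then show ?thesis by (simp only: above_sign_def) (simp add: card_image)
qed

lemma second_copy_shift: "t \<in> {1..N} \<Longrightarrow> second_copy N x (N + t) = x t"
  by (simp add: second_copy_def)

lemma wedge_list_first_copy:
  "S \<subseteq> {1..N} \<Longrightarrow> wedge_list (map (first_copy N) xs) S = wedge_list xs S"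
proof (induction xs arbitrary: S rule: rev_induct)
  case (snoc x xs)
  then show ?case by (auto simp: wedge_right_def first_copy_def subset_iff intro!: sum.cong)
qed simp

lemma wedge_list_second_copy:
  "T \<subseteq> {1..N} \<Longrightarrow> wedge_list (map (second_copy N) xs) (shift N T) = wedge_list xs T"
proof (induction xs arbitrary: T rule: rev_induct)
  case (snoc x xs)
  have "wedge_right (second_copy N x) (wedge_list (map (second_copy N) xs)) (shift N T) = 
      (\<Sum>t\<in>T. above_sign (shift N T) (N + t) * second_copy N x (N + t) *
         wedge_list (map (second_copy N) xs) (shift N T - {N + t}))"
    unfolding wedge_right_def by (subst sum.reindex) auto
  also have "\<dots> = wedge_right x (wedge_list xs) T"
    unfolding wedge_right_def
  proof (rule sum.cong[OF refl])
    fix t assume t: "t \<in> T"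
    then have "T - {t} \<subseteq> {1..N}" "t \<in> {1..N}" using snoc.prems by auto
    then show "above_sign (shift N T) (N + t) * second_copy N x (N + t) *
         wedge_list (map (second_copy N) xs) (shift N T - {N + t}) = above_sign T t * x t * wedge_list xs (T - {t})"
      using snoc.IH[of "T - {t}"] shift_remove[OF t, of N] second_copy_shift[of t N x] by (simp add: above_sign_shift)
  qed
  finally show ?case by simp
qed (auto simp: basis_ext_def)

lemma wedge_list_first_copy_0: "\<not> S \<subseteq> {1..N} \<Longrightarrow> wedge_list (map (first_copy N) xs) S = 0"
  by (rule wedge_list_support[where I="{1..N}"]) (auto simp: first_copy_def)

lemma wedge_list_second_copy_0: "\<not> S \<subseteq> {N + 1..2 * N} \<Longrightarrow> wedge_list (map (second_copy N) xs) S = 0"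
  by (rule wedge_list_support[where I="{N + 1..2 * N}"]) (auto simp: second_copy_def)

lemma shuffle_sign_less: "(\<And>s t. s \<in> S \<Longrightarrow> t \<in> T \<Longrightarrow> s < t) \<Longrightarrow> shuffle_sign S T = 1"
proof -
  assume "\<And>s t. s \<in> S \<Longrightarrow> t \<in> T \<Longrightarrow> s < t"
  then have "{(s, t). s \<in> S \<and> t \<in> T \<and> t < s} = {}" by (auto dest: less_asym)
  then show ?thesis by (simp only: shuffle_sign_def card.empty power_0)
qed

lemma shuffle_sign_greater:
  "(\<And>s t. s \<in> S \<Longrightarrow> t \<in> T \<Longrightarrow> t < s) \<Longrightarrow> shuffle_sign S T = (-1) ^ (card S * card T)"
proof -
  assume "\<And>s t. s \<in> S \<Longrightarrow> t \<in> T \<Longrightarrow> t < s"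
  then have "{(s, t). s \<in> S \<and> t \<in> T \<and> t < s} = S \<times> T" by auto
  then show ?thesis by (simp only: shuffle_sign_def card_cartesian_product)
qed

lemma shuffle_sign_shift: "shuffle_sign (shift N S) (shift N T) = shuffle_sign S T"
proof -
  have "{(s, t). s \<in> shift N S \<and> t \<in> shift N T \<and> t < s} =
      map_prod ((+) (N)) ((+) (N)) ` {(s, t). s \<in> S \<and> t \<in> T \<and> t < s}" by force
  moreover have "inj (map_prod ((+) N) ((+) N))" by (auto simp: inj_on_def)
  ultimately show ?thesis by (simp only: shuffle_sign_def card_image[OF inj_on_subset[OF _ subset_UNIV]])
qed

text \<open>All indices of the first copy precede those of the second, so no sign appears, and only
  the splitting along the two copies contributes.\<close>

lemma wedge_list_copies:
  assumes P: "P \<subseteq> {1..N}" and T: "T \<subseteq> {1..N}"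
  shows "wedge_list (map (first_copy N) xs @ map (second_copy N) ys) (P \<union> shift N T) = wedge_list xs P * wedge_list ys T"
proof -
  have fin: "finite (P \<union> shift N T)" using P T finite_subset by blast
  have sh: "shift N T \<subseteq> {N + 1..2 * N}" using T by force
  have disj: "P \<inter> shift N T = {}" using P sh by force
  let ?x = "wedge_list (map (first_copy N) xs)" and ?y = "wedge_list (map (second_copy N) ys)"
  have "wedge ?x ?y (P \<union> shift N T) =
      (\<Sum>S\<in>{P}. shuffle_sign S (P \<union> shift N T - S) * ?x S * ?y (P \<union> shift N T - S))"
    unfolding wedge_def
  proof (rule sum.mono_neutral_right)
    show "\<forall>S\<in>Pow (P \<union> shift N T) - {P}. shuffle_sign S (P \<union> shift N T - S) * ?x S * ?y (P \<union> shift N T - S) = 0"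
    proof
      fix S assume S: "S \<in> Pow (P \<union> shift N T) - {P}"
      have "S = P" if "S \<subseteq> {1..N}" "P \<union> shift N T - S \<subseteq> {N + 1..2 * N}"
      proof -
        have "S \<subseteq> P" using that S sh by force
        moreover have "P \<subseteq> S" using that P by force
        ultimately show ?thesis by blast
      qed
      then show "shuffle_sign S (P \<union> shift N T - S) * ?x S * ?y (P \<union> shift N T - S) = 0"
        using S wedge_list_first_copy_0[of S N xs] wedge_list_second_copy_0[of "P \<union> shift N T - S" N ys] by force
    qed
  qed (use fin in auto)
  moreover have "P \<union> shift N T - P = shift N T" using disj by auto
  moreover have "shuffle_sign P (shift N T) = 1" by (rule shuffle_sign_less) (use P sh in force)
  ultimately show ?thesis
    by (simp add: wedge_list_append wedge_list_first_copy[OF P] wedge_list_second_copy[OF T])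
qed

lemma above_sign_Un: "finite A \<Longrightarrow> finite B \<Longrightarrow> A \<inter> B = {} \<Longrightarrow> above_sign (A \<union> B) s = above_sign A s * above_sign B s"
proof -
  assume a: "finite A" "finite B" "A \<inter> B = {}"
  have "{t \<in> A \<union> B. s < t} = {t \<in> A. s < t} \<union> {t \<in> B. s < t}" by auto
  then have "card {t \<in> A \<union> B. s < t} = card {t \<in> A. s < t} + card {t \<in> B. s < t}"
    by (simp, subst card_Un_disjoint) (use a in auto)
  then show ?thesis by (simp add: above_sign_def power_add)
qed

lemma above_sign_less: "(\<And>t. t \<in> S \<Longrightarrow> t < s) \<Longrightarrow> above_sign S s = 1"
proof -
  assume "\<And>t. t \<in> S \<Longrightarrow> t < s"
  then have "{t \<in> S. s < t} = {}" by (auto dest: less_asym)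
  then show ?thesis by (simp only: above_sign_def card.empty power_0)
qed

lemma above_sign_greater: "(\<And>t. t \<in> S \<Longrightarrow> s < t) \<Longrightarrow> above_sign S s = (-1) ^ card S"
proof -
  assume "\<And>t. t \<in> S \<Longrightarrow> s < t"
  then have "{t \<in> S. s < t} = S" by auto
  then show ?thesis by (simp only: above_sign_def)
qed

text \<open>The diagonal V -> V \<oplus> V induces the comultiplication, and this is the formula in
  coordinates. Each appended vector is split into its two copies; if S and T share an index, the
  resulting terms vanish or cancel.\<close>

lemma wedge_list_diagonal:
  assumes "S \<subseteq> {1..N}" "T \<subseteq> {1..N}"
  shows "wedge_list (map (diagonal N) zs) (S \<union> shift N T) =
    (if S \<inter> T = {} then shuffle_sign S T * wedge_list zs (S \<union> T) else 0)"
  using assms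
proof (induction zs arbitrary: S T rule: rev_induct)
  case Nil
  then show ?case by (auto simp: basis_ext_def)
next
  case (snoc z zs)
  let ?W = "wedge_list (map (diagonal N) zs)" and ?w = "wedge_list zs"
  have fin: "finite S" "finite T" using snoc.prems finite_subset by auto
  have disj: "S \<inter> shift N T = {}" using snoc.prems by force
  have dS: "diagonal N z s = z s" "S \<union> shift N T - {s} = (S - {s}) \<union> shift N T" if "s \<in> S" for s
    using that snoc.prems disj by (auto simp: diagonal_def first_copy_def second_copy_def)
  have dT: "diagonal N z (N + t) = z t" "S \<union> shift N T - {N + t} = S \<union> shift N (T - {t})" if "t \<in> T" for t
  proof -
    show "diagonal N z (N + t) = z t"
      using that snoc.prems by (auto simp: diagonal_def first_copy_def second_copy_def)
    show "S \<union> shift N T - {N + t} = S \<union> shift N (T - {t})"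
      using that disj by auto
  qed
  \<comment> \<open>An index of the first copy lies below all of the shifted T, which gives the
    factor (-1)^|T|.\<close>
  have sS: "above_sign (S \<union> shift N T) s = (-1) ^ card T * above_sign S s" if "s \<in> S" for s
  proof -
    have "above_sign (shift N T) s = (-1) ^ card (shift N T)"
      by (rule above_sign_greater) (use that snoc.prems in force)
    then show ?thesis using above_sign_Un[OF fin(1) finite_imageI[OF fin(2)] disj]
      by (simp add: card_image)
  qed
  have sT: "above_sign (S \<union> shift N T) (N + t) = above_sign T t" if "t \<in> T" for t
  proof -
    have "above_sign S (N + t) = 1"
      by (rule above_sign_less) (use that snoc.prems in force)
    then show ?thesis using above_sign_Un[OF fin(1) finite_imageI[OF fin(2)] disj]
      by (simp add: above_sign_shift)
  qed
  have "wedge_right (diagonal N z) ?W (S \<union> shift N T) =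
      (\<Sum>s\<in>S. above_sign (S \<union> shift N T) s * diagonal N z s * ?W (S \<union> shift N T - {s})) +
      (\<Sum>t\<in>T. above_sign (S \<union> shift N T) (N + t) * diagonal N z (N + t) * ?W (S \<union> shift N T - {N + t}))"
    unfolding wedge_right_def using disj fin by (subst sum.union_disjoint) (auto simp: sum.reindex)
  also have "\<dots> = (\<Sum>s\<in>S. (-1) ^ card T * above_sign S s * z s *
        (if (S - {s}) \<inter> T = {} then shuffle_sign (S - {s}) T * ?w (S - {s} \<union> T) else 0)) +
      (\<Sum>t\<in>T. above_sign T t * z t *
        (if S \<inter> (T - {t}) = {} then shuffle_sign S (T - {t}) * ?w (S \<union> (T - {t})) else 0))"
    (is "_ = (\<Sum>s\<in>S. ?f s) + (\<Sum>t\<in>T. ?g t)")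
  proof (intro arg_cong2[where f="(+)"] sum.cong refl)
    fix s assume s: "s \<in> S"
    then have "S - {s} \<subseteq> {1..N}" using snoc.prems by auto
    then show "above_sign (S \<union> shift N T) s * diagonal N z s * ?W (S \<union> shift N T - {s}) = ?f s"
      using snoc.IH[of "S - {s}" T] snoc.prems(2) by (simp only: dS[OF s] sS[OF s])
  next
    fix t assume t: "t \<in> T"
    then have "T - {t} \<subseteq> {1..N}" using snoc.prems by auto
    then show "above_sign (S \<union> shift N T) (N + t) * diagonal N z (N + t) * ?W (S \<union> shift N T - {N + t}) = ?g t"
      using snoc.IH[of S "T - {t}"] snoc.prems(1) by (simp only: dT[OF t] sT[OF t])
  qed
  also have "\<dots> = (if S \<inter> T = {} then shuffle_sign S T * wedge_right z ?w (S \<union> T) else 0)"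
  proof (cases "S \<inter> T = {}")
    case True
    have "shuffle_sign S T * wedge_right z ?w (S \<union> T) =
        (\<Sum>s\<in>S. shuffle_sign S T * (above_sign (S \<union> T) s * z s * ?w (S \<union> T - {s}))) +
        (\<Sum>t\<in>T. shuffle_sign S T * (above_sign (S \<union> T) t * z t * ?w (S \<union> T - {t})))"
      unfolding wedge_right_def sum_distrib_left using True fin by (simp add: sum.union_disjoint)
    moreover have "shuffle_sign S T * (above_sign (S \<union> T) s * z s * ?w (S \<union> T - {s})) = ?f s" if s: "s \<in> S" for s
    proof -
      have e: "S \<union> T - {s} = (S - {s}) \<union> T" "(S - {s}) \<inter> T = {}" using s True by auto
      have "shuffle_sign ({s} \<union> (S - {s})) T = shuffle_sign {s} T * shuffle_sign (S - {s}) T"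
        by (rule shuffle_sign_Un_left) (use fin in auto)
      moreover have "{s} \<union> (S - {s}) = S" using s by auto
      moreover have "shuffle_sign {s} T * above_sign T s = (-1) ^ card T"
      proof -
        have "{(u, t). u \<in> {s} \<and> t \<in> T \<and> t < u} = Pair s ` {t \<in> T. t < s}" by auto
        then have "shuffle_sign {s} T = (-1) ^ card {t \<in> T. t < s}"
          by (simp only: shuffle_sign_def) (simp add: card_image inj_on_def)
        moreover have "T = {t \<in> T. t < s} \<union> {t \<in> T. s < t}" using s True by (auto simp: not_less_iff_gr_or_eq)
        then have "card T = card ({t \<in> T. t < s} \<union> {t \<in> T. s < t})" by (rule arg_cong)
        moreover have "card ({t \<in> T. t < s} \<union> {t \<in> T. s < t}) = card {t \<in> T. t < s} + card {t \<in> T. s < t}"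
          using fin by (subst card_Un_disjoint) auto
        ultimately show ?thesis by (simp add: above_sign_def power_add)
      qed
      ultimately show ?thesis unfolding above_sign_Un[OF fin True] e(1)
        using e(2) by (simp add: mult_ac)
    qed
    moreover have "shuffle_sign S T * (above_sign (S \<union> T) t * z t * ?w (S \<union> T - {t})) = ?g t" if t: "t \<in> T" for t
    proof -
      have e: "S \<union> T - {t} = S \<union> (T - {t})" "S \<inter> (T - {t}) = {}" using t True by auto
      have "shuffle_sign S ({t} \<union> (T - {t})) = shuffle_sign S {t} * shuffle_sign S (T - {t})"
        by (rule shuffle_sign_Un_right) (use fin in auto)
      moreover have "{t} \<union> (T - {t}) = T" using t by auto
      moreover have "shuffle_sign S {t} = above_sign S t"
      proof -
        have "{(u, v). u \<in> S \<and> v \<in> {t} \<and> v < u} = (\<lambda>s. (s, t)) ` {s \<in> S. t < s}" by auto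
        then show ?thesis by (simp only: shuffle_sign_def above_sign_def) (simp add: card_image inj_on_def)
      qed
      ultimately have "shuffle_sign S T = above_sign S t * shuffle_sign S (T - {t})" by simp
      then show ?thesis unfolding above_sign_Un[OF fin True] e(1)
        using e(2) by (simp add: mult_ac)
    qed
    ultimately show ?thesis using True by simp
  next
    case False
    \<comment> \<open>While r stays in both sets the induction hypothesis gives 0, so only its
      removal from S or from T can contribute. If r is the only common index these two terms are
      opposite, otherwise both are 0.\<close>
    then obtain r where r: "r \<in> S" "r \<in> T" by auto
    have 0: "?f s = 0" "?g s = 0" if "s \<noteq> r" for s
    proof -
      have "r \<in> (S - {s}) \<inter> T" "r \<in> S \<inter> (T - {s})" using that r by auto
      then have "(S - {s}) \<inter> T \<noteq> {}" "S \<inter> (T - {s}) \<noteq> {}" by blast+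
      then show "?f s = 0" "?g s = 0" by simp_all
    qed
    have "(\<Sum>s\<in>S. ?f s) = (\<Sum>s\<in>{r}. ?f s)" "(\<Sum>s\<in>T. ?g s) = (\<Sum>s\<in>{r}. ?g s)"
      by (rule sum.mono_neutral_right; use fin r 0 in auto)+
    moreover have "?f r + ?g r = 0"
    proof (cases "(S - {r}) \<inter> T = {}")
      case True
      have e: "S - {r} \<union> T = S \<union> (T - {r})" "S \<inter> (T - {r}) = {}" using True r by auto
      have "shuffle_sign ({r} \<union> (S - {r})) (T - {r}) = shuffle_sign {r} (T - {r}) * shuffle_sign (S - {r}) (T - {r})"
        by (rule shuffle_sign_Un_left) (use fin in auto)
      moreover have "shuffle_sign (S - {r}) ({r} \<union> (T - {r})) = shuffle_sign (S - {r}) {r} * shuffle_sign (S - {r}) (T - {r})"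
        by (rule shuffle_sign_Un_right) (use fin in auto)
      moreover have "{r} \<union> (S - {r}) = S" "{r} \<union> (T - {r}) = T" using r by auto
      moreover have "shuffle_sign (S - {r}) {r} = above_sign S r"
      proof -
        have "{(u, v). u \<in> S - {r} \<and> v \<in> {r} \<and> v < u} = (\<lambda>s. (s, r)) ` {s \<in> S. r < s}" by auto
        then show ?thesis by (simp only: shuffle_sign_def above_sign_def) (simp add: card_image inj_on_def)
      qed
      moreover have "shuffle_sign {r} (T - {r}) = - ((-1) ^ card T * above_sign T r)"
      proof -
        have "{(u, t). u \<in> {r} \<and> t \<in> T - {r} \<and> t < u} = Pair r ` {t \<in> T. t < r}" by auto
        then have "shuffle_sign {r} (T - {r}) = (-1) ^ card {t \<in> T. t < r}"
          by (simp only: shuffle_sign_def) (simp add: card_image inj_on_def)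
        moreover have "T = insert r ({t \<in> T. t < r} \<union> {t \<in> T. r < t})" using r by (auto simp: not_less_iff_gr_or_eq)
        then have "card T = card (insert r ({t \<in> T. t < r} \<union> {t \<in> T. r < t}))" by (rule arg_cong)
        then have "card T = Suc (card ({t \<in> T. t < r} \<union> {t \<in> T. r < t}))"
          using fin by simp
        moreover have "card ({t \<in> T. t < r} \<union> {t \<in> T. r < t}) = card {t \<in> T. t < r} + card {t \<in> T. r < t}"
          using fin by (subst card_Un_disjoint) auto
        ultimately show ?thesis by (simp add: above_sign_def power_add flip: power_mult_distrib)
      qed
      ultimately have "shuffle_sign S (T - {r}) = - ((-1) ^ card T * above_sign T r) * shuffle_sign (S - {r}) (T - {r})"
        "shuffle_sign (S - {r}) T = above_sign S r * shuffle_sign (S - {r}) (T - {r})" by simp_all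
      then show ?thesis using True e by (simp add: mult_ac)
    next
      case False
      then have "S \<inter> (T - {r}) \<noteq> {}" by auto
      then show ?thesis using False by simp
    qed
    ultimately show ?thesis using False by simp
  qed
  finally show ?case by simp
qed

definition doubled :: "nat \<Rightarrow> vec list \<Rightarrow> vec list \<Rightarrow> vec list \<Rightarrow> complex" where
  "doubled N xs ys zs =
     wedge_list (map (first_copy N) xs @ map (second_copy N) ys @ map (diagonal N) zs) {1..2 * N}"

lemma minus_one_power_cong: "(even j \<longleftrightarrow> even k) \<Longrightarrow> (-1 :: complex) ^ j = (-1) ^ k"
  by (simp add: minus_one_power_iff)

text \<open>The top coefficient of the double is split between the two factors: the diagonal part
  takes S and the shifted T, the two copies take their complements. The sign counts the inversions
  between the shifted complement of T and S.\<close>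

lemma doubled_pairing:
  "doubled N xs ys zs =
    (-1) ^ (length ys * (N - length xs)) * pairing N (wedge_list xs) (wedge_list ys) (wedge_list zs)"
proof -
  let ?I = "{1..N}"
  let ?A = "wedge_list (map (first_copy N) xs @ map (second_copy N) ys)"
  let ?B = "wedge_list (map (diagonal N) zs)"
  let ?h = "\<lambda>(S, T). (?I - S) \<union> shift N (?I - T)"
  have I2: "{1..2 * N} = ?I \<union> shift N ?I"
  proof (intro equalityI subsetI)
    fix k assume k: "k \<in> {1..2 * N}"
    show "k \<in> ?I \<union> shift N ?I"
    proof (cases "k \<le> N")
      case False
      then have "k = N + (k - N)" "k - N \<in> ?I" using k by auto
      then show ?thesis by blast
    qed (use k in auto)
  qed auto
  have disj: "?I \<inter> shift N ?I = {}" by auto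
  have cut: "(P \<union> shift N Q) \<inter> ?I = P" "{t. N + t \<in> P \<union> shift N Q} \<inter> ?I = Q"
    if "P \<subseteq> ?I" "Q \<subseteq> ?I" for P Q
    using that unfolding subset_iff by fastforce+
  have inj: "inj_on ?h (Pow ?I \<times> Pow ?I)"
  proof (rule inj_onI, clarify)
    fix S T S' T' assume s: "S \<subseteq> ?I" "T \<subseteq> ?I" "S' \<subseteq> ?I" "T' \<subseteq> ?I"
      and e: "(?I - S) \<union> shift N (?I - T) = (?I - S') \<union> shift N (?I - T')"
    have "?I - S = ?I - S'"
      using cut(1)[of "?I - S" "?I - T"] cut(1)[of "?I - S'" "?I - T'"] unfolding e
      by (simp only: Diff_subset simp_thms True_implies_equals)
    moreover have "?I - T = ?I - T'"
      using cut(2)[of "?I - S" "?I - T"] cut(2)[of "?I - S'" "?I - T'"] unfolding e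
      by (simp only: Diff_subset simp_thms True_implies_equals)
    ultimately have "?I - S = ?I - S'" "?I - T = ?I - T'" .
    then show "S = S' \<and> T = T'" using s by blast
  qed
  have img: "?h ` (Pow ?I \<times> Pow ?I) = Pow {1..2 * N}"
  proof (intro equalityI subsetI)
    fix R assume R: "R \<in> Pow {1..2 * N}"
    define S where "S = ?I - R"
    define T where "T = {t \<in> ?I. N + t \<notin> R}"
    have "?I - S = R \<inter> ?I" "?I - T = {t \<in> ?I. N + t \<in> R}" unfolding S_def T_def by blast+
    moreover have "R \<subseteq> ?I \<union> shift N ?I" using R unfolding I2 by (rule PowD)
    ultimately have "R = ?h (S, T)" unfolding prod.case by (simp only:) blast
    then show "R \<in> ?h ` (Pow ?I \<times> Pow ?I)" unfolding S_def T_def by blast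
  qed (auto simp: I2)
  have summand: "shuffle_sign (?h (S, T)) ({1..2 * N} - ?h (S, T)) * ?A (?h (S, T)) * ?B ({1..2 * N} - ?h (S, T)) =
     (-1) ^ (length ys * (N - length xs)) *
     ((if S \<inter> T = {} then shuffle_sign S T * wedge_list zs (S \<union> T) else 0) *
     (shuffle_sign (?I - S) S * wedge_list xs (?I - S)) * (shuffle_sign (?I - T) T * wedge_list ys (?I - T)))"
    if S: "S \<subseteq> ?I" and T: "T \<subseteq> ?I" for S T
  proof -
    let ?P = "?I - S" and ?Q = "?I - T"
    have P: "?P \<subseteq> ?I" and Q: "?Q \<subseteq> ?I" by auto
    have comp: "{1..2 * N} - ?h (S, T) = S \<union> shift N T"
    proof -
      have gen: "(I \<union> J) - ((I - S) \<union> K) = S \<union> M"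
        if "J = K \<union> M" "K \<inter> M = {}" "I \<inter> J = {}" "S \<subseteq> I" for I J K M :: "nat set"
        using that by auto
      have "?I = ?Q \<union> T" using T by blast
      then have "shift N ?I = shift N ?Q \<union> shift N T" by (metis image_Un)
      moreover have "shift N ?Q \<inter> shift N T = shift N (?Q \<inter> T)" by (rule image_Int[symmetric]) simp
      then have "shift N ?Q \<inter> shift N T = {}" by (simp only: Diff_disjoint Int_commute image_empty)
      ultimately show ?thesis unfolding I2 prod.case using disj S by (rule gen)
    qed
    have fin: "finite ?P" "finite ?Q" "finite S" "finite T" using S T finite_subset by auto
    have "shuffle_sign (?P \<union> shift N ?Q) (S \<union> shift N T) =
        shuffle_sign ?P S * shuffle_sign ?P (shift N T) * (shuffle_sign (shift N ?Q) S * shuffle_sign (shift N ?Q) (shift N T))"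
    proof -
      have "S \<inter> shift N T = {}" "?P \<inter> shift N ?Q = {}"
        using disj S image_mono[OF T, of "(+) N"] image_mono[OF Q, of "(+) N"] by blast+
      then show ?thesis using fin by (simp only: shuffle_sign_Un_left shuffle_sign_Un_right finite_imageI finite_UnI mult_ac)
    qed
    moreover have "shuffle_sign ?P (shift N T) = 1"
      by (rule shuffle_sign_less) (use T in force)
    moreover have "shuffle_sign (shift N ?Q) S = (-1) ^ (card (shift N ?Q) * card S)"
      by (rule shuffle_sign_greater) (use S in force)
    ultimately have sgn: "shuffle_sign (?P \<union> shift N ?Q) (S \<union> shift N T) =
        (-1) ^ (card ?Q * card S) * shuffle_sign ?P S * shuffle_sign ?Q T"
      by (simp add: shuffle_sign_shift card_image)
    \<comment> \<open>Only the degrees |?P| = length xs and |?Q| = length ys contribute, and for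
      these the sign no longer depends on S and T.\<close>
    have "wedge_list xs ?P = 0 \<or> wedge_list ys ?Q = 0 \<or> card ?Q * card S = length ys * (N - length xs)"
    proof -
      have "card S = N - card ?P" using S card_mono[of ?I S] by (simp add: card_Diff_subset fin)
      then show ?thesis using wedge_list_degree[of xs ?P] wedge_list_degree[of ys ?Q] by metis
    qed
    then show ?thesis
      unfolding comp unfolding prod.case sgn wedge_list_copies[OF P Q] wedge_list_diagonal[OF S T]
      by (elim disjE) (simp_all only: mult_zero_left mult_zero_right mult_ac)
  qed
  have "doubled N xs ys zs = wedge ?A ?B {1..2 * N}"
    unfolding doubled_def by (simp flip: wedge_list_append)
  also have "\<dots> = (\<Sum>(S, T)\<in>Pow ?I \<times> Pow ?I.
      shuffle_sign (?h (S, T)) ({1..2 * N} - ?h (S, T)) * ?A (?h (S, T)) * ?B ({1..2 * N} - ?h (S, T)))"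
    unfolding wedge_def img[symmetric] by (subst sum.reindex[OF inj]) (simp add: case_prod_unfold)
  also have "\<dots> = (\<Sum>(S, T)\<in>Pow ?I \<times> Pow ?I. (-1) ^ (length ys * (N - length xs)) *
     ((if S \<inter> T = {} then shuffle_sign S T * wedge_list zs (S \<union> T) else 0) *
     (shuffle_sign (?I - S) S * wedge_list xs (?I - S)) * (shuffle_sign (?I - T) T * wedge_list ys (?I - T))))"
    by (rule sum.cong[OF refl]) (use summand in \<open>clarsimp simp del: atLeastAtMost_iff\<close>)
  finally show ?thesis
    by (simp add: pairing_def sum.cartesian_product sum_distrib_left case_prod_unfold)
qed

section \<open>Symmetries of the doubled space\<close>

text \<open>The map \<open>g \<otimes> id\<close> on \<open>\<complex>\<^sup>2 \<otimes> V\<close>, restricted to the first \<open>m\<close> basis vectors of \<open>V\<close>,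
  where \<open>g\<close> is the identity plus the product of the column \<open>(\<alpha>, \<beta>)\<close> and the row \<open>(\<gamma>, \<delta>)\<close>.\<close>

definition plane_map :: "nat \<Rightarrow> complex \<Rightarrow> complex \<Rightarrow> complex \<Rightarrow> complex \<Rightarrow> nat \<Rightarrow> vec \<Rightarrow> vec" where
  "plane_map N \<alpha> \<beta> \<gamma> \<delta> m v = (\<lambda>k.
     if k \<in> {1..m} then v k + (\<gamma> * v k + \<delta> * v (N + k)) * \<alpha>
     else if k \<in> {N + 1..N + m} then v k + (\<gamma> * v (k - N) + \<delta> * v k) * \<beta>
     else v k)"

text \<open>The map g \<otimes> id has determinant det g to the power N. It is composed of rank one
  perturbations, one for each plane spanned by the two copies of a basis vector, and
  \<open>rank_one_top\<close> applies to each.\<close>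

lemma wedge_list_plane_map:
  "m \<le> N \<Longrightarrow> wedge_list (map (plane_map N \<alpha> \<beta> \<gamma> \<delta> m) vs) {1..2 * N} =
     (1 + (\<gamma> * \<alpha> + \<delta> * \<beta>)) ^ m * wedge_list vs {1..2 * N}"
proof (induction m)
  case 0
  have "plane_map N \<alpha> \<beta> \<gamma> \<delta> 0 = (\<lambda>v. v)" by (simp add: plane_map_def fun_eq_iff)
  then show ?case by simp
next
  case (Suc m)
  let ?I = "{1..2 * N}"
  define \<xi> where "\<xi> = (\<lambda>s. if s = Suc m then \<gamma> else if s = N + Suc m then \<delta> else 0)"
  define a where "a = (\<lambda>s. if s = Suc m then \<alpha> else if s = N + Suc m then \<beta> else 0)"
  have \<xi>: "(\<Sum>s\<in>?I. \<xi> s * v s) = \<gamma> * v (Suc m) + \<delta> * v (N + Suc m)" for v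
  proof -
    have "(\<Sum>s\<in>?I. \<xi> s * v s) = (\<Sum>s\<in>{Suc m, N + Suc m}. \<xi> s * v s)"
      by (rule sum.mono_neutral_right) (use Suc.prems in \<open>auto simp: \<xi>_def\<close>)
    then show ?thesis using Suc.prems by (simp add: \<xi>_def)
  qed
  have "rank_one_vec ?I \<xi> a (plane_map N \<alpha> \<beta> \<gamma> \<delta> m v) = plane_map N \<alpha> \<beta> \<gamma> \<delta> (Suc m) v" for v
  proof
    fix k
    show "rank_one_vec ?I \<xi> a (plane_map N \<alpha> \<beta> \<gamma> \<delta> m v) k = plane_map N \<alpha> \<beta> \<gamma> \<delta> (Suc m) v k"
      unfolding rank_one_vec_def \<xi> using Suc.prems
      by (cases "k = N + Suc m") (auto simp: plane_map_def a_def)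
  qed
  then have "wedge_list (map (plane_map N \<alpha> \<beta> \<gamma> \<delta> (Suc m)) vs) ?I =
      rank_one ?I \<xi> a (wedge_list (map (plane_map N \<alpha> \<beta> \<gamma> \<delta> m) vs)) ?I"
    by (simp add: rank_one_wedge_list comp_def)
  also have "\<dots> = (1 + (\<gamma> * \<alpha> + \<delta> * \<beta>)) * wedge_list (map (plane_map N \<alpha> \<beta> \<gamma> \<delta> m) vs) ?I"
    unfolding rank_one_top[OF finite_atLeastAtMost] \<xi> using Suc.prems by (simp add: a_def)
  finally show ?case using Suc by simp
qed

text \<open>In the plane, the involution exchanging (1,0) and (1,1) sends (0,1) to (0,-1) and has
  determinant -1.\<close>

lemma swap_first_diagonal:
  "wedge_list (map (diagonal N) as @ map (first_copy N) bs @ map (\<lambda>v k. - second_copy N v k) cs @ map (diagonal N) ds) {1..2 * N} =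
   (-1) ^ N * wedge_list (map (first_copy N) as @ map (diagonal N) bs @ map (second_copy N) cs @ map (first_copy N) ds) {1..2 * N}"
proof -
  let ?f = "plane_map N 0 1 1 (-2) N"
  have "?f (first_copy N v) = diagonal N v" "?f (second_copy N v) = (\<lambda>k. - second_copy N v k)"
    "?f (diagonal N v) = first_copy N v" for v
    by (auto simp: plane_map_def first_copy_def second_copy_def diagonal_def fun_eq_iff)
  then show ?thesis
    using wedge_list_plane_map[of N N 0 1 1 "-2"
      "map (first_copy N) as @ map (diagonal N) bs @ map (second_copy N) cs @ map (first_copy N) ds"]
    by (simp add: comp_def)
qed

text \<open>The coordinate exchange in the plane: it fixes (1,1) and has determinant -1.\<close>

lemma swap_first_second:
  "wedge_list (map (diagonal N) as @ map (first_copy N) bs @ map (second_copy N) cs) {1..2 * N} =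
   (-1) ^ N * wedge_list (map (diagonal N) as @ map (second_copy N) bs @ map (first_copy N) cs) {1..2 * N}"
proof -
  let ?f = "plane_map N 1 (-1) (-1) 1 N"
  have "?f (first_copy N v) = second_copy N v" "?f (second_copy N v) = first_copy N v"
    "?f (diagonal N v) = diagonal N v" for v
    by (auto simp: plane_map_def first_copy_def second_copy_def diagonal_def fun_eq_iff)
  then show ?thesis
    using wedge_list_plane_map[of N N 1 "-1" "-1" 1
      "map (diagonal N) as @ map (second_copy N) bs @ map (first_copy N) cs"]
    by (simp add: comp_def)
qed

lemma foldl_wedge_right_add:
  "foldl (\<lambda>x v. wedge_right v x) (\<lambda>S. x S + y S) vs =
    (\<lambda>S. foldl (\<lambda>x v. wedge_right v x) x vs S + foldl (\<lambda>x v. wedge_right v x) y vs S)"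
  by (induction vs arbitrary: x y) (simp_all add: wedge_right_add)

lemma wedge_list_add_vec:
  "wedge_list (ps @ (\<lambda>k. v k + w k) # qs) S = wedge_list (ps @ v # qs) S + wedge_list (ps @ w # qs) S"
  by (simp add: wedge_list_def wedge_right_add_vec foldl_wedge_right_add)

lemma wedge_list_scale_vec:
  "wedge_list (ps @ (\<lambda>k. c * v k) # qs) S = c * wedge_list (ps @ v # qs) S"
  by (simp add: wedge_list_def wedge_right_scale_vec foldl_wedge_right_scale)

lemma wedge_list_map_uminus:
  "wedge_list (ps @ map (\<lambda>v k. - f v k) xs @ qs) S = (-1) ^ length xs * wedge_list (ps @ map f xs @ qs) S"
proof (induction xs arbitrary: ps)
  case (Cons x xs)
  have "wedge_list (ps @ (\<lambda>k. - f x k) # ys) S = - wedge_list (ps @ f x # ys) S" for ys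
    using wedge_list_scale_vec[of ps "-1" "f x" ys S] by simp
  then show ?case using Cons[of "ps @ [f x]"] by simp
qed simp

lemma wedge_list_repeated: "v \<in> set qs \<Longrightarrow> wedge_list (ps @ v # qs) S = 0"
  using wedge_list_move[of ps v qs "[]" S] wedge_list_snoc[of "ps @ qs" v] wedge_right_member[of v "ps @ qs"]
  by simp

text \<open>The second copy of x already occurs as a later factor, so only the first-copy component
  of the diagonal vector survives.\<close>

lemma wedge_list_replace_diagonal:
  assumes "\<And>x. x \<in> set xs \<Longrightarrow> second_copy N x \<in> set qs"
  shows "wedge_list (ps @ map (diagonal N) xs @ qs) S = wedge_list (ps @ map (first_copy N) xs @ qs) S"
  using assms
proof (induction xs arbitrary: ps)
  case (Cons x xs)
  have "wedge_list (ps @ diagonal N x # map (diagonal N) xs @ qs) S =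
      wedge_list (ps @ first_copy N x # map (diagonal N) xs @ qs) S"
    unfolding diagonal_def[of N x] wedge_list_add_vec
    by (subst (2) wedge_list_repeated) (use Cons.prems in auto)
  then show ?case using Cons.IH[of "ps @ [first_copy N x]"] Cons.prems by simp
qed simp

section \<open>Identities between three-flag functions\<close>

lemma initial_mono: "b \<le> a \<Longrightarrow> set (initial u b) \<subseteq> set (initial u a)"
  by (auto simp: initial_def)

lemma quad_ordered_doubled:
  assumes u: "supported (NN n) u" and v: "supported (NN n) v" and w: "supported (NN n) w"
    and sum: "a + b + c + d = 2 * NN n" and a: "a \<le> NN n" and ac: "NN n \<le> a + c"
  shows "quad_ordered n (wedge_upto n u) (wedge_upto n v) (wedge_upto n w) a b c d =
    (-1) ^ ((a + c - NN n) * (d + a)) * doubled (NN n) (initial u b @ initial w d) (initial u a) (initial v c)"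
proof -
  have "NN n - (b + d) = a + c - NN n" using sum ac by simp
  then have "doubled (NN n) (initial u b @ initial w d) (initial u a) (initial v c) =
    (-1) ^ ((a + c - NN n) * a) * pairing (NN n) (wedge_list (initial u b @ initial w d))
      (wedge_list (initial u a)) (wedge_list (initial v c))"
    unfolding doubled_pairing by (simp add: mult.commute)
  then show ?thesis unfolding quad_ordered_pairing[OF assms]
    by (simp add: distrib_left power_add flip: power_mult_distrib)
qed

lemma wedge_list_move_two:
  "wedge_list (ps @ p # xs @ q # ys) S = (-1) ^ length xs * wedge_list ((ps @ xs @ ys) @ [p, q]) S"
  using wedge_list_move[of "ps @ p # xs" q ys "[]" S] wedge_list_move[of ps p "xs @ ys" "[q]" S]
  by (simp add: power_add flip: power_mult_distrib)

text \<open>What remains after the three-term relation is the comparison of signs: in each of the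
  three products the two factors together carry (-1)^(c + d), although their individual signs depend
  on k.\<close>

lemma octahedron:
  assumes u: "supported (NN n) u" and v: "supported (NN n) v" and w: "supported (NN n) w"
    and sum: "a + b + c + d + 2 = 2 * NN n" and a: "a < NN n" and ac: "NN n \<le> a + c"
  defines "Q \<equiv> quad_ordered n (wedge_upto n u) (wedge_upto n v) (wedge_upto n w)"
  shows "Q (Suc a) (Suc b) c d * Q a b (Suc c) (Suc d) =
    Q a (Suc b) c (Suc d) * Q (Suc a) b (Suc c) d + Q a (Suc b) (Suc c) d * Q (Suc a) b c (Suc d)"
proof -
  let ?N = "NN n"
  define P where "P = map (first_copy ?N) (initial u b)"
  define X where "X = map (first_copy ?N) (initial w d)"
  define Y where "Y = map (second_copy ?N) (initial u a)"
  define Z where "Z = map (diagonal ?N) (initial v c)"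
  define p where "p = first_copy ?N (u (Suc b))"
  define x where "x = first_copy ?N (w (Suc d))"
  define y where "y = second_copy ?N (u (Suc a))"
  define z where "z = diagonal ?N (v (Suc c))"
  define f where "f = (\<lambda>p q. wedge_list ((P @ X @ Y @ Z) @ [p, q]) {1..2 * ?N})"
  define k where "k = a + c - ?N"
  note defs = doubled_def initial_Suc f_def P_def X_def Y_def Z_def p_def x_def y_def z_def
  have k: "a + c - ?N = k" "Suc a + c - ?N = Suc k" "a + Suc c - ?N = Suc k" "Suc a + Suc c - ?N = Suc (Suc k)"
    using ac unfolding k_def by simp_all
  note Q = quad_ordered_doubled[OF u v w, folded Q_def]
  have len: "length X = d" "length Y = a" "length Z = c" by (simp_all add: X_def Y_def Z_def)
  have "doubled ?N (initial u (Suc b) @ initial w d) (initial u (Suc a)) (initial v c) = (-1) ^ (d + a) * f p y"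
    using wedge_list_move_two[of P p "X @ Y" y Z] by (simp add: defs)
  then have 13: "Q (Suc a) (Suc b) c d = (-1) ^ (Suc k * (d + Suc a) + (d + a)) * f p y"
    using sum a ac Q[of "Suc a" "Suc b" c d] by (simp only: k power_add mult.assoc; simp?)
  have "doubled ?N (initial u b @ initial w (Suc d)) (initial u a) (initial v (Suc c)) = (-1) ^ (a + c) * f x z"
    using wedge_list_move_two[of "P @ X" x "Y @ Z" z "[]"] by (simp add: defs)
  then have 24: "Q a b (Suc c) (Suc d) = (-1) ^ (Suc k * (Suc d + a) + (a + c)) * f x z"
    using sum a ac Q[of a b "Suc c" "Suc d"] by (simp only: k power_add mult.assoc; simp?)
  have "doubled ?N (initial u (Suc b) @ initial w (Suc d)) (initial u a) (initial v c) = (-1) ^ d * f p x"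
    using wedge_list_move_two[of P p X x "Y @ Z"] by (simp add: defs)
  then have 12: "Q a (Suc b) c (Suc d) = (-1) ^ (k * (Suc d + a) + d) * f p x"
    using sum a ac Q[of a "Suc b" c "Suc d"] by (simp only: k power_add mult.assoc; simp?)
  have "doubled ?N (initial u b @ initial w d) (initial u (Suc a)) (initial v (Suc c)) = (-1) ^ c * f y z"
    using wedge_list_move_two[of "P @ X @ Y" y Z z "[]"] by (simp add: defs)
  then have 34: "Q (Suc a) b (Suc c) d = (-1) ^ (Suc (Suc k) * (d + Suc a) + c) * f y z"
    using sum a ac Q[of "Suc a" b "Suc c" d] by (simp only: k power_add mult.assoc; simp?)
  have "doubled ?N (initial u (Suc b) @ initial w d) (initial u a) (initial v (Suc c)) = (-1) ^ (d + a + c) * f p z"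
    using wedge_list_move_two[of P p "X @ Y @ Z" z "[]"] by (simp add: defs add.assoc)
  then have 14: "Q a (Suc b) (Suc c) d = (-1) ^ (Suc k * (d + a) + (d + a + c)) * f p z"
    using sum a ac Q[of a "Suc b" "Suc c" d] by (simp only: k power_add mult.assoc; simp?)
  have "doubled ?N (initial u b @ initial w (Suc d)) (initial u (Suc a)) (initial v c) = (-1) ^ a * f x y"
    using wedge_list_move_two[of "P @ X" x Y y Z] by (simp add: defs)
  then have 23: "Q (Suc a) b c (Suc d) = (-1) ^ (Suc k * (Suc d + Suc a) + a) * f x y"
    using sum a ac Q[of "Suc a" b c "Suc d"] by (simp only: k power_add mult.assoc; simp?)
  have plucker: "f p y * f x z = f p x * f y z + f p z * f x y"
    unfolding f_def by (rule plucker_three_term) simp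
  have mult: "((-1) ^ i * r) * ((-1) ^ j * s) = (-1) ^ (c + d) * (r * s)"
    if "even (i + j) \<longleftrightarrow> even (c + d)" for i j and r s :: complex
    using that minus_one_power_cong[of "i + j" "c + d"] by (simp add: power_add mult_ac)
  show ?thesis unfolding 13 24 12 34 14 23
    by (subst (1 2 3) mult; (simp only: even_add even_mult_iff even_Suc; blast)?)
      (simp add: plucker distrib_left)
qed

text \<open>The lines of (1,0), (0,1), (1,1) in the plane are permuted cyclically by exchanging
  first copy and diagonal and then the two copies. The two determinant factors cancel, and the
  remaining sign is that of the reordering and of (0,1) |-> (0,-1).\<close>

lemma doubled_rotate:
  assumes "odd N"
  shows "doubled N xs ys zs =
    (-1) ^ (length ys + length xs * (length ys + length zs)) * doubled N ys zs xs"
proof -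
  let ?w = "\<lambda>vs. wedge_list vs {1..2 * N}"
  let ?f = "map (first_copy N)" and ?s = "map (second_copy N)" and ?d = "map (diagonal N)"
  let ?x = "length xs" and ?y = "length ys" and ?z = "length zs"
  have "doubled N xs ys zs = (-1) ^ (?y * ?z) * ?w (?f xs @ ?d zs @ ?s ys)"
    using wedge_list_swap[of "?f xs" "?s ys" "?d zs" "[]"] by (simp add: doubled_def)
  also have "?w (?f xs @ ?d zs @ ?s ys) = (-1) ^ ?y * - ?w (?d xs @ ?f zs @ ?s ys)"
    using swap_first_diagonal[of N xs zs ys "[]"] assms
      wedge_list_map_uminus[of "?d xs @ ?f zs" "second_copy N" ys "[]"] by simp
  also have "- ?w (?d xs @ ?f zs @ ?s ys) = ?w (?d xs @ ?s zs @ ?f ys)"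
    using swap_first_second[of N xs zs ys] assms by simp
  also have "\<dots> = (-1) ^ (?x * (?z + ?y)) * ?w (?s zs @ ?f ys @ ?d xs)"
    using wedge_list_swap[of "[]" "?d xs" "?s zs @ ?f ys" "[]"] by simp
  also have "?w (?s zs @ ?f ys @ ?d xs) = (-1) ^ (?z * ?y) * doubled N ys zs xs"
    using wedge_list_swap[of "[]" "?s zs" "?f ys" "?d xs"] by (simp add: doubled_def)
  finally have "doubled N xs ys zs =
      (-1) ^ (?y * ?z + (?y + (?x * (?z + ?y) + ?z * ?y))) * doubled N ys zs xs"
    by (simp only: power_add mult.assoc)
  moreover have "(-1 :: complex) ^ (?y * ?z + (?y + (?x * (?z + ?y) + ?z * ?y))) = (-1) ^ (?y + ?x * (?y + ?z))"
    by (intro minus_one_power_cong) (simp add: even_add even_mult_iff; blast)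
  ultimately show ?thesis by simp
qed

text \<open>The degrees have an even sum and N is odd, so the sign of the rotation cancels against
  the signs of the two translations into the double.\<close>

lemma pairing_rotate:
  assumes "odd N" "length xs + length ys + length zs = 2 * N" "length xs \<le> N" "length ys \<le> N"
  shows "pairing N (wedge_list xs) (wedge_list ys) (wedge_list zs) =
    pairing N (wedge_list ys) (wedge_list zs) (wedge_list xs)"
proof -
  let ?x = "length xs" and ?y = "length ys" and ?z = "length zs"
  have eq: "(-1) ^ (?y * (N - ?x)) * pairing N (wedge_list xs) (wedge_list ys) (wedge_list zs) =
      (-1) ^ (?y + ?x * (?y + ?z) + ?z * (N - ?y)) * pairing N (wedge_list ys) (wedge_list zs) (wedge_list xs)"
    using doubled_rotate[OF assms(1), of xs ys zs] by (simp add: doubled_pairing power_add)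
  have parity: "even (?x + ?y + ?z)" using assms(2) by simp
  have "(-1 :: complex) ^ (?y * (N - ?x)) = (-1) ^ (?y + ?x * (?y + ?z) + ?z * (N - ?y))"
  proof (rule minus_one_power_cong)
    have "even (N - ?x) \<longleftrightarrow> odd ?x" "even (N - ?y) \<longleftrightarrow> odd ?y" using assms by (simp_all add: even_diff_nat)
    then show "even (?y * (N - ?x)) \<longleftrightarrow> even (?y + ?x * (?y + ?z) + ?z * (N - ?y))"
      using parity unfolding even_add even_mult_iff by blast
  qed
  then show ?thesis using eq by simp
qed

text \<open>The two definitions split different flags, V_c on the left and U_a on the right; the
  cyclic symmetry of the pairing relates them. The remaining sign is (-1)^((N - d) d), which is 1
  for odd N.\<close>

lemma quad_ordered_0:
  assumes u: "supported (NN n) u" and v: "supported (NN n) v" and w: "supported (NN n) w"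
    and sum: "a + c + d = 2 * NN n" and le: "a \<le> NN n" "c \<le> NN n" "d \<le> NN n"
  shows "quad_ordered n (wedge_upto n u) (wedge_upto n v) (wedge_upto n w) a 0 c d =
    triple n (wedge_upto n u) (wedge_upto n v) (wedge_upto n w) a c d"
proof -
  have "a + c + d = 2 * M \<Longrightarrow> d \<le> M \<Longrightarrow> a + c - M = M - d" for M by arith
  then have "a + c - NN n = NN n - d" using sum le(3) .
  moreover have "even ((NN n - d) * d)" using le by (simp add: even_mult_iff even_diff_nat)
  ultimately have "(-1 :: complex) ^ ((a + c - NN n) * d) = 1" by (simp only: neg_one_even_power)
  moreover have "quad_ordered n (wedge_upto n u) (wedge_upto n v) (wedge_upto n w) a 0 c d =
      (-1) ^ ((a + c - NN n) * d) *
      pairing (NN n) (wedge_list (initial u 0 @ initial w d)) (wedge_list (initial u a)) (wedge_list (initial v c))"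
    by (rule quad_ordered_pairing[OF u v w]) (use sum le in auto)
  moreover have "pairing (NN n) (wedge_list (initial v c)) (wedge_list (initial w d)) (wedge_list (initial u a)) =
      pairing (NN n) (wedge_list (initial w d)) (wedge_list (initial u a)) (wedge_list (initial v c))"
    by (rule pairing_rotate) (use sum le in auto)
  ultimately show ?thesis
    unfolding triple_pairing[OF u v w sum le(2,3)] by (simp only: mult_1 initial_0 append_Nil)
qed

lemma wedge_complement:
  "finite R \<Longrightarrow> wedge x y R = (\<Sum>T\<in>Pow R. shuffle_sign (R - T) T * x (R - T) * y T)"
  unfolding wedge_def
  by (rule sum.reindex_bij_witness[where i="\<lambda>T. R - T" and j="\<lambda>S. R - S"]) (auto simp: double_diff)

text \<open>A form of degree N has a coefficient only at the full set, which forces S = {} and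
  leaves a single exterior product.\<close>

lemma pairing_full_left:
  assumes "length xs = N"
  shows "pairing N (wedge_list xs) y z = wedge_list xs {1..N} * wedge y z {1..N}"
proof -
  let ?t = "\<lambda>S T. (if S \<inter> T = {} then shuffle_sign S T * z (S \<union> T) else 0) *
     (shuffle_sign ({1..N} - S) S * wedge_list xs ({1..N} - S)) * (shuffle_sign ({1..N} - T) T * y ({1..N} - T))"
  have "pairing N (wedge_list xs) y z = (\<Sum>S\<in>{{}}. \<Sum>T\<in>Pow {1..N}. ?t S T)"
    unfolding pairing_def
  proof (rule sum.mono_neutral_right)
    show "\<forall>S\<in>Pow {1..N} - {{}}. (\<Sum>T\<in>Pow {1..N}. ?t S T) = 0"
    proof
      fix S assume S: "S \<in> Pow {1..N} - {{}}"
      then have "card ({1..N} - S) < N"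
        using psubset_card_mono[of "{1..N}" "{1..N} - S"] by auto
      then have "wedge_list xs ({1..N} - S) = 0" using wedge_list_degree[of xs "{1..N} - S"] assms by auto
      then show "(\<Sum>T\<in>Pow {1..N}. ?t S T) = 0" by simp
    qed
  qed auto
  then show ?thesis by (simp add: wedge_complement sum_distrib_left mult_ac)
qed

lemma pairing_full_middle:
  assumes "length ys = N"
  shows "pairing N x (wedge_list ys) z = wedge_list ys {1..N} * wedge x z {1..N}"
proof -
  let ?t = "\<lambda>T S. (if S \<inter> T = {} then shuffle_sign S T * z (S \<union> T) else 0) *
     (shuffle_sign ({1..N} - S) S * x ({1..N} - S)) * (shuffle_sign ({1..N} - T) T * wedge_list ys ({1..N} - T))"
  have "pairing N x (wedge_list ys) z = (\<Sum>T\<in>{{}}. \<Sum>S\<in>Pow {1..N}. ?t T S)"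
    unfolding pairing_def
  proof (subst sum.swap, rule sum.mono_neutral_right)
    show "\<forall>S\<in>Pow {1..N} - {{}}. (\<Sum>T\<in>Pow {1..N}. ?t S T) = 0"
    proof
      fix S assume S: "S \<in> Pow {1..N} - {{}}"
      then have "card ({1..N} - S) < N"
        using psubset_card_mono[of "{1..N}" "{1..N} - S"] by auto
      then have "wedge_list ys ({1..N} - S) = 0" using wedge_list_degree[of ys "{1..N} - S"] assms by auto
      then show "(\<Sum>T\<in>Pow {1..N}. ?t S T) = 0" by simp
    qed
  qed auto
  then show ?thesis by (simp add: wedge_complement sum_distrib_left mult_ac)
qed

text \<open>U_N is the volume form, so its factor is a scalar, and the sign in
  \<open>quad_ordered_pairing\<close> undoes that of moving V_c past W_d.\<close>

lemma quad_ordered_full: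
  assumes u: "supported (NN n) u" and v: "supported (NN n) v" and w: "supported (NN n) w"
    and sum: "b + c + d = NN n" and vol: "wedge_list (initial u (NN n)) {1..NN n} = 1"
  shows "quad_ordered n (wedge_upto n u) (wedge_upto n v) (wedge_upto n w) (NN n) b c d =
    triple n (wedge_upto n u) (wedge_upto n v) (wedge_upto n w) b c d"
proof -
  have "quad_ordered n (wedge_upto n u) (wedge_upto n v) (wedge_upto n w) (NN n) b c d =
      (-1) ^ ((NN n + c - NN n) * d) * pairing (NN n) (wedge_list (initial u b @ initial w d))
        (wedge_list (initial u (NN n))) (wedge_list (initial v c))"
    by (rule quad_ordered_pairing[OF u v w]) (use sum in simp_all)
  also have "\<dots> = (-1) ^ (c * d) * wedge_list (initial u b @ initial w d @ initial v c) {1..NN n}"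
    unfolding pairing_full_middle[OF length_initial] vol wedge_list_append[symmetric] by simp
  also have "\<dots> = triple n (wedge_upto n u) (wedge_upto n v) (wedge_upto n w) b c d"
    unfolding triple_vol[OF u v w sum] vol_def
    using wedge_list_swap[of "initial u b" "initial v c" "initial w d" "[]" "{1..NN n}"] by (simp add: mult.commute)
  finally show ?thesis .
qed

text \<open>Exchanging first copy and diagonal makes W_d diagonal and puts V_c into the first copy.
  It also makes U_b diagonal, but since b \<le> a the second copies of its vectors occur in U_a, so
  it may be moved back to the first copy.\<close>

lemma quad_ordered_swap:
  assumes u: "supported (NN n) u" and v: "supported (NN n) v" and w: "supported (NN n) w"
    and sum: "a + b + c + d = 2 * NN n" and a: "b \<le> a" "a \<le> NN n" and ge: "NN n \<le> a + c" "NN n \<le> a + d"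
  shows "quad_ordered n (wedge_upto n u) (wedge_upto n v) (wedge_upto n w) a b c d =
    (-1) ^ ((a + 1) * (c + d + 1) + c * d) *
    quad_ordered n (wedge_upto n u) (wedge_upto n w) (wedge_upto n v) a b d c"
proof -
  let ?N = "NN n"
  let ?w = "\<lambda>vs. wedge_list vs {1..2 * ?N}"
  let ?f = "map (first_copy ?N)" and ?s = "map (second_copy ?N)" and ?d = "map (diagonal ?N)"
  let ?a = "initial u a" and ?b = "initial u b" and ?c = "initial v c" and ?e = "initial w d"
  have "doubled ?N (?b @ ?e) ?a ?c = (-1) ^ (a * c) * ?w (?f (?b @ ?e) @ ?d ?c @ ?s ?a)"
    using wedge_list_swap[of "?f (?b @ ?e)" "?s ?a" "?d ?c" "[]"] by (simp add: doubled_def)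
  also have "?w (?f (?b @ ?e) @ ?d ?c @ ?s ?a) = (-1) ^ Suc a * ?w ([] @ ?d ?b @ (?d ?e @ ?f ?c @ ?s ?a))"
    using swap_first_diagonal[of ?N "?b @ ?e" ?c ?a "[]"]
      wedge_list_map_uminus[of "?d (?b @ ?e) @ ?f ?c" "second_copy ?N" ?a "[]"] by simp
  also have "?w ([] @ ?d ?b @ (?d ?e @ ?f ?c @ ?s ?a)) = ?w ([] @ ?f ?b @ (?d ?e @ ?f ?c @ ?s ?a))"
    by (rule wedge_list_replace_diagonal) (use initial_mono[OF a(1), of u] in auto)
  also have "\<dots> = (-1) ^ (d * (c + a)) * doubled ?N (?b @ ?c) ?a ?e"
    using wedge_list_swap[of "?f ?b" "?d ?e" "?f ?c @ ?s ?a" "[]"] by (simp add: doubled_def)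
  finally have eq: "doubled ?N (?b @ ?e) ?a ?c = (-1) ^ (a * c + (Suc a + d * (c + a))) * doubled ?N (?b @ ?c) ?a ?e"
    by (simp only: power_add mult.assoc)
  have sum': "a + b + d + c = 2 * NN n" using sum by simp
  have "(-1 :: complex) ^ ((a + c - ?N) * (d + a) + (a * c + (Suc a + d * (c + a)))) =
      (-1) ^ ((a + 1) * (c + d + 1) + c * d + (a + d - ?N) * (c + a))"
    by (intro minus_one_power_cong)
      (use ge in \<open>simp add: even_add even_mult_iff even_diff_nat; blast\<close>)
  then show ?thesis
    unfolding quad_ordered_doubled[OF u v w sum a(2) ge(1)] quad_ordered_doubled[OF u w v sum' a(2) ge(2)] eq
    by (simp only: power_add mult.assoc[symmetric])
qed

text \<open>After the swap U_b and V_c stand in the same factor and fill it to degree N, so the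
  pairing splits. This is the origin of the products of frozen variables at the virtual
  positions.\<close>

lemma quad_ordered_factor:
  assumes u: "supported (NN n) u" and v: "supported (NN n) v" and w: "supported (NN n) w"
    and sum: "b + c = NN n" "a + d = NN n" and a: "b \<le> a"
  shows "quad_ordered n (wedge_upto n u) (wedge_upto n v) (wedge_upto n w) a b c d =
    vol n (wedge (wedge_upto n u b) (wedge_upto n v c)) * vol n (wedge (wedge_upto n u a) (wedge_upto n w d))"
proof -
  have "even d \<longleftrightarrow> odd a" using sum(2) by (metis even_add even_mult_iff odd_one dvd_triv_left)
  then have "even ((a + 1) * (c + d + 1) + c * d)" by (simp add: even_add even_mult_iff) blast
  then have "(-1 :: complex) ^ ((a + 1) * (c + d + 1) + c * d) = 1" by (rule neg_one_even_power)
  moreover have "quad_ordered n (wedge_upto n u) (wedge_upto n v) (wedge_upto n w) a b c d =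
      (-1) ^ ((a + 1) * (c + d + 1) + c * d) *
      quad_ordered n (wedge_upto n u) (wedge_upto n w) (wedge_upto n v) a b d c"
    by (rule quad_ordered_swap[OF u v w]) (use sum a in simp_all)
  ultimately have "quad_ordered n (wedge_upto n u) (wedge_upto n v) (wedge_upto n w) a b c d =
      quad_ordered n (wedge_upto n u) (wedge_upto n w) (wedge_upto n v) a b d c"
    by (simp only: mult_1)
  also have "\<dots> = pairing (NN n) (wedge_list (initial u b @ initial v c)) (wedge_list (initial u a)) (wedge_list (initial w d))"
    using sum a by (subst quad_ordered_pairing[OF u w v]) auto
  also have "\<dots> = wedge_list (initial u b @ initial v c) {1..NN n} * wedge (wedge_list (initial u a)) (wedge_list (initial w d)) {1..NN n}"
    by (rule pairing_full_left) (use sum in simp)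
  finally show ?thesis by (simp only: vol_def wedge_list_append wedge_upto_eq u v w)
qed

section \<open>Duality\<close>

text \<open>The indices k and N + 1 - k are the ones paired by the quadratic form.\<close>

definition reflect :: "nat \<Rightarrow> nat set \<Rightarrow> nat set" where
  "reflect N S = (\<lambda>k. N + 1 - k) ` S"

text \<open>Invariance of the flag under the Hodge star, in coordinates: U_a is the star of
  U_(N-a).\<close>

definition self_dual :: "nat \<Rightarrow> (nat \<Rightarrow> vec) \<Rightarrow> bool" where
  "self_dual N u \<longleftrightarrow> (\<forall>a\<le>N. \<forall>S\<subseteq>{1..N}.
     wedge_list (initial u a) S = wedge_list (initial u (N - a)) (reflect N ({1..N} - S)))"

lemma reflect_reflect: "S \<subseteq> {1..N} \<Longrightarrow> reflect N (reflect N S) = S"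
  by (force simp: reflect_def image_image)

lemma reflect_inj:
  fixes N :: nat
  shows "inj_on (\<lambda>k. N + 1 - k) {1..N}"
proof (rule inj_onI)
  fix x y assume "x \<in> {1..N}" "y \<in> {1..N}" and e: "N + 1 - x = N + 1 - y"
  then have "x = N + 1 - (N + 1 - x)" "y = N + 1 - (N + 1 - y)" by auto
  then show "x = y" using e by metis
qed

lemma reflect_UNIV: "reflect N {1..N} = {1..N}"
proof
  show "{1..N} \<subseteq> reflect N {1..N}"
  proof
    fix k assume "k \<in> {1..N}"
    then have "k = N + 1 - (N + 1 - k)" "N + 1 - k \<in> {1..N}" by auto
    then show "k \<in> reflect N {1..N}" unfolding reflect_def by blast
  qed
qed (auto simp: reflect_def)

lemma reflect_subset: "S \<subseteq> {1..N} \<Longrightarrow> reflect N S \<subseteq> {1..N}"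
  by (fastforce simp: reflect_def)

lemma reflect_Un: "reflect N (S \<union> T) = reflect N S \<union> reflect N T"
  by (auto simp: reflect_def)

lemma reflect_Int: "S \<subseteq> {1..N} \<Longrightarrow> T \<subseteq> {1..N} \<Longrightarrow> reflect N (S \<inter> T) = reflect N S \<inter> reflect N T"
  unfolding reflect_def by (rule inj_on_image_Int[OF reflect_inj])

lemma reflect_Diff: "S \<subseteq> {1..N} \<Longrightarrow> T \<subseteq> {1..N} \<Longrightarrow> reflect N (S - T) = reflect N S - reflect N T"
  unfolding reflect_def by (rule inj_on_image_set_diff[OF reflect_inj]) auto

lemma reflect_empty_iff [simp]: "reflect N S = {} \<longleftrightarrow> S = {}"
  by (simp add: reflect_def)

lemma reflect_bij: "bij_betw (reflect N) (Pow {1..N}) (Pow {1..N})"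
  by (rule bij_betw_byWitness[where f'="reflect N"]) (auto simp: reflect_reflect image_subset_iff simp del: One_nat_def dest: subsetD[OF reflect_subset])

lemma sum_reflect: "(\<Sum>S\<in>Pow {1..N}. f S) = (\<Sum>S\<in>Pow {1..N}. f (reflect N S))"
  by (rule sum.reindex_bij_betw[OF reflect_bij, symmetric])

text \<open>The reflection reverses the order of the indices, hence the two arguments change
  places.\<close>

lemma shuffle_sign_reflect:
  assumes "S \<subseteq> {1..N}" "T \<subseteq> {1..N}"
  shows "shuffle_sign (reflect N S) (reflect N T) = shuffle_sign T S"
proof -
  let ?r = "\<lambda>k. N + 1 - k"
  have "{(s, t). s \<in> reflect N S \<and> t \<in> reflect N T \<and> t < s} =
      (\<lambda>(t, s). (?r s, ?r t)) ` {(t, s). t \<in> T \<and> s \<in> S \<and> s < t}" (is "_ = ?h ` ?I")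
  proof
    show "{(s, t). s \<in> reflect N S \<and> t \<in> reflect N T \<and> t < s} \<subseteq> ?h ` ?I"
    proof clarify
      fix s' t' assume "s' \<in> reflect N S" "t' \<in> reflect N T" "t' < s'"
      then obtain s t where st: "s \<in> S" "s' = ?r s" "t \<in> T" "t' = ?r t" by (auto simp: reflect_def)
      then have "s < t" using \<open>t' < s'\<close> by simp
      then have "(t, s) \<in> ?I" using st by auto
      then show "(s', t') \<in> ?h ` ?I" using st by force
    qed
    show "?h ` ?I \<subseteq> {(s, t). s \<in> reflect N S \<and> t \<in> reflect N T \<and> t < s}"
      using assms by (auto simp: reflect_def)
  qed
  moreover have "inj_on ?h ?I" using assms by (fastforce simp: inj_on_def)
  ultimately show ?thesis by (simp only: shuffle_sign_def card_image)
qed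

text \<open>For odd N either S or its complement has even size.\<close>

lemma shuffle_sign_complement:
  assumes "odd N" "S \<subseteq> {1..N}"
  shows "shuffle_sign S ({1..N} - S) = shuffle_sign ({1..N} - S) S"
proof -
  have fin: "finite S" using assms(2) finite_subset by blast
  have "card ({1..N} - S) = N - card S" "card S \<le> N"
    using card_mono[of "{1..N}" S] assms(2) by (simp_all add: card_Diff_subset fin)
  then have "even (card ({1..N} - S) * card S)"
    using assms(1) by (simp add: even_mult_iff even_diff_nat)
  then have "(-1 :: complex) ^ (card ({1..N} - S) * card S) = 1" by (rule neg_one_even_power)
  moreover have "({1..N} - S) \<inter> S = {}" by auto
  ultimately show ?thesis
    using shuffle_sign_swap[of "{1..N} - S" S] fin by simp
qed

lemma self_dualD:
  "self_dual N u \<Longrightarrow> a \<le> N \<Longrightarrow> S \<subseteq> {1..N} \<Longrightarrow>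
     wedge_list (initial u (N - a)) (reflect N S) = wedge_list (initial u a) ({1..N} - S)"
proof -
  assume a: "self_dual N u" "a \<le> N" "S \<subseteq> {1..N}"
  then have "{1..N} - ({1..N} - S) = S" by auto
  then show ?thesis using a unfolding self_dual_def by (metis Diff_subset)
qed

text \<open>Reflecting both summation sets in the expansion of the product of U_(N-a), V_(N-b),
  W_(N-c) turns its coefficients into those of U_a, V_b, W_c, and the sum into the pairing for the
  triple of total degree 2N.\<close>

lemma triple_dual:
  assumes u: "supported (NN n) u" and v: "supported (NN n) v" and w: "supported (NN n) w"
    and du: "self_dual (NN n) u" and dv: "self_dual (NN n) v" and dw: "self_dual (NN n) w"
    and sum: "a + b + c = 2 * NN n" and le: "a \<le> NN n" "b \<le> NN n" "c \<le> NN n"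
  shows "triple n (wedge_upto n u) (wedge_upto n v) (wedge_upto n w) a b c =
    triple n (wedge_upto n u) (wedge_upto n v) (wedge_upto n w) (NN n - a) (NN n - b) (NN n - c)"
proof -
  define N where "N = NN n"
  let ?I = "{1..N}"
  have odd: "odd N" by (simp add: N_def)
  let ?x = "wedge_list (initial u (N - a))" and ?y = "wedge_list (initial v (N - b))" and ?z = "wedge_list (initial w (N - c))"
  have "(N - a) + (N - b) + (N - c) = N" using sum le by (simp add: N_def)
  then have "triple n (wedge_upto n u) (wedge_upto n v) (wedge_upto n w) (N - a) (N - b) (N - c) =
      wedge (wedge ?x ?y) ?z ?I"
    using triple_vol[OF u v w, of "N - a" "N - b" "N - c"]
      wedge_list_append[of "initial u (N - a) @ initial v (N - b)" "initial w (N - c)"]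
    by (simp add: N_def vol_def wedge_list_append)
  also have "\<dots> = (\<Sum>T\<in>Pow ?I. \<Sum>S\<in>Pow ?I. if S \<inter> T = {} then
      shuffle_sign (?I - T) T * (shuffle_sign (?I - T - S) S * ?x (?I - T - S) * ?y S) * ?z T else 0)"
    unfolding wedge_complement[OF finite_atLeastAtMost, of "wedge ?x ?y"]
  proof (rule sum.cong[OF refl])
    fix T assume "T \<in> Pow ?I"
    have "wedge ?x ?y (?I - T) = (\<Sum>S\<in>Pow ?I. if S \<inter> T = {} then
        shuffle_sign (?I - T - S) S * ?x (?I - T - S) * ?y S else 0)"
      unfolding wedge_complement[OF finite_Diff[OF finite_atLeastAtMost]]
      by (rule sum.mono_neutral_cong_left) auto
    then show "shuffle_sign (?I - T) T * wedge ?x ?y (?I - T) * ?z T =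
       (\<Sum>S\<in>Pow ?I. if S \<inter> T = {} then
          shuffle_sign (?I - T) T * (shuffle_sign (?I - T - S) S * ?x (?I - T - S) * ?y S) * ?z T else 0)"
      by (simp add: sum_distrib_left sum_distrib_right if_distrib[of "\<lambda>x. _ * x * _"] cong: if_cong)
  qed
  also have "\<dots> = (\<Sum>T\<in>Pow ?I. \<Sum>S\<in>Pow ?I. if reflect N S \<inter> reflect N T = {} then
      shuffle_sign (?I - reflect N T) (reflect N T) *
      (shuffle_sign (?I - reflect N T - reflect N S) (reflect N S) * ?x (?I - reflect N T - reflect N S) * ?y (reflect N S)) *
      ?z (reflect N T) else 0)"
    by (rule trans[OF sum_reflect], rule sum.cong[OF refl], rule sum_reflect)
  also have "\<dots> = (\<Sum>T\<in>Pow ?I. \<Sum>S\<in>Pow ?I. 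
     (if S \<inter> T = {} then shuffle_sign S T * wedge_list (initial u a) (S \<union> T) else 0) *
     (shuffle_sign (?I - S) S * wedge_list (initial v b) (?I - S)) * (shuffle_sign (?I - T) T * wedge_list (initial w c) (?I - T)))"
  proof (intro sum.cong refl)
    fix T S assume "T \<in> Pow ?I" "S \<in> Pow ?I"
    then have T: "T \<subseteq> ?I" and S: "S \<subseteq> ?I" by auto
    let ?X = "?I - (S \<union> T)"
    have ST: "S \<union> T \<subseteq> ?I" and X: "?X \<subseteq> ?I" using S T by auto
    have fin: "finite S" "finite T" "finite ?X" using S T by (blast intro: finite_subset[OF _ finite_atLeastAtMost])+
    have r: "?I - reflect N T - reflect N S = reflect N ?X" "?I - reflect N T = reflect N (?I - T)"
      unfolding reflect_Diff[OF order_refl ST] reflect_Diff[OF order_refl T] reflect_UNIV reflect_Un by blast+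
    have dual: "?x (reflect N ?X) = wedge_list (initial u a) (S \<union> T)"
      "?y (reflect N S) = wedge_list (initial v b) (?I - S)" "?z (reflect N T) = wedge_list (initial w c) (?I - T)"
      using self_dualD[OF du[folded N_def] le(1)[folded N_def] X] self_dualD[OF dv[folded N_def] le(2)[folded N_def] S]
        self_dualD[OF dw[folded N_def] le(3)[folded N_def] T] double_diff[OF ST order_refl] by simp_all
    show "(if reflect N S \<inter> reflect N T = {} then
      shuffle_sign (?I - reflect N T) (reflect N T) *
      (shuffle_sign (?I - reflect N T - reflect N S) (reflect N S) * ?x (?I - reflect N T - reflect N S) * ?y (reflect N S)) *
      ?z (reflect N T) else 0) =
      (if S \<inter> T = {} then shuffle_sign S T * wedge_list (initial u a) (S \<union> T) else 0) *
     (shuffle_sign (?I - S) S * wedge_list (initial v b) (?I - S)) * (shuffle_sign (?I - T) T * wedge_list (initial w c) (?I - T))"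
    proof (cases "S \<inter> T = {}")
      case True
      have p: "?I - S = ?X \<union> T" "?I - T = ?X \<union> S" "?X \<inter> T = {}" "?X \<inter> S = {}" "T \<inter> S = {}"
        using S T True by auto
      \<comment> \<open>All signs decompose along the partition of {1..N} into S, T and the rest;
        \<open>shuffle_sign_complement\<close> accounts for the blocks that appear in the opposite
        order.\<close>
      have "shuffle_sign T (?I - T) * shuffle_sign S ?X =
          shuffle_sign S T * shuffle_sign (?I - S) S * shuffle_sign (?I - T) T"
      proof -
        have "shuffle_sign (?I - T) T = shuffle_sign ?X T * shuffle_sign S T"
          "shuffle_sign (?I - S) S = shuffle_sign ?X S * shuffle_sign T S"
          "shuffle_sign T (?I - T) = shuffle_sign T ?X * shuffle_sign T S"
          "shuffle_sign S (?I - S) = shuffle_sign S ?X * shuffle_sign S T"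
          unfolding p(1,2) using p fin by (simp_all add: shuffle_sign_Un_left shuffle_sign_Un_right)
        moreover have "shuffle_sign T (?I - T) = shuffle_sign (?I - T) T"
          "shuffle_sign S (?I - S) = shuffle_sign (?I - S) S"
          using shuffle_sign_complement[OF odd] S T by auto
        ultimately show ?thesis
          by (metis (no_types, opaque_lifting) mult.assoc mult.commute mult.left_neutral shuffle_sign_sq)
      qed
      moreover have "reflect N S \<inter> reflect N T = {}" using True reflect_Int[OF S T] by (metis reflect_empty_iff)
      ultimately show ?thesis
        unfolding r(1) unfolding r(2) dual shuffle_sign_reflect[OF Diff_subset T] shuffle_sign_reflect[OF X S] using True
        by (simp add: mult_ac)
    next
      case False
      then have "reflect N S \<inter> reflect N T \<noteq> {}" using reflect_Int[OF S T] by (metis reflect_empty_iff)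
      then show ?thesis using False by simp
    qed
  qed
  also have "\<dots> = pairing N (wedge_list (initial v b)) (wedge_list (initial w c)) (wedge_list (initial u a))"
    unfolding pairing_def by (rule sum.swap)
  finally show ?thesis using triple_pairing[OF u v w sum le(2,3)] by (simp add: N_def)
qed

text \<open>Makes the coefficients of all four forms visible, so that self-duality can be applied to
  each of them.\<close>

lemma pairing_expand:
  "pairing N (wedge x w) y z = (\<Sum>S\<in>Pow {1..N}. \<Sum>T\<in>Pow {1..N}. \<Sum>P\<in>Pow {1..N}.
     if S \<inter> T = {} \<and> S \<inter> P = {} then
       shuffle_sign S T * shuffle_sign ({1..N} - S) S * shuffle_sign P ({1..N} - S - P) * shuffle_sign ({1..N} - T) T *
       (z (S \<union> T) * x P * w ({1..N} - S - P) * y ({1..N} - T))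
     else 0)"
  unfolding pairing_def
proof (intro sum.cong refl)
  fix S T
  let ?I = "{1..N}"
  have "wedge x w (?I - S) = (\<Sum>P\<in>Pow ?I. if S \<inter> P = {} then shuffle_sign P (?I - S - P) * x P * w (?I - S - P) else 0)"
    unfolding wedge_def by (rule sum.mono_neutral_cong_left) auto
  then show "(if S \<inter> T = {} then shuffle_sign S T * z (S \<union> T) else 0) * (shuffle_sign (?I - S) S * wedge x w (?I - S)) *
       (shuffle_sign (?I - T) T * y (?I - T)) =
     (\<Sum>P\<in>Pow ?I. if S \<inter> T = {} \<and> S \<inter> P = {} then
       shuffle_sign S T * shuffle_sign (?I - S) S * shuffle_sign P (?I - S - P) * shuffle_sign (?I - T) T *
       (z (S \<union> T) * x P * w (?I - S - P) * y (?I - T)) else 0)"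
    by (auto simp: sum_distrib_left sum_distrib_right mult_ac intro!: sum.cong)
qed

text \<open>Term by term: the three sets are reflected and T and P exchange their roles. Thereby the
  two U forms change places, and so do the V and W forms.\<close>

lemma pairing_dual:
  assumes odd: "odd N" and du: "self_dual N u" and dv: "self_dual N v" and dw: "self_dual N w"
    and le: "a \<le> N" "b \<le> N" "c \<le> N" "d \<le> N"
  shows "pairing N (wedge (wedge_list (initial u b)) (wedge_list (initial w d))) (wedge_list (initial u a)) (wedge_list (initial v c)) =
    pairing N (wedge (wedge_list (initial u (N - a))) (wedge_list (initial v (N - c))))
      (wedge_list (initial u (N - b))) (wedge_list (initial w (N - d)))"
proof -
  let ?I = "{1..N}"
  let ?x = "wedge_list (initial u b)" and ?w = "wedge_list (initial w d)"
    and ?y = "wedge_list (initial u a)" and ?z = "wedge_list (initial v c)"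
  let ?x' = "wedge_list (initial u (N - a))" and ?w' = "wedge_list (initial v (N - c))"
    and ?y' = "wedge_list (initial u (N - b))" and ?z' = "wedge_list (initial w (N - d))"
  let ?t = "\<lambda>S T P. if S \<inter> T = {} \<and> S \<inter> P = {} then
       shuffle_sign S T * shuffle_sign (?I - S) S * shuffle_sign P (?I - S - P) * shuffle_sign (?I - T) T *
       (?z (S \<union> T) * ?x P * ?w (?I - S - P) * ?y (?I - T)) else 0"
  let ?t' = "\<lambda>S T P. if S \<inter> T = {} \<and> S \<inter> P = {} then
       shuffle_sign S T * shuffle_sign (?I - S) S * shuffle_sign P (?I - S - P) * shuffle_sign (?I - T) T *
       (?z' (S \<union> T) * ?x' P * ?w' (?I - S - P) * ?y' (?I - T)) else 0"
  let ?r = "reflect N"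
  have "pairing N (wedge ?x' ?w') ?y' ?z' = (\<Sum>S\<in>Pow ?I. \<Sum>T\<in>Pow ?I. \<Sum>P\<in>Pow ?I. ?t' S T P)"
    by (rule pairing_expand)
  also have "\<dots> = (\<Sum>S\<in>Pow ?I. \<Sum>T\<in>Pow ?I. \<Sum>P\<in>Pow ?I. ?t' (?r S) (?r T) (?r P))"
    by (rule trans[OF sum_reflect], rule sum.cong[OF refl], rule trans[OF sum_reflect],
        rule sum.cong[OF refl], rule sum_reflect)
  also have "\<dots> = (\<Sum>S\<in>Pow ?I. \<Sum>P\<in>Pow ?I. \<Sum>T\<in>Pow ?I. ?t' (?r S) (?r T) (?r P))"
    by (rule sum.cong[OF refl], rule sum.swap)
  also have "\<dots> = (\<Sum>S\<in>Pow ?I. \<Sum>T\<in>Pow ?I. \<Sum>P\<in>Pow ?I. ?t S T P)"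
  proof (intro sum.cong refl)
    fix S T P assume "S \<in> Pow ?I" "T \<in> Pow ?I" "P \<in> Pow ?I"
    then have S: "S \<subseteq> ?I" and T: "T \<subseteq> ?I" and P: "P \<subseteq> ?I" by auto
    have fin: "finite S" "finite P" "finite T" using S P T by (blast intro: finite_subset[OF _ finite_atLeastAtMost])+
    have i: "?r S \<inter> ?r P = {} \<longleftrightarrow> S \<inter> P = {}" "?r S \<inter> ?r T = {} \<longleftrightarrow> S \<inter> T = {}"
      using reflect_Int[OF S T] reflect_Int[OF S P] by (metis reflect_empty_iff)+
    show "?t' (?r S) (?r P) (?r T) = ?t S T P"
    proof (cases "S \<inter> T = {} \<and> S \<inter> P = {}")
      case True
      let ?Q = "?I - (S \<union> P)" and ?Y = "?I - (S \<union> T)"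
      have SP: "S \<union> P \<subseteq> ?I" and ST: "S \<union> T \<subseteq> ?I" using S T P by auto
      have eq: "?I - S - P = ?Q" "?I - S - T = ?Y" by auto
      have r: "?I - ?r S = ?r (?I - S)" "?I - ?r P = ?r (?I - P)" "?I - ?r S - ?r T = ?r ?Y"
        unfolding reflect_Diff[OF order_refl S] reflect_Diff[OF order_refl P] reflect_Diff[OF order_refl ST]
          reflect_UNIV reflect_Un by blast+
      have dual: "?z' (?r S \<union> ?r P) = ?w ?Q" "?x' (?r T) = ?y (?I - T)" "?w' (?r ?Y) = ?z (S \<union> T)"
        "?y' (?r (?I - P)) = ?x P"
        using self_dualD[OF dw le(4) SP] self_dualD[OF du le(1) T] self_dualD[OF dv le(3), of ?Y]
          self_dualD[OF du le(2), of "?I - P"] double_diff[OF ST order_refl] double_diff[OF P order_refl]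
        by (simp_all add: reflect_Un)
      have p: "?I - P = S \<union> ?Q" "?I - T = S \<union> ?Y" "S \<inter> ?Q = {}" "S \<inter> ?Y = {}" using S T P True by auto
      have "shuffle_sign P (?I - P) = shuffle_sign P S * shuffle_sign P ?Q"
        "shuffle_sign (?I - T) T = shuffle_sign S T * shuffle_sign ?Y T"
        unfolding p(1,2) using p fin by (simp_all add: shuffle_sign_Un_left shuffle_sign_Un_right)
      then have "shuffle_sign P S * shuffle_sign S (?I - S) * shuffle_sign ?Y T * shuffle_sign P (?I - P) =
          shuffle_sign S T * shuffle_sign (?I - S) S * shuffle_sign P ?Q * shuffle_sign (?I - T) T"
      proof -
        have gen: "p * k * y * (p * q) = s * k * q * (s * y)" if "p * p = 1" "s * s = 1" for p k y q s :: complex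
        proof -
          have "p * k * y * (p * q) = (p * p) * (k * y * q)" "s * k * q * (s * y) = (s * s) * (k * y * q)"
            by (simp_all only: mult_ac)
          then show ?thesis using that by simp
        qed
        assume "shuffle_sign P (?I - P) = shuffle_sign P S * shuffle_sign P ?Q"
          "shuffle_sign (?I - T) T = shuffle_sign S T * shuffle_sign ?Y T"
        then show ?thesis by (simp only: shuffle_sign_complement[OF odd S] gen[OF shuffle_sign_sq shuffle_sign_sq])
      qed
      then show ?thesis
        unfolding r(3) unfolding r(1,2) i eq dual shuffle_sign_reflect[OF S P] shuffle_sign_reflect[OF Diff_subset S]
          shuffle_sign_reflect[OF T Diff_subset] shuffle_sign_reflect[OF Diff_subset P]
        using True by (simp add: mult_ac)
    next
      case False
      then show ?thesis unfolding i by auto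
    qed
  qed
  also have "\<dots> = pairing N (wedge ?x ?w) ?y ?z" by (rule pairing_expand[symmetric])
  finally show ?thesis ..
qed

text \<open>\<open>pairing_dual\<close> exchanges the places of V and W, and
  \<open>quad_ordered_swap\<close> exchanges them back; the rest is a parity check with N
  odd.\<close>

lemma quad_ordered_dual:
  assumes u: "supported (NN n) u" and v: "supported (NN n) v" and w: "supported (NN n) w"
    and du: "self_dual (NN n) u" and dv: "self_dual (NN n) v" and dw: "self_dual (NN n) w"
    and sum: "a + b + c + d = 2 * NN n" and a: "b \<le> a" "a \<le> NN n" and le: "c \<le> NN n" "d \<le> NN n"
    and ge: "NN n \<le> a + c" "NN n \<le> a + d"
  shows "quad_ordered n (wedge_upto n u) (wedge_upto n v) (wedge_upto n w) a b c d =
    quad_ordered n (wedge_upto n u) (wedge_upto n v) (wedge_upto n w) (NN n - b) (NN n - a) (NN n - c) (NN n - d)"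
proof -
  define N where "N = NN n"
  have odd: "odd N" by (simp add: N_def)
  note facts = sum[folded N_def] a[folded N_def] le[folded N_def] ge[folded N_def]
  obtain a' b' c' d' where N: "N = a + a'" "N = b + b'" "N = c + c'" "N = d + d'"
    by (rule that[of "N - a" "N - b" "N - c" "N - d"]) (use facts in auto)
  then have sub: "N - a = a'" "N - b = b'" "N - c = c'" "N - d = d'" by auto
  have dual: "b' + a' + c' + d' = 2 * N" "b' + a' + d' + c' = 2 * N" "a' \<le> b'" "b' \<le> N" "N \<le> b' + c'" "N \<le> b' + d'"
    using facts N by linarith+
  let ?Q = "quad_ordered n (wedge_upto n u)" and ?V = "wedge_upto n v" and ?W = "wedge_upto n w"
  have 1: "?Q ?V ?W (N - b) (N - a) (N - c) (N - d) =
      (-1) ^ ((N - b + 1) * ((N - c) + (N - d) + 1) + (N - c) * (N - d)) *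
      ?Q ?W ?V (N - b) (N - a) (N - d) (N - c)"
    unfolding sub by (rule quad_ordered_swap[OF u v w, folded N_def]) (fact dual)+
  have 2: "?Q ?W ?V (N - b) (N - a) (N - d) (N - c) = (-1) ^ ((N - b + (N - d) - N) * (N - c)) *
      pairing N (wedge_list (initial u (N - a) @ initial v (N - c))) (wedge_list (initial u (N - b))) (wedge_list (initial w (N - d)))"
    unfolding sub by (rule quad_ordered_pairing[OF u w v, folded N_def]) (fact dual)+
  have 3: "?Q ?V ?W a b c d = (-1) ^ ((a + c - N) * d) *
      pairing N (wedge_list (initial u b @ initial w d)) (wedge_list (initial u a)) (wedge_list (initial v c))"
    by (rule quad_ordered_pairing[OF u v w, folded N_def]) (fact facts)+
  have 4: "pairing N (wedge_list (initial u b @ initial w d)) (wedge_list (initial u a)) (wedge_list (initial v c)) =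
      pairing N (wedge_list (initial u (N - a) @ initial v (N - c))) (wedge_list (initial u (N - b))) (wedge_list (initial w (N - d)))"
    using pairing_dual[OF odd du[folded N_def] dv[folded N_def] dw[folded N_def], of a b c d] facts
    by (simp add: wedge_list_append)
  have "(-1 :: complex) ^ ((a + c - N) * d) =
      (-1) ^ ((N - b + 1) * ((N - c) + (N - d) + 1) + (N - c) * (N - d) + (N - b + (N - d) - N) * (N - c))"
  proof (rule minus_one_power_cong)
    have e: "even (N - b) \<longleftrightarrow> odd b" "even (N - c) \<longleftrightarrow> odd c" "even (N - d) \<longleftrightarrow> odd d" "even (a + c - N) \<longleftrightarrow> odd (a + c)"
      using odd facts by (simp_all add: even_diff_nat)
    have "N - b + (N - d) - N = a + c - N" unfolding sub using N facts(1) by linarith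
    moreover have "even (a + b + c + d)" using facts by simp
    ultimately show "even ((a + c - N) * d) \<longleftrightarrow>
        even ((N - b + 1) * ((N - c) + (N - d) + 1) + (N - c) * (N - d) + (N - b + (N - d) - N) * (N - c))"
      using e by (simp only: even_add even_mult_iff odd_one not_True_eq_False simp_thms) argo
  qed
  then show ?thesis unfolding N_def[symmetric] 1 2 3 4 by (simp only: power_add mult.assoc)
qed

section \<open>Reflections and the spin group\<close>

declare One_nat_def [simp del]

text \<open>N is kept as a separate constant, so that 2n + 1 appears only where a definition or an
  inequality calls for it.\<close>

locale quadratic_space =
  fixes n N :: nat
  assumes N_eq: "N = NN n"
begin

abbreviation "I \<equiv> {1..N}"

definition dual_vec :: "vec \<Rightarrow> vec" where
  "dual_vec v = (\<lambda>s. bform n v (unit_vec s))"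

definition supp :: "vec \<Rightarrow> bool" where
  "supp v \<longleftrightarrow> (\<forall>k. k \<notin> I \<longrightarrow> v k = 0)"

lemma odd_N: "odd N" and N_pos: "N \<ge> 1"
  by (simp_all add: N_eq)

lemma bform_eq: "bform n v w = (\<Sum>i\<in>I. (-1) ^ (i - 1) * v i * w (N + 1 - i))"
  by (simp add: bform_def N_eq)

lemma sum_flip: "(\<Sum>i\<in>I. f i) = (\<Sum>i\<in>I. f (N + 1 - i))"
  by (rule sum.reindex_bij_witness[where i="\<lambda>i. N + 1 - i" and j="\<lambda>i. N + 1 - i"]) auto

text \<open>Since N is odd, N - i and i - 1 have the same parity. This is the symmetry of the
  form.\<close>

lemma sign_flip: "i \<in> I \<Longrightarrow> (-1 :: complex) ^ (N + 1 - i - 1) = (-1) ^ (i - 1)"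
  using odd_N by (intro minus_one_power_cong) (auto simp: even_diff_nat)

lemma dual_vec_eq: "s \<in> I \<Longrightarrow> dual_vec v s = (-1) ^ (s - 1) * v (N + 1 - s)"
proof -
  assume s: "s \<in> I"
  have "dual_vec v s = (\<Sum>i\<in>I. if i = N + 1 - s then (-1) ^ (i - 1) * v i else 0)"
    unfolding dual_vec_def bform_eq by (rule sum.cong) (use s in \<open>auto simp: unit_vec_def\<close>)
  also have "\<dots> = (-1) ^ (N + 1 - s - 1) * v (N + 1 - s)"
    using s by (subst sum.delta) auto
  finally show ?thesis unfolding sign_flip[OF s] .
qed

lemma bform_dual: "bform n v w = (\<Sum>s\<in>I. dual_vec v s * w s)"
proof -
  have "bform n v w = (\<Sum>i\<in>I. (-1) ^ (N + 1 - i - 1) * v (N + 1 - i) * w (N + 1 - (N + 1 - i)))"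
    unfolding bform_eq by (rule sum_flip)
  also have "\<dots> = (\<Sum>s\<in>I. dual_vec v s * w s)"
    by (rule sum.cong[OF refl]) (use dual_vec_eq sign_flip in auto)
  finally show ?thesis .
qed

lemma bform_sym: "bform n v w = bform n w v"
  unfolding bform_dual[of v] unfolding bform_eq
  by (rule sum.cong[OF refl]) (simp add: dual_vec_eq)

lemma bform_add: "bform n (\<lambda>k. v k + w k) z = bform n v z + bform n w z"
  by (simp add: bform_eq algebra_simps sum.distrib)

lemma bform_scale: "bform n (\<lambda>k. c * v k) z = c * bform n v z"
  by (simp add: bform_eq sum_distrib_left mult_ac)

lemma bform_add2: "bform n z (\<lambda>k. v k + w k) = bform n z v + bform n z w"
  by (simp add: bform_eq algebra_simps sum.distrib)

lemma bform_scale2: "bform n z (\<lambda>k. c * v k) = c * bform n z v"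
  by (simp add: bform_eq sum_distrib_left mult_ac)

text \<open>The orthogonal reflection when <v,v> = 1. Being a rank one perturbation of the identity,
  it acts on the exterior algebra by \<open>ext_reflection\<close>.\<close>

definition hyperplane_reflection :: "vec \<Rightarrow> vec \<Rightarrow> vec" where
  "hyperplane_reflection v z = (\<lambda>k. z k + (- 2 * bform n v z) * v k)"

definition ext_reflection :: "vec \<Rightarrow> ext \<Rightarrow> ext" where
  "ext_reflection v = rank_one I (\<lambda>s. - 2 * dual_vec v s) v"

lemma hyperplane_reflection_rank_one:
  "hyperplane_reflection v = rank_one_vec I (\<lambda>s. - 2 * dual_vec v s) v"
  by (simp add: hyperplane_reflection_def rank_one_vec_def bform_dual fun_eq_iff sum_distrib_left
      sum_distrib_right mult_ac)

lemma wedge_list_reflections: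
  "wedge_list (map (foldr hyperplane_reflection vs) xs) = foldr ext_reflection vs (wedge_list xs)"
proof (induction vs)
  case (Cons v vs)
  have "wedge_list (map (foldr hyperplane_reflection (v # vs)) xs) =
      wedge_list (map (hyperplane_reflection v) (map (foldr hyperplane_reflection vs) xs))"
    by (simp add: comp_def)
  then show ?case
    unfolding hyperplane_reflection_rank_one rank_one_wedge_list[OF finite_atLeastAtMost, symmetric]
    unfolding hyperplane_reflection_rank_one[symmetric] Cons by (simp only: ext_reflection_def[of v] foldr.simps o_def)
qed simp

lemma ext_reflection_top: "bform n v v = 1 \<Longrightarrow> ext_reflection v x I = - x I"
  unfolding ext_reflection_def rank_one_top[OF finite_atLeastAtMost]
  by (simp add: bform_dual sum_distrib_left[symmetric] mult.assoc sum_negf)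

text \<open>The Hodge star; in this basis it has no signs.\<close>

definition star :: "ext \<Rightarrow> ext" where
  "star x = (\<lambda>S. x (reflect N (I - S)))"

lemma star_star: "S \<subseteq> I \<Longrightarrow> star (star x) S = x S"
proof -
  assume S: "S \<subseteq> I"
  have "reflect N (I - reflect N (I - S)) = reflect N (reflect N (I - (I - S)))"
    unfolding reflect_Diff[OF order_refl Diff_subset] reflect_UNIV ..
  also have "\<dots> = S" using S by (simp add: double_diff reflect_reflect)
  finally show ?thesis by (simp add: star_def)
qed

text \<open>The sign (-1)^(k-1) of the form counts the indices below k. Split between S and its
  complement, these combine with the sign of the reflected product to that of the contraction and a
  factor depending on |S| only.\<close>

lemma star_wedge_right:
  assumes S: "S \<subseteq> I"
  shows "star (wedge_right v x) S = (-1) ^ card S * contract I (dual_vec v) (star x) S"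
proof -
  have fin: "finite S" using S finite_subset by blast
  have "star (wedge_right v x) S = (\<Sum>k\<in>I - S. above_sign (reflect N (I - S)) (N + 1 - k) * v (N + 1 - k) *
      x (reflect N (I - S) - {N + 1 - k}))"
    unfolding star_def wedge_right_def reflect_def[of N "I - S"]
    by (subst sum.reindex) (auto intro: inj_on_subset[OF reflect_inj])
  also have "\<dots> = (\<Sum>k\<in>I - S. (-1) ^ card S * (above_sign S k * dual_vec v k * star x (insert k S)))"
  proof (rule sum.cong[OF refl])
    fix k assume k: "k \<in> I - S"
    have kI: "{k} \<subseteq> I" "k \<in> I" using k by auto
    have set: "reflect N (I - S) - {N + 1 - k} = reflect N (I - insert k S)"
    proof -
      have "reflect N ((I - S) - {k}) = reflect N (I - S) - reflect N {k}"
        by (rule reflect_Diff) (use k in auto)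
      moreover have "(I - S) - {k} = I - insert k S" by auto
      ultimately show ?thesis by (simp add: reflect_def)
    qed
    have "{t \<in> reflect N (I - S). N + 1 - k < t} = (\<lambda>t. N + 1 - t) ` {t \<in> I - S. t < k}"
      using k by (auto simp: reflect_def)
    then have "card {t \<in> reflect N (I - S). N + 1 - k < t} = card {t \<in> I - S. t < k}"
      by (simp only:) (rule card_image[OF inj_on_subset[OF reflect_inj]], auto)
    moreover have "{1..<k} = {t \<in> I - S. t < k} \<union> {t \<in> S. t < k}" using k S by auto
    then have "card {1..<k} = card ({t \<in> I - S. t < k} \<union> {t \<in> S. t < k})" by (rule arg_cong)
    then have "k - 1 = card {t \<in> I - S. t < k} + card {t \<in> S. t < k}"
      using fin by (subst (asm) card_Un_disjoint) auto
    moreover have "S = {t \<in> S. t < k} \<union> {t \<in> S. k < t}" using k by (auto simp: not_less_iff_gr_or_eq)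
    then have "card S = card ({t \<in> S. t < k} \<union> {t \<in> S. k < t})" by (rule arg_cong)
    then have "card S = card {t \<in> S. t < k} + card {t \<in> S. k < t}"
      using fin by (subst (asm) card_Un_disjoint) auto
    ultimately have "above_sign (reflect N (I - S)) (N + 1 - k) * (-1) ^ (k - 1) = (-1) ^ card S * above_sign S k"
      unfolding above_sign_def by (simp add: power_add[symmetric]) (rule minus_one_power_cong, auto)
    then show "above_sign (reflect N (I - S)) (N + 1 - k) * v (N + 1 - k) * x (reflect N (I - S) - {N + 1 - k}) =
        (-1) ^ card S * (above_sign S k * dual_vec v k * star x (insert k S))"
    proof -
      assume e: "above_sign (reflect N (I - S)) (N + 1 - k) * (-1) ^ (k - 1) = (-1) ^ card S * above_sign S k"
      have "v (N + 1 - k) = (-1) ^ (k - 1) * dual_vec v k"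
        unfolding dual_vec_eq[OF kI(2)] by (simp flip: mult.assoc power_mult_distrib)
      then have "above_sign (reflect N (I - S)) (N + 1 - k) * v (N + 1 - k) =
          (above_sign (reflect N (I - S)) (N + 1 - k) * (-1) ^ (k - 1)) * dual_vec v k" by (simp only: mult.assoc)
      then show ?thesis unfolding set e by (simp add: star_def mult_ac)
    qed
  qed
  finally show ?thesis unfolding contract_def by (simp add: sum_distrib_left)
qed

lemma card_reflect_complement: "S \<subseteq> I \<Longrightarrow> card (reflect N (I - S)) = N - card S"
  unfolding reflect_def
  by (subst card_image[OF inj_on_subset[OF reflect_inj Diff_subset]]) (simp add: card_Diff_subset finite_subset)

text \<open>The star is an involution on the subsets of {1..N}, so this is
  \<open>star_wedge_right\<close> for the star of x, read at the dual set.\<close>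

lemma star_contract:
  assumes S: "S \<subseteq> I"
  shows "star (contract I (dual_vec v) x) S = (-1) ^ (N - card S) * wedge_right v (star x) S"
proof -
  let ?S = "reflect N (I - S)"
  have S': "?S \<subseteq> I" by (rule reflect_subset) auto
  have "star (wedge_right v (star x)) ?S = (-1) ^ card ?S * contract I (dual_vec v) (star (star x)) ?S"
    by (rule star_wedge_right[OF S'])
  also have "contract I (dual_vec v) (star (star x)) ?S = contract I (dual_vec v) x ?S"
    unfolding contract_def by (intro sum.cong refl) (use S' in \<open>simp add: star_star\<close>)
  also have "star (wedge_right v (star x)) ?S = star (star (wedge_right v (star x))) S" by (simp add: star_def)
  finally have "wedge_right v (star x) S = (-1) ^ (N - card S) * star (contract I (dual_vec v) x) S"
    unfolding star_star[OF S] card_reflect_complement[OF S] by (simp add: star_def)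
  then show ?thesis by (simp flip: mult.assoc power_mult_distrib)
qed

text \<open>Write R = 1 - 2 e c with e the multiplication by v and c the contraction. The star
  carries e c to c e, which is 1 - e c for a unit vector, and hence R to -R.\<close>

lemma star_ext_reflection:
  assumes v: "bform n v v = 1" and S: "S \<subseteq> I"
  shows "star (ext_reflection v x) S = - ext_reflection v (star x) S"
proof -
  let ?k = "contract I (dual_vec v)"
  have fin: "finite S" using S finite_subset by blast
  have scale: "contract I (\<lambda>s. - 2 * dual_vec v s) y = (\<lambda>S. - 2 * ?k y S)" for y
    by (simp add: contract_def fun_eq_iff sum_distrib_left mult_ac)
  have R: "ext_reflection v y S = y S - 2 * wedge_right v (?k y) S" for y S
    unfolding ext_reflection_def rank_one_def scale wedge_right_scale by simp
  have "star (wedge_right v (?k x)) S = (-1) ^ card S * ?k (star (?k x)) S"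
    by (rule star_wedge_right[OF S])
  also have "?k (star (?k x)) S = (-1) ^ card S * ?k (wedge_right v (star x)) S"
    unfolding contract_def[of I "dual_vec v" "star _"] contract_def[of I "dual_vec v" "wedge_right v (star x)"] sum_distrib_left
  proof (rule sum.cong[OF refl])
    fix s assume s: "s \<in> I - S"
    then have sS: "insert s S \<subseteq> I" using S by auto
    have "card (insert s S) \<le> N" using card_mono[OF _ sS] by simp
    then have "(-1 :: complex) ^ (N - card (insert s S)) = (-1) ^ card S"
      using odd_N s fin by (intro minus_one_power_cong) (auto simp: even_diff_nat)
    then show "above_sign S s * dual_vec v s * star (contract I (dual_vec v) x) (insert s S) =
        (-1) ^ card S * (above_sign S s * dual_vec v s * wedge_right v (star x) (insert s S))"
      unfolding star_contract[OF sS] by simp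
  qed
  finally have "star (wedge_right v (?k x)) S = ?k (wedge_right v (star x)) S"
    by (simp flip: mult.assoc power_mult_distrib)
  also have "\<dots> = star x S - wedge_right v (?k (star x)) S"
    using contract_wedge_right[OF finite_atLeastAtMost fin] v by (simp add: bform_dual)
  finally have "star (wedge_right v (?k x)) S = star x S - wedge_right v (?k (star x)) S" .
  then show ?thesis unfolding R by (simp add: star_def R)
qed

text \<open>The star identities hold on subsets of {1..N} only; this allows their use underneath a
  reflection.\<close>

lemma ext_reflection_cong:
  assumes "\<And>T. T \<subseteq> I \<Longrightarrow> x T = y T" "S \<subseteq> I"
  shows "ext_reflection v x S = ext_reflection v y S"
proof -
  have "wedge_right v (contract I \<xi> x) S = wedge_right v (contract I \<xi> y) S" for \<xi>
  proof (rule wedge_right_cong)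
    fix T assume "T \<subseteq> S"
    then have "T \<subseteq> I" using assms(2) by auto
    then show "contract I \<xi> x T = contract I \<xi> y T"
      unfolding contract_def by (intro sum.cong refl) (use assms(1) in auto)
  qed
  then show ?thesis using assms by (simp add: ext_reflection_def rank_one_def)
qed

lemma ext_reflection_uminus: "ext_reflection v (\<lambda>S. c * x S) = (\<lambda>S. c * ext_reflection v x S)"
  by (simp add: ext_reflection_def rank_one_def contract_scale wedge_right_scale distrib_left)

lemma star_ext_reflections:
  assumes "\<And>v. v \<in> set vs \<Longrightarrow> bform n v v = 1" "S \<subseteq> I"
  shows "star (foldr ext_reflection vs x) S = (-1) ^ length vs * foldr ext_reflection vs (star x) S"
  using assms
proof (induction vs arbitrary: S)
  case (Cons v vs)
  have "star (foldr ext_reflection (v # vs) x) S = - ext_reflection v (star (foldr ext_reflection vs x)) S"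
    using star_ext_reflection[of v S] Cons.prems by simp
  also have "ext_reflection v (star (foldr ext_reflection vs x)) S =
      ext_reflection v (\<lambda>S. (-1) ^ length vs * foldr ext_reflection vs (star x) S) S"
    by (rule ext_reflection_cong) (use Cons in auto)
  finally show ?case unfolding ext_reflection_uminus by simp
qed simp

lemma ext_reflections_top:
  "(\<And>v. v \<in> set vs \<Longrightarrow> bform n v v = 1) \<Longrightarrow> foldr ext_reflection vs x I = (-1) ^ length vs * x I"
  by (induction vs) (simp_all add: ext_reflection_top)

lemma initial_unit_vec: "wedge_list (initial unit_vec a) = basis_ext {1..a}"
proof -
  have "set [1..<Suc a] = {1..a}" by auto
  then show ?thesis unfolding initial_def using wedge_list_unit_vec[of "[1..<Suc a]"] by (simp del: upt_Suc)
qed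

text \<open>The standard flag is fixed by the star, and the star commutes with an even number of
  reflections.\<close>

lemma reflections_self_dual:
  assumes unit: "\<And>v. v \<in> set vs \<Longrightarrow> bform n v v = 1" and even: "even (length vs)"
    and u: "\<And>i. i \<in> I \<Longrightarrow> u i = foldr hyperplane_reflection vs (unit_vec i)"
  shows "self_dual N u" "wedge_list (initial u N) I = 1"
proof -
  have W: "wedge_list (initial u a) = foldr ext_reflection vs (basis_ext {1..a})" if "a \<le> N" for a
  proof -
    have "initial u a = map (foldr hyperplane_reflection vs) (initial unit_vec a)"
      unfolding initial_def map_map by (rule map_cong) (use that u in auto)
    then show ?thesis by (simp only: wedge_list_reflections initial_unit_vec)
  qed
  show "wedge_list (initial u N) I = 1"
    unfolding W[OF order_refl] using ext_reflections_top[OF unit] even by (simp add: basis_ext_def)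
  show "self_dual N u"
    unfolding self_dual_def
  proof (intro allI impI)
    fix a S assume a: "a \<le> N" and S: "S \<subseteq> I"
    have star: "star (basis_ext {1..N - a}) S = basis_ext {1..a} S" if S: "S \<subseteq> I" for S
    proof -
      have "reflect N (I - {1..a}) = {1..N - a}"
      proof -
        have "k \<in> (\<lambda>k. N + 1 - k) ` {a + 1..N}" if "k \<in> {1..N - a}" for k
          using that a by (intro image_eqI[of _ _ "N + 1 - k"]) auto
        moreover have "I - {1..a} = {a + 1..N}" using a by auto
        ultimately show ?thesis unfolding reflect_def using a by auto
      qed
      moreover have "{1..a} \<subseteq> I" using a by auto
      ultimately have "reflect N (I - S) = {1..N - a} \<longleftrightarrow> S = {1..a}"
        using S by (metis reflect_reflect Diff_subset double_diff order_refl)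
      then show ?thesis by (simp add: star_def basis_ext_def)
    qed
    have "foldr ext_reflection vs (star (basis_ext {1..N - a})) S = foldr ext_reflection vs (basis_ext {1..a}) S"
      using S
    proof (induction vs arbitrary: S)
      case Nil
      then show ?case using star by simp
    next
      case (Cons v vs)
      then show ?case by simp (rule ext_reflection_cong, auto)
    qed
    then show "wedge_list (initial u a) S = wedge_list (initial u (N - a)) (reflect N (I - S))"
      using star_ext_reflections[OF unit S, where x="basis_ext {1..N - a}"] even
      unfolding W[OF a] W[OF diff_le_self] by (simp add: star_def)
  qed
qed


section \<open>The Clifford algebra\<close>

definition act :: "emat \<Rightarrow> ext \<Rightarrow> ext" where
  "act g x = (\<lambda>S. \<Sum>T\<in>Pow I. g S T * x T)"

definition confined :: "emat \<Rightarrow> bool" where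
  "confined g \<longleftrightarrow> (\<forall>S T. \<not> (S \<subseteq> I \<and> T \<subseteq> I) \<longrightarrow> g S T = 0)"

lemma emul_eq: "emul n g h = (\<lambda>S T. \<Sum>R\<in>Pow I. g S R * h R T)"
  by (simp add: emul_def N_eq)

lemma eone_eq: "eone n = (\<lambda>S T. if S = T \<and> S \<subseteq> I then 1 else 0)"
  by (simp add: eone_def N_eq)

lemma emul_assoc: "emul n (emul n g h) k = emul n g (emul n h k)"
  unfolding emul_eq fun_eq_iff
  by (subst sum_distrib_left, subst sum_distrib_right, subst sum.swap) (simp add: mult.assoc)

lemma confined_eone: "confined (eone n)"
  by (simp add: confined_def eone_eq)

lemma confined_emul: "confined g \<Longrightarrow> confined h \<Longrightarrow> confined (emul n g h)"
  unfolding confined_def emul_eq by (intro allI impI sum.neutral ballI) (metis mult_eq_0_iff)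

lemma emul_eone_left: "confined g \<Longrightarrow> emul n (eone n) g = g"
proof (intro ext)
  fix S T assume g: "confined g"
  have "emul n (eone n) g S T = (\<Sum>R\<in>Pow I. if R = S then g R T else 0)"
    unfolding emul_eq by (rule sum.cong) (auto simp: eone_eq)
  also have "\<dots> = g S T" using g by (simp add: confined_def)
  finally show "emul n (eone n) g S T = g S T" .
qed

lemma emul_eone_right: "confined g \<Longrightarrow> emul n g (eone n) = g"
proof (intro ext)
  fix S T assume g: "confined g"
  have "emul n g (eone n) S T = (\<Sum>R\<in>Pow I. if R = T then g S R else 0)"
    unfolding emul_eq by (rule sum.cong) (auto simp: eone_eq)
  also have "\<dots> = g S T" using g by (simp add: confined_def)
  finally show "emul n g (eone n) S T = g S T" .
qed

text \<open>A matrix that vanishes outside the index range is determined by its action, so matrix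
  identities can be checked on forms.\<close>

lemma emat_eqI:
  assumes "confined g" "confined h" "\<And>S x. S \<subseteq> I \<Longrightarrow> act g x S = act h x S"
  shows "g = h"
proof (intro ext)
  fix S T
  show "g S T = h S T"
  proof (cases "S \<subseteq> I \<and> T \<subseteq> I")
    case True
    have "act k (basis_ext T) S = k S T" for k
    proof -
      have "act k (basis_ext T) S = (\<Sum>R\<in>Pow I. if R = T then k S R else 0)"
        unfolding act_def by (rule sum.cong) (auto simp: basis_ext_def)
      then show ?thesis using True by simp
    qed
    then show ?thesis using assms(3)[of S "basis_ext T"] True by simp
  qed (use assms in \<open>auto simp: confined_def\<close>)
qed

lemma act_emul: "act (emul n g h) x S = act g (act h x) S"
  unfolding act_def emul_eq
  by (simp add: sum_distrib_left sum_distrib_right mult.assoc) (rule sum.swap)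

lemma act_eone: "S \<subseteq> I \<Longrightarrow> act (eone n) x S = x S"
proof -
  assume S: "S \<subseteq> I"
  have "act (eone n) x S = (\<Sum>T\<in>Pow I. if T = S then x T else 0)"
    unfolding act_def by (rule sum.cong) (auto simp: eone_eq)
  then show ?thesis using S by simp
qed

lemma cliff_eq: "cliff n v = (\<lambda>S T. if S \<subseteq> I \<and> T \<subseteq> I then
      (\<Sum>i\<in>I. (if i \<notin> T \<and> S = insert i T then shuffle_sign {i} T * v i else 0)
                   + (if i \<notin> S \<and> T = insert i S then shuffle_sign {i} S * dual_vec v i else 0)) else 0)"
  unfolding cliff_def N_eq dual_vec_def ..

lemma confined_cliff: "confined (cliff n v)"
  by (auto simp: confined_def cliff_eq)

lemma shuffle_sign_singleton:
  assumes "finite T" "i \<notin> T"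
  shows "shuffle_sign {i} T = (-1) ^ card T * above_sign T i"
proof -
  have "{(s, t). s \<in> {i} \<and> t \<in> T \<and> t < s} = Pair i ` {t \<in> T. t < i}" by auto
  then have "shuffle_sign {i} T = (-1) ^ card {t \<in> T. t < i}"
    by (simp only: shuffle_sign_def) (simp add: card_image inj_on_def)
  moreover have "T = {t \<in> T. t < i} \<union> {t \<in> T. i < t}" using assms by (auto simp: not_less_iff_gr_or_eq)
  then have "card T = card ({t \<in> T. t < i} \<union> {t \<in> T. i < t})" by (rule arg_cong)
  then have "card T = card {t \<in> T. t < i} + card {t \<in> T. i < t}"
    using assms by (subst (asm) card_Un_disjoint) auto
  ultimately show ?thesis by (simp add: above_sign_def power_add)
qed

text \<open>\<open>cliff\<close> multiplies and contracts from the left. Passing to the right costs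
  a degree sign, opposite for the two parts because they reach degree |S| from the degrees |S| - 1
  and |S| + 1.\<close>

lemma act_cliff:
  assumes S: "S \<subseteq> I"
  shows "act (cliff n v) x S = (-1) ^ card S * (contract I (dual_vec v) x S - wedge_right v x S)"
proof -
  have fin: "finite S" using S finite_subset by blast
  let ?f = "\<lambda>i T. (if i \<notin> T \<and> S = insert i T then shuffle_sign {i} T * v i else 0) * x T"
  let ?g = "\<lambda>i T. (if i \<notin> S \<and> T = insert i S then shuffle_sign {i} S * dual_vec v i else 0) * x T"
  have "act (cliff n v) x S = (\<Sum>T\<in>Pow I. \<Sum>i\<in>I. ?f i T + ?g i T)"
    unfolding act_def by (rule sum.cong[OF refl]) (use S in \<open>auto simp: cliff_eq sum_distrib_right distrib_right\<close>)
  also have "\<dots> = (\<Sum>i\<in>I. \<Sum>T\<in>Pow I. ?f i T) + (\<Sum>i\<in>I. \<Sum>T\<in>Pow I. ?g i T)"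
    by (subst sum.swap) (simp add: sum.distrib)
  also have "(\<Sum>i\<in>I. \<Sum>T\<in>Pow I. ?f i T) = (\<Sum>i\<in>I. if i \<in> S then - ((-1) ^ card S * (above_sign S i * v i * x (S - {i}))) else 0)"
  proof (rule sum.cong[OF refl])
    fix i assume i: "i \<in> I"
    show "(\<Sum>T\<in>Pow I. ?f i T) = (if i \<in> S then - ((-1) ^ card S * (above_sign S i * v i * x (S - {i}))) else 0)"
    proof (cases "i \<in> S")
      case True
      have "(\<Sum>T\<in>Pow I. ?f i T) = (\<Sum>T\<in>{S - {i}}. ?f i T)"
        by (rule sum.mono_neutral_right) (use S in auto)
      also have "\<dots> = shuffle_sign {i} (S - {i}) * v i * x (S - {i})" using True by (simp add: insert_absorb)
      also have "shuffle_sign {i} (S - {i}) = - ((-1) ^ card S * above_sign S i)"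
      proof -
        have "card S = Suc (card (S - {i}))" using card_Suc_Diff1[OF fin True] by simp
        then show ?thesis
          using shuffle_sign_singleton[of "S - {i}" i] fin True
          by (simp add: above_sign_remove del: card_Diff_singleton card_Diff_insert)
      qed
      finally show ?thesis using True by (simp add: mult_ac)
    next
      case False
      then show ?thesis by (subst sum.neutral) auto
    qed
  qed
  also have "\<dots> = - ((-1) ^ card S * wedge_right v x S)"
  proof -
    have "(\<Sum>i\<in>I. if i \<in> S then - ((-1) ^ card S * (above_sign S i * v i * x (S - {i}))) else 0) =
        (\<Sum>i\<in>S. - ((-1) ^ card S * (above_sign S i * v i * x (S - {i}))))"
      by (rule sum.mono_neutral_cong_right) (use S in auto)
    then show ?thesis by (simp add: wedge_right_def sum_negf sum_distrib_left)
  qed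
  also have "(\<Sum>i\<in>I. \<Sum>T\<in>Pow I. ?g i T) = (\<Sum>i\<in>I - S. (-1) ^ card S * (above_sign S i * dual_vec v i * x (insert i S)))"
  proof (rule sum.mono_neutral_cong_right)
    fix i assume i: "i \<in> I - S"
    have "(\<Sum>T\<in>Pow I. ?g i T) = (\<Sum>T\<in>{insert i S}. ?g i T)"
      by (rule sum.mono_neutral_right) (use S i in auto)
    then show "(\<Sum>T\<in>Pow I. ?g i T) = (-1) ^ card S * (above_sign S i * dual_vec v i * x (insert i S))"
      using i fin by (simp add: shuffle_sign_singleton mult_ac)
  qed auto
  finally show ?thesis
    by (simp add: contract_def sum_distrib_left right_diff_distrib)
qed

text \<open>The sign (-1)^|S| anticommutes with multiplication and contraction, so the square is
  minus the square of their difference. The pure squares vanish and the mixed terms add up to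
  <v,v>.\<close>

lemma cliff_square: "emul n (cliff n v) (cliff n v) = (\<lambda>S T. bform n v v * eone n S T)"
proof (rule emat_eqI)
  show "confined (\<lambda>S T. bform n v v * eone n S T)" using confined_eone by (simp add: confined_def)
  show "confined (emul n (cliff n v) (cliff n v))" by (simp add: confined_emul confined_cliff)
  fix S x assume S: "S \<subseteq> I"
  have fin: "finite S" using S finite_subset by blast
  let ?y = "\<lambda>R. contract I (dual_vec v) x R + (-1) * wedge_right v x R"
  have k: "contract I (dual_vec v) (act (cliff n v) x) S = - ((-1) ^ card S * contract I (dual_vec v) ?y S)"
    unfolding contract_def[of I "dual_vec v" "act _ _"] contract_def[of I "dual_vec v" ?y]
      sum_distrib_left sum_negf[symmetric]
  proof (rule sum.cong[OF refl])
    fix s assume s: "s \<in> I - S"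
    then have sS: "insert s S \<subseteq> I" using S by auto
    show "above_sign S s * dual_vec v s * act (cliff n v) x (insert s S) =
        - ((-1) ^ card S * (above_sign S s * dual_vec v s * ?y (insert s S)))"
      unfolding act_cliff[OF sS] using s fin by simp
  qed
  have w: "wedge_right v (act (cliff n v) x) S = - ((-1) ^ card S * wedge_right v ?y S)"
    unfolding wedge_right_def[of v "act _ _"] wedge_right_def[of v ?y]
      sum_distrib_left sum_negf[symmetric]
  proof (rule sum.cong[OF refl])
    fix s assume s: "s \<in> S"
    then have sS: "S - {s} \<subseteq> I" using S by auto
    have "card S = Suc (card (S - {s}))" using card_Suc_Diff1[OF fin s] by simp
    then show "above_sign S s * v s * act (cliff n v) x (S - {s}) =
        - ((-1) ^ card S * (above_sign S s * v s * ?y (S - {s})))"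
      unfolding act_cliff[OF sS] by (simp del: card_Diff_singleton card_Diff_insert)
  qed
  have "act (emul n (cliff n v) (cliff n v)) x S = - (contract I (dual_vec v) ?y S - wedge_right v ?y S)"
    unfolding act_emul act_cliff[OF S] k w by (simp add: algebra_simps flip: power_mult_distrib)
  also have "contract I (dual_vec v) ?y S = - contract I (dual_vec v) (wedge_right v x) S"
    unfolding contract_add contract_scale using contract_anticommute[OF _ fin, of I "dual_vec v" "dual_vec v" x] by simp
  also have "wedge_right v ?y S = wedge_right v (contract I (dual_vec v) x) S"
    unfolding wedge_right_add wedge_right_scale wedge_right_twice by simp
  also have "- (- contract I (dual_vec v) (wedge_right v x) S - wedge_right v (contract I (dual_vec v) x) S) = bform n v v * x S"
    using contract_wedge_right[OF _ fin, of I "dual_vec v" v x] by (simp add: bform_dual)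
  also have "\<dots> = bform n v v * act (eone n) x S" by (simp add: act_eone S)
  also have "\<dots> = act (\<lambda>S T. bform n v v * eone n S T) x S"
    by (simp add: act_def sum_distrib_left mult.assoc)
  finally show "act (emul n (cliff n v) (cliff n v)) x S = act (\<lambda>S T. bform n v v * eone n S T) x S" .
qed

lemma dual_vec_add: "dual_vec (\<lambda>k. v k + w k) = (\<lambda>s. dual_vec v s + dual_vec w s)"
  by (simp add: dual_vec_def bform_add)

lemma dual_vec_scale: "dual_vec (\<lambda>k. c * v k) = (\<lambda>s. c * dual_vec v s)"
  by (simp add: dual_vec_def bform_scale)

lemma cliff_add: "cliff n (\<lambda>k. v k + w k) S T = cliff n v S T + cliff n w S T"
proof (cases "S \<subseteq> I \<and> T \<subseteq> I")
  case True
  show ?thesis unfolding cliff_eq dual_vec_add if_P[OF True] sum.distrib[symmetric]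
    by (rule sum.cong) (auto simp: algebra_simps)
next
  case False
  show ?thesis unfolding cliff_eq if_not_P[OF False] by simp
qed

lemma cliff_scale: "cliff n (\<lambda>k. c * v k) S T = c * cliff n v S T"
proof (cases "S \<subseteq> I \<and> T \<subseteq> I")
  case True
  show ?thesis unfolding cliff_eq dual_vec_scale if_P[OF True] sum_distrib_left
    by (rule sum.cong) (auto simp: algebra_simps)
next
  case False
  show ?thesis unfolding cliff_eq if_not_P[OF False] by simp
qed

lemma emul_add_left: "emul n (\<lambda>S T. g S T + h S T) k = (\<lambda>S T. emul n g k S T + emul n h k S T)"
  by (simp add: emul_eq distrib_right sum.distrib)

lemma emul_add_right: "emul n k (\<lambda>S T. g S T + h S T) = (\<lambda>S T. emul n k g S T + emul n k h S T)"
  by (simp add: emul_eq distrib_left sum.distrib)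

lemma emul_scale_left: "emul n (\<lambda>S T. c * g S T) k = (\<lambda>S T. c * emul n g k S T)"
  by (simp add: emul_eq sum_distrib_left mult_ac)

text \<open>Polarization of \<open>cliff_square\<close>.\<close>

lemma cliff_anticommutator:
  "emul n (cliff n v) (cliff n w) S T + emul n (cliff n w) (cliff n v) S T = 2 * bform n v w * eone n S T"
proof -
  let ?s = "\<lambda>k. v k + w k"
  have c: "cliff n ?s = (\<lambda>S T. cliff n v S T + cliff n w S T)" by (intro ext) (rule cliff_add)
  have "emul n (cliff n ?s) (cliff n ?s) S T = bform n ?s ?s * eone n S T" by (simp add: cliff_square)
  moreover have "bform n ?s ?s = bform n v v + bform n w w + 2 * bform n v w"
    by (simp add: bform_add bform_add2 bform_sym[of w v])
  ultimately show ?thesis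
    unfolding c emul_add_left emul_add_right using cliff_square[of v] cliff_square[of w]
    by (simp add: algebra_simps)
qed

lemma cliff_conjugate:
  assumes "bform n v v = 1"
  shows "emul n (cliff n v) (cliff n z) = emul n (cliff n (\<lambda>k. - hyperplane_reflection v z k)) (cliff n v)"
proof -
  have "(\<lambda>k. - hyperplane_reflection v z k) = (\<lambda>k. (2 * bform n v z) * v k + (-1) * z k)"
    by (simp add: hyperplane_reflection_def fun_eq_iff)
  then have c: "cliff n (\<lambda>k. - hyperplane_reflection v z k) =
      (\<lambda>S T. (2 * bform n v z) * cliff n v S T + (-1) * cliff n z S T)"
    by (simp only:) (intro ext, simp only: cliff_add cliff_scale)
  show ?thesis
  proof (intro ext)
    fix S T
    show "emul n (cliff n v) (cliff n z) S T = emul n (cliff n (\<lambda>k. - hyperplane_reflection v z k)) (cliff n v) S T"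
      unfolding c emul_add_left emul_scale_left cliff_square assms
      using cliff_anticommutator[of v z S T] by (simp add: algebra_simps)
  qed
qed

text \<open>The column of {} recovers the vector, which makes \<open>cliff\<close> injective on
  vectors supported in {1..N}.\<close>

lemma cliff_entry: "k \<in> I \<Longrightarrow> cliff n v {k} {} = v k"
proof -
  assume k: "k \<in> I"
  have "cliff n v {k} {} = (\<Sum>i\<in>I. if i = k then v i else 0)"
    unfolding cliff_eq using k by simp
  then show ?thesis using k by simp
qed

lemma cliff_cong: "(\<And>k. k \<in> I \<Longrightarrow> v k = w k) \<Longrightarrow> cliff n v = cliff n w"
proof -
  assume vw: "\<And>k. k \<in> I \<Longrightarrow> v k = w k"
  have d: "dual_vec v s = dual_vec w s" if "s \<in> I" for s
  proof -
    have "N + 1 - s \<in> I" using that by auto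
    then show ?thesis unfolding dual_vec_eq[OF that] using vw by simp
  qed
  show ?thesis unfolding cliff_eq by (intro ext if_cong refl sum.cong arg_cong2[where f="(+)"]) (use vw d in auto)
qed

section \<open>Products of unit vectors and the columns of elements of the spin group\<close>

definition clifford_product :: "vec list \<Rightarrow> emat" where
  "clifford_product vs = foldr (\<lambda>v. emul n (cliff n v)) vs (eone n)"

lemma clifford_product_Cons [simp]: "clifford_product (v # vs) = emul n (cliff n v) (clifford_product vs)"
  by (simp add: clifford_product_def)

lemma clifford_product_Nil [simp]: "clifford_product [] = eone n"
  by (simp add: clifford_product_def)

lemma confined_clifford_product: "confined (clifford_product vs)"
  by (induction vs) (simp_all add: confined_eone confined_emul confined_cliff)

lemma clifford_product_append:
  "clifford_product (vs @ ws) = emul n (clifford_product vs) (clifford_product ws)"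
  by (induction vs) (simp_all add: emul_eone_left confined_clifford_product emul_assoc)

definition unit_list :: "vec list \<Rightarrow> bool" where
  "unit_list vs \<longleftrightarrow> (\<forall>v\<in>set vs. supp v \<and> bform n v v = 1)"

lemma clifford_product_inverse:
  "unit_list vs \<Longrightarrow> emul n (clifford_product vs) (clifford_product (rev vs)) = eone n"
proof (induction vs)
  case (Cons v vs)
  then have "emul n (clifford_product vs) (clifford_product (rev vs)) = eone n" by (simp add: unit_list_def)
  then have "emul n (clifford_product vs) (emul n (clifford_product (rev vs)) x) = emul n (eone n) x" for x
    by (simp flip: emul_assoc)
  then have "emul n (clifford_product (v # vs)) (clifford_product (rev (v # vs))) = emul n (cliff n v) (cliff n v)"
    by (simp add: clifford_product_append emul_assoc confined_cliff emul_eone_right emul_eone_left)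
  then show ?case using Cons.prems by (simp add: cliff_square unit_list_def)
qed (simp add: emul_eone_left confined_eone)

text \<open>The vectors in the definition of \<open>spin\<close> may have any values outside {1..N};
  neither \<open>cliff\<close> nor the form sees them.\<close>

lemma restrict_vec:
  obtains v' where "supp v'" "cliff n v = cliff n v'" "bform n v v = bform n v' v'"
proof
  let ?v = "\<lambda>k. if k \<in> I then v k else 0"
  show "supp ?v" by (simp add: supp_def)
  show "cliff n v = cliff n ?v" by (rule cliff_cong) simp
  show "bform n v v = bform n ?v ?v"
    unfolding bform_eq by (rule sum.cong) auto
qed

lemma spin_clifford_product:
  "g \<in> spin n \<longleftrightarrow> (\<exists>vs. unit_list vs \<and> even (length vs) \<and> g = clifford_product vs)"
proof
  assume "g \<in> spin n"
  then show "\<exists>vs. unit_list vs \<and> even (length vs) \<and> g = clifford_product vs"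
  proof induction
    case one
    show ?case by (rule exI[of _ "[]"]) (simp add: unit_list_def)
  next
    case (mult g v w)
    then obtain vs where vs: "unit_list vs" "even (length vs)" "g = clifford_product vs" by blast
    obtain v' where v': "supp v'" "cliff n v = cliff n v'" "bform n v v = bform n v' v'" by (rule restrict_vec)
    obtain w' where w': "supp w'" "cliff n w = cliff n w'" "bform n w w = bform n w' w'" by (rule restrict_vec)
    have "emul n (emul n g (cliff n v)) (cliff n w) = clifford_product (vs @ [v', w'])"
      by (simp add: clifford_product_append emul_assoc vs v' w' emul_eone_right confined_cliff)
    then show ?case using mult vs v' w' by (intro exI[of _ "vs @ [v', w']"]) (auto simp: unit_list_def)
  qed
next
  assume "\<exists>vs. unit_list vs \<and> even (length vs) \<and> g = clifford_product vs"
  then obtain vs where vs: "unit_list vs" "even (length vs)" and g: "g = clifford_product vs" by blast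
  have "clifford_product vs \<in> spin n" if "unit_list vs" "even (length vs)" for vs
    using that
  proof (induction "length vs" arbitrary: vs rule: less_induct)
    case less
    show ?case
    proof (cases vs rule: rev_cases)
      case Nil
      then show ?thesis by (simp add: spin.one)
    next
      case (snoc us w)
      then obtain us' v where us: "us = us' @ [v]" using less.prems by (cases us rule: rev_cases) auto
      have "clifford_product us' \<in> spin n" using less snoc us by (auto simp: unit_list_def)
      then have "emul n (emul n (clifford_product us') (cliff n v)) (cliff n w) \<in> spin n"
        using less.prems snoc us by (intro spin.mult) (auto simp: unit_list_def)
      then show ?thesis
        by (simp add: snoc us clifford_product_append emul_assoc emul_eone_right confined_cliff)
    qed
  qed
  then show "g \<in> spin n" using vs by (simp add: g)
qed

lemma hyperplane_reflection_scale:
  "hyperplane_reflection v (\<lambda>k. c * z k) = (\<lambda>k. c * hyperplane_reflection v z k)"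
  by (simp add: hyperplane_reflection_def bform_scale2 fun_eq_iff algebra_simps)

lemma clifford_product_conjugate:
  assumes "unit_list vs"
  shows "emul n (clifford_product vs) (cliff n z) =
    emul n (cliff n (\<lambda>k. (-1) ^ length vs * foldr hyperplane_reflection vs z k)) (clifford_product vs)"
  using assms
proof (induction vs)
  case Nil
  then show ?case by (simp add: emul_eone_left emul_eone_right confined_cliff)
next
  case (Cons v vs)
  let ?z = "\<lambda>k. (-1) ^ length vs * foldr hyperplane_reflection vs z k"
  have "(\<lambda>k. - hyperplane_reflection v ?z k) = (\<lambda>k. (-1) ^ length (v # vs) * foldr hyperplane_reflection (v # vs) z k)"
    by (simp add: hyperplane_reflection_scale)
  moreover have "emul n (clifford_product (v # vs)) (cliff n z) = emul n (emul n (cliff n v) (cliff n ?z)) (clifford_product vs)"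
    using Cons by (simp add: emul_assoc unit_list_def)
  moreover have "bform n v v = 1" using Cons.prems by (simp add: unit_list_def)
  ultimately show ?case by (simp only: cliff_conjugate emul_assoc clifford_product_Cons)
qed

lemma supp_reflections: "supp z \<Longrightarrow> unit_list vs \<Longrightarrow> supp (foldr hyperplane_reflection vs z)"
  by (induction vs) (auto simp: supp_def unit_list_def hyperplane_reflection_def)

lemma supp_unit_vec: "i \<in> I \<Longrightarrow> supp (unit_vec i)"
  by (auto simp: supp_def unit_vec_def)

text \<open>For uniqueness in the definite description: the product of unit vectors is invertible,
  so two candidates give the same Clifford element, and \<open>cliff_entry\<close> reads off their
  coordinates.\<close>

lemma so_column_clifford:
  assumes vs: "unit_list vs" "even (length vs)"
    and u: "supp u" "\<And>k. k \<in> I \<Longrightarrow> u k = foldr hyperplane_reflection vs (unit_vec i) k"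
  shows "so_column n (clifford_product vs) i = u"
  unfolding so_column_def
proof (rule the_equality)
  let ?g = "clifford_product vs"
  have "cliff n u = cliff n (foldr hyperplane_reflection vs (unit_vec i))" by (rule cliff_cong) (rule u)
  then have "emul n ?g (cliff n (unit_vec i)) = emul n (cliff n u) ?g"
    using clifford_product_conjugate[OF vs(1), of "unit_vec i"] vs(2) by simp
  then show "(\<forall>k. k \<notin> {1..NN n} \<longrightarrow> u k = 0) \<and> emul n ?g (cliff n (unit_vec i)) = emul n (cliff n u) ?g"
    using u(1) unfolding supp_def by (simp only: N_eq simp_thms)
  fix w assume w: "(\<forall>k. k \<notin> {1..NN n} \<longrightarrow> w k = 0) \<and> emul n ?g (cliff n (unit_vec i)) = emul n (cliff n w) ?g"
  have "emul n (cliff n w) ?g = emul n (cliff n u) ?g"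
    using w clifford_product_conjugate[OF vs(1), of "unit_vec i"] vs(2)
      \<open>cliff n u = cliff n (foldr hyperplane_reflection vs (unit_vec i))\<close> by simp
  then have "emul n (emul n (cliff n w) ?g) (clifford_product (rev vs)) = emul n (emul n (cliff n u) ?g) (clifford_product (rev vs))"
    by simp
  then have "cliff n w = cliff n u"
    by (simp only: emul_assoc clifford_product_inverse[OF vs(1)] emul_eone_right confined_cliff)
  then have "w k = u k" if "k \<in> I" for k using cliff_entry[OF that] by metis
  moreover have "w k = u k" if "k \<notin> I" for k
    using w u(1) that unfolding supp_def by (simp only: N_eq simp_thms)
  ultimately show "w = u" by (intro ext) blast
qed

lemma so_column_exists:
  assumes "g \<in> spin n"
  obtains vs where "unit_list vs" "even (length vs)" "g = clifford_product vs"
    "\<And>i. supp (so_column n g i)"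
    "\<And>i. i \<in> I \<Longrightarrow> so_column n g i = foldr hyperplane_reflection vs (unit_vec i)"
proof -
  obtain vs where vs: "unit_list vs" "even (length vs)" "g = clifford_product vs"
    using assms spin_clifford_product by blast
  have eq: "so_column n g i = (\<lambda>k. if k \<in> I then foldr hyperplane_reflection vs (unit_vec i) k else 0)" for i
    unfolding vs(3) by (rule so_column_clifford[OF vs(1,2)]) (auto simp: supp_def)
  show thesis
  proof (rule that[OF vs])
    show "so_column n g i = foldr hyperplane_reflection vs (unit_vec i)" if "i \<in> I" for i
      unfolding vs(3) by (rule so_column_clifford[OF vs(1,2)]) (use supp_reflections supp_unit_vec vs that in auto)
  qed (auto simp: eq supp_def)
qed

lemma spin_flag:
  assumes "g \<in> spin n"
  shows "supported N (so_column n g)" "self_dual N (so_column n g)" "wedge_list (initial (so_column n g) N) I = 1"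
proof -
  obtain vs where vs: "unit_list vs" "even (length vs)" "g = clifford_product vs"
    "\<And>i. supp (so_column n g i)"
    "\<And>i. i \<in> I \<Longrightarrow> so_column n g i = foldr hyperplane_reflection vs (unit_vec i)"
    by (rule so_column_exists[OF assms]) (rule that; assumption)
  show "supported N (so_column n g)" using vs(4) by (auto simp: supported_def supp_def)
  show "self_dual N (so_column n g)" "wedge_list (initial (so_column n g) N) I = 1"
    by (rule reflections_self_dual[of vs]; use vs in \<open>auto simp: unit_list_def\<close>)+
qed

end

section \<open>Regularity of the three-flag functions\<close>

context quadratic_space
begin

text \<open>The value of the form induced on the exterior algebra at e_S and the reflected basis
  element: the sum comes from the signs (-1)^(s-1), the binomial coefficient from the reversal of
  the order.\<close>

definition adjoint_sign :: "nat set \<Rightarrow> complex" where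
  "adjoint_sign S = (-1) ^ ((\<Sum>s\<in>S. s - 1) + (card S choose 2))"

lemma adjoint_sign_insert:
  assumes "finite S" "j \<notin> S"
  shows "adjoint_sign (insert j S) = (-1) ^ (j - 1) * (-1) ^ card S * adjoint_sign S"
proof -
  have "Suc (card S) choose 2 = card S + (card S choose 2)" by (simp add: numeral_2_eq_2)
  then show ?thesis using assms by (simp add: adjoint_sign_def power_add)
qed

lemma adjoint_sign_sq [simp]: "adjoint_sign S * adjoint_sign S = 1"
  by (simp add: adjoint_sign_def flip: power_add)

text \<open>The transposition of the Clifford algebra; it inverts the elements of the spin group, so that the entries of
  \<open>\<pi>(g)\<close> are polynomials in the entries of \<open>g\<close>.\<close>

definition adjoint :: "emat \<Rightarrow> emat" where
  "adjoint g = (\<lambda>S T. adjoint_sign S * adjoint_sign T * g (reflect N T) (reflect N S))"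

lemma adjoint_emul: "adjoint (emul n g h) S T = emul n (adjoint h) (adjoint g) S T"
proof -
  have "adjoint (emul n g h) S T = (\<Sum>R\<in>Pow I. adjoint_sign S * adjoint_sign T * (g (reflect N T) R * h R (reflect N S)))"
    by (simp add: adjoint_def emul_eq sum_distrib_left)
  also have "\<dots> = (\<Sum>R\<in>Pow I. adjoint_sign S * adjoint_sign T * (g (reflect N T) (reflect N R) * h (reflect N R) (reflect N S)))"
    by (rule sum_reflect)
  also have "\<dots> = emul n (adjoint h) (adjoint g) S T"
    unfolding emul_eq adjoint_def
  proof (rule sum.cong[OF refl])
    fix R
    have "adjoint_sign S * adjoint_sign R * h (reflect N R) (reflect N S) *
        (adjoint_sign R * adjoint_sign T * g (reflect N T) (reflect N R)) =
        (adjoint_sign R * adjoint_sign R) * (adjoint_sign S * adjoint_sign T * (g (reflect N T) (reflect N R) * h (reflect N R) (reflect N S)))"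
      by (simp only: mult_ac)
    then show "adjoint_sign S * adjoint_sign T * (g (reflect N T) (reflect N R) * h (reflect N R) (reflect N S)) =
      adjoint_sign S * adjoint_sign R * h (reflect N R) (reflect N S) *
        (adjoint_sign R * adjoint_sign T * g (reflect N T) (reflect N R))" by simp
  qed
  finally show ?thesis .
qed

lemma reflect_eq_iff: "S \<subseteq> I \<Longrightarrow> T \<subseteq> I \<Longrightarrow> reflect N S = reflect N T \<longleftrightarrow> S = T"
  by (metis reflect_reflect)

lemma reflect_insert: "reflect N (insert j S) = insert (N + 1 - j) (reflect N S)"
  by (simp add: reflect_def)

text \<open>Vectors are self-adjoint because transposition and reflection exchange the exterior part
  of the matrix with its contraction part.\<close>

lemma adjoint_cliff:
  assumes S: "S \<subseteq> I" and T: "T \<subseteq> I"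
  shows "adjoint (cliff n v) S T = cliff n v S T"
proof -
  have fin: "finite S" "finite T" using S T by (blast intro: finite_subset[OF _ finite_atLeastAtMost])+
  have r: "reflect N S \<subseteq> I" "reflect N T \<subseteq> I" using S T by (auto intro!: reflect_subset)
  have c: "N + 1 - j \<notin> reflect N X \<and> reflect N Y = insert (N + 1 - j) (reflect N X) \<longleftrightarrow> j \<notin> X \<and> Y = insert j X"
    if "j \<in> I" "X \<subseteq> I" "Y \<subseteq> I" for j X Y
  proof -
    have "insert j X \<subseteq> I" using that by auto
    moreover have "N + 1 - j \<in> reflect N X \<longleftrightarrow> j \<in> X"
      using reflect_Int[of "{j}" N X] that by (auto simp: reflect_def)
    ultimately show ?thesis using reflect_eq_iff[OF that(3)] by (simp add: reflect_insert[symmetric])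
  qed
  have sgn: "shuffle_sign {N + 1 - j} (reflect N X) = above_sign X j" if "j \<in> I" "X \<subseteq> I" for j X
  proof -
    have "shuffle_sign (reflect N {j}) (reflect N X) = shuffle_sign X {j}"
      by (rule shuffle_sign_reflect) (use that in auto)
    moreover have "{(u, v). u \<in> X \<and> v \<in> {j} \<and> v < u} = (\<lambda>s. (s, j)) ` {s \<in> X. j < s}" by auto
    then have "shuffle_sign X {j} = above_sign X j"
      by (simp only: shuffle_sign_def above_sign_def) (simp add: card_image inj_on_def)
    ultimately show ?thesis by (simp add: reflect_def)
  qed
  have d: "dual_vec v (N + 1 - j) = (-1) ^ (j - 1) * v j" "v (N + 1 - j) = (-1) ^ (j - 1) * dual_vec v j"
    if "j \<in> I" for j
  proof -
    have "N + 1 - j \<in> I" "N + 1 - (N + 1 - j) = j" using that by auto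
    then show "dual_vec v (N + 1 - j) = (-1) ^ (j - 1) * v j"
      using dual_vec_eq[of "N + 1 - j" v] sign_flip[OF that] by simp
    show "v (N + 1 - j) = (-1) ^ (j - 1) * dual_vec v j"
      unfolding dual_vec_eq[OF that] by (simp flip: mult.assoc power_mult_distrib)
  qed
  have "adjoint (cliff n v) S T = (\<Sum>i\<in>I. adjoint_sign S * adjoint_sign T *
      ((if i \<notin> reflect N S \<and> reflect N T = insert i (reflect N S) then shuffle_sign {i} (reflect N S) * v i else 0) +
       (if i \<notin> reflect N T \<and> reflect N S = insert i (reflect N T) then shuffle_sign {i} (reflect N T) * dual_vec v i else 0)))"
    using r by (simp add: adjoint_def cliff_eq sum_distrib_left)
  also have "\<dots> = (\<Sum>j\<in>I. adjoint_sign S * adjoint_sign T *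
      ((if N + 1 - j \<notin> reflect N S \<and> reflect N T = insert (N + 1 - j) (reflect N S) then shuffle_sign {N + 1 - j} (reflect N S) * v (N + 1 - j) else 0) +
       (if N + 1 - j \<notin> reflect N T \<and> reflect N S = insert (N + 1 - j) (reflect N T) then shuffle_sign {N + 1 - j} (reflect N T) * dual_vec v (N + 1 - j) else 0)))"
    by (rule sum_flip)
  also have "\<dots> = (\<Sum>i\<in>I. (if i \<notin> T \<and> S = insert i T then shuffle_sign {i} T * v i else 0)
                   + (if i \<notin> S \<and> T = insert i S then shuffle_sign {i} S * dual_vec v i else 0))"
  proof (rule sum.cong[OF refl])
    fix j assume j: "j \<in> I"
    have e: "adjoint_sign X * adjoint_sign (insert j X) * (above_sign X j * ((-1) ^ (j - 1) * a)) = shuffle_sign {j} X * a"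
      if "finite X" "j \<notin> X" for X and a :: complex
    proof -
      have "adjoint_sign X * adjoint_sign (insert j X) * (above_sign X j * ((-1) ^ (j - 1) * a)) =
          (adjoint_sign X * adjoint_sign X) * ((-1) ^ (j - 1) * (-1) ^ (j - 1)) * ((-1) ^ card X * above_sign X j * a)"
        unfolding adjoint_sign_insert[OF that] by (simp only: mult_ac)
      then show ?thesis using that by (simp add: shuffle_sign_singleton flip: power_mult_distrib)
    qed
    show "adjoint_sign S * adjoint_sign T *
      ((if N + 1 - j \<notin> reflect N S \<and> reflect N T = insert (N + 1 - j) (reflect N S) then shuffle_sign {N + 1 - j} (reflect N S) * v (N + 1 - j) else 0) +
       (if N + 1 - j \<notin> reflect N T \<and> reflect N S = insert (N + 1 - j) (reflect N T) then shuffle_sign {N + 1 - j} (reflect N T) * dual_vec v (N + 1 - j) else 0)) =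
       (if j \<notin> T \<and> S = insert j T then shuffle_sign {j} T * v j else 0)
                   + (if j \<notin> S \<and> T = insert j S then shuffle_sign {j} S * dual_vec v j else 0)"
      unfolding c[OF j S T] c[OF j T S] sgn[OF j S] sgn[OF j T] d[OF j]
      using e[OF fin(1)] e[OF fin(2)] by (auto simp: distrib_left mult.commute[of "adjoint_sign (insert j _)"])
  qed
  also have "\<dots> = cliff n v S T" using S T by (simp add: cliff_eq)
  finally show ?thesis .
qed

lemma emul_cong:
  assumes "\<And>R. R \<subseteq> I \<Longrightarrow> g S R = g' S R" "\<And>R. R \<subseteq> I \<Longrightarrow> h R T = h' R T"
  shows "emul n g h S T = emul n g' h' S T"
  unfolding emul_eq by (rule sum.cong) (use assms in auto)

lemma adjoint_clifford_product:
  "S \<subseteq> I \<Longrightarrow> T \<subseteq> I \<Longrightarrow> adjoint (clifford_product vs) S T = clifford_product (rev vs) S T"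
proof (induction vs arbitrary: S T)
  case Nil
  have "reflect N S \<subseteq> I" "reflect N T \<subseteq> I" using Nil by (auto intro!: reflect_subset)
  then show ?case using Nil by (auto simp: adjoint_def eone_eq reflect_eq_iff)
next
  case (Cons v vs)
  have "adjoint (clifford_product (v # vs)) S T = emul n (adjoint (clifford_product vs)) (adjoint (cliff n v)) S T"
    by (simp add: adjoint_emul)
  also have "\<dots> = emul n (clifford_product (rev vs)) (cliff n v) S T"
    by (rule emul_cong) (use Cons adjoint_cliff in auto)
  finally show ?case by (simp add: clifford_product_append emul_eone_right confined_cliff)
qed

text \<open>The column u satisfies g e_i = u g in the Clifford algebra, and \<open>adjoint g\<close>
  is the inverse of g, so u = g e_i \<open>adjoint g\<close>. The entry at \<open>{k}\<close> and
  \<open>{}\<close> is the k-th coordinate of u.\<close>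

lemma so_column_formula:
  assumes g: "g \<in> spin n" and i: "i \<in> I" and k: "k \<in> I"
  shows "so_column n g i k = (\<Sum>R\<in>Pow I. \<Sum>Q\<in>Pow I.
    g {k} R * cliff n (unit_vec i) R Q * (adjoint_sign Q * adjoint_sign {} * g {} (reflect N Q)))"
proof -
  obtain vs where vs: "unit_list vs" "even (length vs)" "g = clifford_product vs"
    "\<And>i. supp (so_column n g i)"
    "\<And>i. i \<in> I \<Longrightarrow> so_column n g i = foldr hyperplane_reflection vs (unit_vec i)"
    by (rule so_column_exists[OF g]) (rule that; assumption)
  let ?u = "so_column n g i" and ?h = "clifford_product (rev vs)"
  have "emul n g (cliff n (unit_vec i)) = emul n (cliff n ?u) g"
    using clifford_product_conjugate[OF vs(1), of "unit_vec i"] vs(2,3) vs(5)[OF i] by simp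
  then have "emul n (emul n g (cliff n (unit_vec i))) ?h = cliff n ?u"
    by (simp add: emul_assoc vs(3) clifford_product_inverse[OF vs(1)] emul_eone_right confined_cliff)
  then have "?u k = emul n (emul n g (cliff n (unit_vec i))) ?h {k} {}"
    using cliff_entry[OF k, of ?u] by simp
  also have "\<dots> = emul n (emul n g (cliff n (unit_vec i))) (adjoint g) {k} {}"
    by (rule emul_cong) (simp_all add: vs(3) adjoint_clifford_product)
  also have "\<dots> = (\<Sum>Q\<in>Pow I. \<Sum>R\<in>Pow I.
    g {k} R * cliff n (unit_vec i) R Q * (adjoint_sign Q * adjoint_sign {} * g {} (reflect N Q)))"
    unfolding emul_eq adjoint_def by (simp add: sum_distrib_right reflect_def)
  also have "\<dots> = (\<Sum>R\<in>Pow I. \<Sum>Q\<in>Pow I.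
    g {k} R * cliff n (unit_vec i) R Q * (adjoint_sign Q * adjoint_sign {} * g {} (reflect N Q)))"
    by (rule sum.swap)
  finally show ?thesis .
qed

end

section \<open>Closure properties of regular functions, and the regularity of flags and three-flag
  functions\<close>

lemma regular_const: "regular_fun n (\<lambda>p. c)"
  unfolding regular_fun_def using poly_fun.const by blast

lemma regular_add: "regular_fun n f \<Longrightarrow> regular_fun n g \<Longrightarrow> regular_fun n (\<lambda>p. f p + g p)"
proof -
  assume "regular_fun n f" "regular_fun n g"
  then obtain P Q where "poly_fun P" "\<forall>p\<in>spin3 n. f p = P p" "poly_fun Q" "\<forall>p\<in>spin3 n. g p = Q p"
    unfolding regular_fun_def by blast
  then show ?thesis unfolding regular_fun_def by (intro exI[of _ "\<lambda>p. P p + Q p"]) (auto intro: poly_fun.add)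
qed

lemma regular_mult: "regular_fun n f \<Longrightarrow> regular_fun n g \<Longrightarrow> regular_fun n (\<lambda>p. f p * g p)"
proof -
  assume "regular_fun n f" "regular_fun n g"
  then obtain P Q where "poly_fun P" "\<forall>p\<in>spin3 n. f p = P p" "poly_fun Q" "\<forall>p\<in>spin3 n. g p = Q p"
    unfolding regular_fun_def by blast
  then show ?thesis unfolding regular_fun_def by (intro exI[of _ "\<lambda>p. P p * Q p"]) (auto intro: poly_fun.mult)
qed

lemma regular_cong: "(\<And>p. p \<in> spin3 n \<Longrightarrow> f p = g p) \<Longrightarrow> regular_fun n g \<Longrightarrow> regular_fun n f"
  unfolding regular_fun_def by auto

lemma regular_sum: "(\<And>a. a \<in> A \<Longrightarrow> regular_fun n (f a)) \<Longrightarrow> regular_fun n (\<lambda>p. \<Sum>a\<in>A. f a p)"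
  by (induction A rule: infinite_finite_induct) (simp_all add: regular_const regular_add)

lemma regular_prod: "(\<And>a. a \<in> A \<Longrightarrow> regular_fun n (f a)) \<Longrightarrow> regular_fun n (\<lambda>p. \<Prod>a\<in>A. f a p)"
  by (induction A rule: infinite_finite_induct) (simp_all add: regular_const regular_mult)

text \<open>A numbered projection, so that one lemma covers all three flags; every m from 2 on gives
  the third.\<close>

definition component :: "nat \<Rightarrow> point \<Rightarrow> emat" where
  "component m p = (if m = 0 then fst p else if m = 1 then fst (snd p) else snd (snd p))"

lemma component_spin: "p \<in> spin3 n \<Longrightarrow> component m p \<in> spin n"
  by (auto simp: spin3_def component_def)

lemma regular_component: "regular_fun n (\<lambda>p. component m p S T)"
proof -
  have "poly_fun (\<lambda>p. component m p S T)"
    using poly_fun.coord1[of S T] poly_fun.coord2[of S T] poly_fun.coord3[of S T]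
    by (cases "m = 0"; cases "m = 1"; simp add: component_def case_prod_unfold)
  then show ?thesis unfolding regular_fun_def by blast
qed

lemma regular_so_column:
  assumes "i \<in> {1..NN n}"
  shows "regular_fun n (\<lambda>p. so_column n (component m p) i k)"
proof -
  interpret quadratic_space n "NN n" by unfold_locales simp
  show ?thesis
  proof (cases "k \<in> {1..NN n}")
    case True
    show ?thesis
    proof (rule regular_cong)
      fix p assume "p \<in> spin3 n"
      then show "so_column n (component m p) i k = (\<Sum>R\<in>Pow {1..NN n}. \<Sum>Q\<in>Pow {1..NN n}.
        component m p {k} R * cliff n (unit_vec i) R Q *
        (adjoint_sign Q * adjoint_sign {} * component m p {} (reflect (NN n) Q)))"
        by (rule so_column_formula[OF component_spin assms True])
    qed (intro regular_sum regular_mult regular_const regular_component)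
  next
    case False
    have "so_column n (component m p) i k = 0" if "p \<in> spin3 n" for p
      using spin_flag(1)[OF component_spin[OF that]] False by (auto simp: supported_def)
    then show ?thesis by (rule regular_cong[OF _ regular_const])
  qed
qed

lemma regular_wedge:
  assumes "\<And>S. regular_fun n (\<lambda>p. x p S)" "\<And>S. regular_fun n (\<lambda>p. y p S)"
  shows "regular_fun n (\<lambda>p. wedge (x p) (y p) S)"
  unfolding wedge_def by (intro regular_sum regular_mult regular_const assms)

lemma regular_flag: "a \<le> NN n \<Longrightarrow> regular_fun n (\<lambda>p. flag_form n (component m p) a S)"
proof (induction a arbitrary: S)
  case 0
  show ?case by (simp add: flag_form_def regular_const)
next
  case (Suc a)
  show ?case unfolding flag_form_def wedge_upto.simps
  proof (rule regular_wedge)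
    show "regular_fun n (\<lambda>p. wedge_upto n (so_column n (component m p)) a S)" for S
      using Suc by (simp add: flag_form_def)
    show "regular_fun n (\<lambda>p. ext_of_vec n (so_column n (component m p) (Suc a)) S)" for S
      unfolding ext_of_vec_def using Suc.prems
      by (intro regular_sum regular_mult regular_const regular_so_column) auto
  qed
qed

lemma regular_quad_ordered:
  assumes "a \<le> NN n" "b \<le> NN n" "c \<le> NN n" "d \<le> NN n"
  shows "regular_fun n (\<lambda>p. quad_ordered n (flag_form n (component 0 p)) (flag_form n (component 1 p))
    (flag_form n (component 2 p)) a b c d)"
proof -
  have if_regular: "regular_fun n (\<lambda>p. if Q then f p else 0)" if "regular_fun n f" for Q f
    using that by (cases Q) (simp_all add: regular_const)
  show ?thesis unfolding quad_ordered_def tensor_apply_def vol_def comult_def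
    by (intro regular_sum regular_mult regular_wedge regular_const if_regular regular_flag assms)
qed

section \<open>Orthogonal maps are products of reflections\<close>

context quadratic_space
begin

text \<open>Linearity is not mentioned: a map preserving the form is determined by the images of an
  orthonormal basis, and in this way it enters the base case of
  \<open>orthogonal_map_reflections\<close>.\<close>

definition orthogonal_map :: "(vec \<Rightarrow> vec) \<Rightarrow> bool" where
  "orthogonal_map L \<longleftrightarrow> (\<forall>x. supp x \<longrightarrow> supp (L x)) \<and>
     (\<forall>x y. supp x \<longrightarrow> supp y \<longrightarrow> bform n (L x) (L y) = bform n x y)"

lemma bform_unit_vec: "i \<in> I \<Longrightarrow> bform n v (unit_vec i) = (-1) ^ (i - 1) * v (N + 1 - i)"
  using dual_vec_eq[of i v] by (simp add: dual_vec_def)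

text \<open>For i \<le> n the plane of e_i and e_(N+1-i) is hyperbolic with <e_i, e_(N+1-i)> =
  (-1)^(i-1). The coefficients give two orthonormal vectors in it, one numbered i and the other N +
  1 - i. The middle basis vector has square (-1)^n and is multiplied by \<open>\<i>\<close> if n is
  odd.\<close>

definition orthonormal_coeff :: "nat \<Rightarrow> complex \<times> complex" where
  "orthonormal_coeff i =
    (if i \<le> n then (1, (-1) ^ (i - 1) / 2)
     else if i = n + 1 then (if even n then 1 else \<i>, 0)
     else (- \<i> * (-1) ^ (i - 1) / 2, \<i>))"

definition orthonormal :: "nat \<Rightarrow> vec" where
  "orthonormal i = (\<lambda>k. fst (orthonormal_coeff i) * unit_vec i k + snd (orthonormal_coeff i) * unit_vec (N + 1 - i) k)"

lemma supp_orthonormal: "i \<in> I \<Longrightarrow> supp (orthonormal i)"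
  by (auto simp: supp_def orthonormal_def unit_vec_def)

lemma bform_orthonormal:
  assumes i: "i \<in> I" and j: "j \<in> I"
  shows "bform n (orthonormal i) (orthonormal j) = (if i = j then 1 else 0)"
proof -
  have u: "bform n (unit_vec i) (unit_vec j) = (if i + j = N + 1 then (-1) ^ (j - 1) else 0)"
    if "i \<in> I" "j \<in> I" for i j
    unfolding bform_unit_vec[OF that(2)] using that by (auto simp: unit_vec_def)
  have r: "N + 1 - i \<in> I" "N + 1 - j \<in> I" using i j by auto
  have e: "i + (N + 1 - j) = N + 1 \<longleftrightarrow> i = j" "N + 1 - i + j = N + 1 \<longleftrightarrow> i = j"
    "N + 1 - i + (N + 1 - j) = N + 1 \<longleftrightarrow> i + j = N + 1" using i j by auto
  obtain a b where ab: "orthonormal_coeff i = (a, b)" by fastforce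
  obtain c d where cd: "orthonormal_coeff j = (c, d)" by fastforce
  have "bform n (orthonormal i) (orthonormal j) =
      (-1) ^ (j - 1) * ((if i + j = N + 1 then a * c + b * d else 0) + (if i = j then a * d + b * c else 0))"
    unfolding orthonormal_def ab cd fst_conv snd_conv bform_add bform_add2 bform_scale bform_scale2
      u[OF i j] u[OF i r(2)] u[OF r(1) j] u[OF r] e sign_flip[OF j]
    by (simp add: algebra_simps)
  also have "\<dots> = (if i = j then 1 else 0)"
  proof -
    have sq: "(-1 :: complex) ^ (j - 1) * ((-1) ^ (j - 1) * z) = z" for z
      by (simp flip: mult.assoc power_mult_distrib)
    consider "i = j" "i = n + 1" | "i = j" "i \<noteq> n + 1" | "i \<noteq> j" "i + j = N + 1" | "i \<noteq> j" "i + j \<noteq> N + 1"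
      by blast
    then show ?thesis
    proof cases
      case 1
      then show ?thesis using ab cd
        by (cases "even n") (auto simp: orthonormal_coeff_def N_eq minus_one_power_iff)
    next
      case 2
      then have "i + j \<noteq> N + 1" unfolding N_eq by arith
      have abcd: "a = fst (orthonormal_coeff j)" "b = snd (orthonormal_coeff j)"
        "c = fst (orthonormal_coeff j)" "d = snd (orthonormal_coeff j)" using 2 ab cd by simp_all
      show ?thesis unfolding abcd using 2 \<open>i + j \<noteq> N + 1\<close>
        by (cases "(-1 :: complex) ^ (j - 1) = 1"; cases "j \<le> n")
          (simp_all add: orthonormal_coeff_def minus_one_power_iff split: if_splits)
    next
      case 3
      then have "(-1 :: complex) ^ (i - 1) = (-1) ^ (j - 1)" using sign_flip[OF j] by (metis add_diff_cancel_right')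
      moreover have "i \<le> n \<and> j > n + 1 \<or> j \<le> n \<and> i > n + 1" using 3 unfolding N_eq by arith
      ultimately show ?thesis using 3 ab cd by (auto simp: orthonormal_coeff_def)
    next
      case 4
      then show ?thesis by simp
    qed
  qed
  finally show ?thesis .
qed

lemma bform_orthonormal_right:
  "bform n z (orthonormal i) = fst (orthonormal_coeff i) * bform n z (unit_vec i) +
     snd (orthonormal_coeff i) * bform n z (unit_vec (N + 1 - i))"
  by (simp only: orthonormal_def bform_add2 bform_scale2)

text \<open>In each hyperbolic plane the sum and the difference of the two equations return the
  pairings with the original basis vectors, which are the coordinates up to sign.\<close>

lemma supp_eqI:
  assumes "supp v" "supp w" "\<And>j. j \<in> I \<Longrightarrow> bform n v (orthonormal j) = bform n w (orthonormal j)"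
  shows "v = w"
proof
  fix k
  define z where "z = (\<lambda>k. v k + (-1) * w k)"
  have z: "bform n z (orthonormal j) = 0" if "j \<in> I" for j
    using assms(3)[OF that] by (simp only: z_def bform_add bform_scale) simp
  have "bform n z (unit_vec j) = 0" if "j \<le> n" "j \<in> I" for j
  proof -
    have j': "N + 1 - j \<in> I" "\<not> N + 1 - j \<le> n" "N + 1 - j \<noteq> n + 1" "N + 1 - (N + 1 - j) = j"
      using that unfolding N_eq by auto
    have 1: "bform n z (unit_vec j) + ((-1) ^ (j - 1) / 2) * bform n z (unit_vec (N + 1 - j)) = 0"
      using z[OF that(2)] that(1) by (simp add: bform_orthonormal_right orthonormal_coeff_def)
    have "- \<i> * (-1) ^ (j - 1) / 2 * bform n z (unit_vec (N + 1 - j)) + \<i> * bform n z (unit_vec j) = 0"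
      using z[OF j'(1)] j'(2-) sign_flip[OF that(2)]
      by (simp only: bform_orthonormal_right orthonormal_coeff_def if_False fst_conv snd_conv)
    then have "\<i> * (bform n z (unit_vec j) - ((-1) ^ (j - 1) / 2) * bform n z (unit_vec (N + 1 - j))) = 0"
      by (simp add: algebra_simps)
    then have 2: "bform n z (unit_vec j) - ((-1) ^ (j - 1) / 2) * bform n z (unit_vec (N + 1 - j)) = 0" by simp
    have "x + y = 0 \<Longrightarrow> x - y = 0 \<Longrightarrow> x = 0" for x y :: complex by simp
    then show ?thesis using 1 2 .
  qed note small = this
  have "bform n z (unit_vec j) = 0" if j: "j \<in> I" for j
  proof -
    consider "j \<le> n" | "j = n + 1" | "N + 1 - j \<le> n" "N + 1 - j \<in> I" "N + 1 - (N + 1 - j) = j" "j > n + 1"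
      using j unfolding N_eq by fastforce
    then show ?thesis
    proof cases
      case 1 then show ?thesis using small j by simp
    next
      case 2
      then show ?thesis using z[OF j]
        by (cases "even n") (simp_all add: bform_orthonormal_right orthonormal_coeff_def)
    next
      case 3
      have "bform n z (unit_vec (N + 1 - j)) + ((-1) ^ (N + 1 - j - 1) / 2) * bform n z (unit_vec j) = 0"
        using z[OF 3(2)] 3(1,3) by (simp add: bform_orthonormal_right orthonormal_coeff_def)
      then show ?thesis using small[OF 3(1,2)] by simp
    qed
  qed note all = this
  show "v k = w k"
  proof (cases "k \<in> I")
    case True
    then have "N + 1 - k \<in> I" "N + 1 - (N + 1 - k) = k" by auto
    then have "z k = 0" using all[of "N + 1 - k"] bform_unit_vec[of "N + 1 - k" z] by simp
    then show ?thesis by (simp add: z_def)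
  qed (use assms in \<open>auto simp: supp_def\<close>)
qed

lemma reflection_involutive:
  "bform n u u = 1 \<Longrightarrow> hyperplane_reflection u (hyperplane_reflection u z) = z"
  by (simp only: hyperplane_reflection_def bform_add2 bform_scale2) (simp add: fun_eq_iff algebra_simps)

lemma orthogonal_reflection: "supp u \<Longrightarrow> bform n u u = 1 \<Longrightarrow> orthogonal_map (hyperplane_reflection u)"
proof -
  assume u: "supp u" "bform n u u = 1"
  have "bform n (hyperplane_reflection u x) (hyperplane_reflection u y) = bform n x y" for x y
    unfolding hyperplane_reflection_def bform_add2 bform_scale2 bform_add bform_scale
    using u bform_sym[of x u] by (simp add: algebra_simps)
  then show ?thesis using u by (auto simp: orthogonal_map_def supp_def hyperplane_reflection_def)
qed

lemma orthogonal_comp: "orthogonal_map L \<Longrightarrow> orthogonal_map M \<Longrightarrow> orthogonal_map (\<lambda>x. L (M x))"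
  by (simp add: orthogonal_map_def)

text \<open>Weak form of the Cartan--Dieudonne theorem: no bound on the number of reflections.\<close>

lemma orthogonal_map_reflections:
  assumes "orthogonal_map L" "\<And>j. j \<in> I \<Longrightarrow> m < j \<Longrightarrow> L (orthonormal j) = orthonormal j" "m \<le> N"
  shows "\<exists>vs. unit_list vs \<and> (\<forall>z. supp z \<longrightarrow> L z = foldr hyperplane_reflection vs z)"
  using assms
proof (induction m arbitrary: L)
  case 0
  have "L z = z" if z: "supp z" for z
  proof (rule supp_eqI)
    fix j assume j: "j \<in> I"
    have "bform n (L z) (L (orthonormal j)) = bform n z (orthonormal j)"
      using 0(1) z supp_orthonormal[OF j] by (simp add: orthogonal_map_def)
    then show "bform n (L z) (orthonormal j) = bform n z (orthonormal j)" using 0(2)[OF j] j by simp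
  qed (use 0(1) z in \<open>auto simp: orthogonal_map_def\<close>)
  then show ?case by (intro exI[of _ "[]"]) (simp add: unit_list_def)
next
  case (Suc m)
  let ?x = "orthonormal (Suc m)"
  let ?y = "L ?x"
  have mI: "Suc m \<in> I" using Suc.prems by auto
  have x: "supp ?x" "bform n ?x ?x = 1" using supp_orthonormal[OF mI] bform_orthonormal[OF mI mI] by auto
  have y: "supp ?y" "bform n ?y ?y = 1" using Suc.prems(1) x by (auto simp: orthogonal_map_def)
  have xj: "bform n (orthonormal j) ?x = 0" if "j \<in> I" "Suc m < j" for j
    using bform_orthonormal[OF that(1) mI] that by simp
  have yj: "bform n (orthonormal j) ?y = 0" if j: "j \<in> I" "Suc m < j" for j
  proof -
    have "bform n (L (orthonormal j)) ?y = bform n (orthonormal j) ?x"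
      using Suc.prems(1) x supp_orthonormal[OF j(1)] by (simp add: orthogonal_map_def)
    then show ?thesis using Suc.prems(2)[OF j] xj[OF j] by simp
  qed
  have fix_perp: "hyperplane_reflection u z = z" if "bform n z u = 0" for u z
    using that bform_sym[of u z] by (simp add: hyperplane_reflection_def)
  have "\<exists>us. unit_list us \<and> foldr hyperplane_reflection us ?y = ?x \<and>
      (\<forall>j\<in>I. Suc m < j \<longrightarrow> foldr hyperplane_reflection us (orthonormal j) = orthonormal j)"
  proof (cases "bform n ?x ?y = 1")
    case False
    \<comment> \<open>The difference of the unit vectors ?y and ?x has square 2 - 2<?x,?y>, nonzero
      in this case; normalized by d, it defines a reflection that sends ?y to ?x.\<close>
    define d where "d = 1 / csqrt (2 - 2 * bform n ?x ?y)"
    have d: "d * d * (2 - 2 * bform n ?x ?y) = 1"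
    proof -
      have "d\<^sup>2 = 1 / (2 - 2 * bform n ?x ?y)" by (simp add: d_def power_divide)
      then show ?thesis using False by (simp add: power2_eq_square)
    qed
    define u where "u = (\<lambda>k. d * (?y k + (-1) * ?x k))"
    have "bform n u u = d * d * (2 - 2 * bform n ?x ?y)"
      unfolding u_def bform_scale bform_scale2 bform_add bform_add2 x y
      using bform_sym[of ?y ?x] by (simp add: algebra_simps)
    then have u: "bform n u u = 1" using d by simp
    have uy: "bform n u ?y = d * (1 - bform n ?x ?y)"
      unfolding u_def bform_scale bform_add y by simp
    have "hyperplane_reflection u ?y k = ?x k" for k
    proof -
      have "hyperplane_reflection u ?y k = ?y k - (d * d * (2 - 2 * bform n ?x ?y)) * (?y k - ?x k)"
        unfolding hyperplane_reflection_def uy unfolding u_def by (simp only: ring_distribs mult_ac) simp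
      then show ?thesis unfolding d by simp
    qed
    then have "hyperplane_reflection u ?y = ?x" by (rule ext)
    moreover have "hyperplane_reflection u (orthonormal j) = orthonormal j" if "j \<in> I" "Suc m < j" for j
      by (rule fix_perp) (simp only: u_def bform_scale2 bform_add2 xj[OF that] yj[OF that], simp)
    moreover have "supp u" using x y by (auto simp: supp_def u_def)
    ultimately show ?thesis using u by (intro exI[of _ "[u]"]) (auto simp: unit_list_def)
  next
    case True
    \<comment> \<open>Here ?y - ?x has square 0. But ?y + ?x has square 4, the reflection in it
      sends ?y to -?x, and the reflection in ?x corrects the sign.\<close>
    define u where "u = (\<lambda>k. (1 / 2) * (?y k + ?x k))"
    have u: "bform n u u = 1"
      unfolding u_def bform_scale bform_scale2 bform_add bform_add2 x y
      using bform_sym[of ?y ?x] True by simp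
    have uy: "bform n u ?y = 1"
      unfolding u_def bform_scale bform_add y True by simp
    have "hyperplane_reflection u ?y = (\<lambda>k. (-1) * ?x k)"
      unfolding hyperplane_reflection_def uy by (simp add: u_def fun_eq_iff algebra_simps)
    then have "hyperplane_reflection ?x (hyperplane_reflection u ?y) = ?x"
      by (simp only: hyperplane_reflection_def bform_scale2 x) (simp add: fun_eq_iff)
    moreover have "hyperplane_reflection u (orthonormal j) = orthonormal j" if "j \<in> I" "Suc m < j" for j
      by (rule fix_perp) (simp only: u_def bform_scale2 bform_add2 xj[OF that] yj[OF that], simp)
    moreover have "hyperplane_reflection ?x (orthonormal j) = orthonormal j" if "j \<in> I" "Suc m < j" for j
      by (rule fix_perp) (rule xj[OF that])
    moreover have "supp u" using x y by (auto simp: supp_def u_def)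
    ultimately show ?thesis using u x by (intro exI[of _ "[?x, u]"]) (auto simp: unit_list_def)
  qed
  then obtain us where us: "unit_list us" "foldr hyperplane_reflection us ?y = ?x"
    "\<And>j. j \<in> I \<Longrightarrow> Suc m < j \<Longrightarrow> foldr hyperplane_reflection us (orthonormal j) = orthonormal j" by blast
  have orth: "orthogonal_map (foldr hyperplane_reflection us)"
    using us(1) by (induction us) (auto simp: unit_list_def o_def orthogonal_map_def intro: orthogonal_comp
      dest: orthogonal_reflection[unfolded orthogonal_map_def])
  have "\<exists>vs. unit_list vs \<and> (\<forall>z. supp z \<longrightarrow> foldr hyperplane_reflection us (L z) = foldr hyperplane_reflection vs z)"
  proof (rule Suc.IH)
    show "orthogonal_map (\<lambda>z. foldr hyperplane_reflection us (L z))"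
      by (rule orthogonal_comp[OF orth Suc.prems(1)])
    fix j assume j: "j \<in> I" "m < j"
    show "foldr hyperplane_reflection us (L (orthonormal j)) = orthonormal j"
    proof (cases "j = Suc m")
      case False
      then have "Suc m < j" using j by simp
      then show ?thesis using us(3)[OF j(1)] Suc.prems(2)[OF j(1)] by simp
    qed (simp add: us)
  qed (use Suc.prems in simp)
  then obtain vs where vs: "unit_list vs" "\<And>z. supp z \<Longrightarrow> foldr hyperplane_reflection us (L z) = foldr hyperplane_reflection vs z"
    by blast
  have inv: "foldr hyperplane_reflection (rev us) (foldr hyperplane_reflection us z) = z" for z
    using us(1) by (induction us arbitrary: z) (auto simp: unit_list_def reflection_involutive)
  have "unit_list (rev us @ vs)" using us vs by (auto simp: unit_list_def)
  moreover have "L z = foldr hyperplane_reflection (rev us @ vs) z" if "supp z" for z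
    using vs(2)[OF that] inv[of "L z"] by simp
  ultimately show ?case by blast
qed

text \<open>N is odd, so L and -L have opposite determinants, and one of them is a product of an
  even number of reflections. The parities are compared through the volume of the image of the
  standard basis.\<close>

lemma spin_of_orthogonal:
  assumes L: "orthogonal_map L"
  obtains g c where "g \<in> spin n" "c = 1 \<or> c = -1" "\<And>i. i \<in> I \<Longrightarrow> so_column n g i = (\<lambda>k. c * L (unit_vec i) k)"
proof -
  let ?M = "\<lambda>z k. (-1) * L z k"
  have "supp (?M z)" if "supp (L z)" for z using that by (auto simp: supp_def)
  moreover have "bform n (?M x) (?M y) = bform n (L x) (L y)" for x y
    by (simp only: bform_scale bform_scale2) simp
  ultimately have M: "orthogonal_map ?M" using L by (auto simp: orthogonal_map_def)
  obtain vs where vs: "unit_list vs" "\<And>z. supp z \<Longrightarrow> L z = foldr hyperplane_reflection vs z"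
    using orthogonal_map_reflections[OF L, of N] by auto
  obtain ws where ws: "unit_list ws" "\<And>z. supp z \<Longrightarrow> ?M z = foldr hyperplane_reflection ws z"
    using orthogonal_map_reflections[OF M, of N] by auto
  have volume: "wedge_list (map (foldr hyperplane_reflection us) (initial unit_vec N)) I = (-1) ^ length us"
    if "unit_list us" for us
    unfolding wedge_list_reflections initial_unit_vec
    using ext_reflections_top[of us "basis_ext I"] that by (simp add: basis_ext_def unit_list_def)
  have supp_initial: "supp z" if "z \<in> set (initial unit_vec N)" for z
    using that supp_unit_vec by (auto simp: initial_def)
  have "map (foldr hyperplane_reflection ws) (initial unit_vec N) = map ?M (initial unit_vec N)"
    by (rule map_cong[OF refl]) (use ws(2) supp_initial in metis)
  also have "\<dots> = map (\<lambda>z k. - foldr hyperplane_reflection vs z k) (initial unit_vec N)"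
    by (rule map_cong[OF refl]) (use vs(2) supp_initial in simp)
  finally have "(-1 :: complex) ^ length ws = wedge_list (map (\<lambda>z k. - foldr hyperplane_reflection vs z k) (initial unit_vec N)) I"
    using volume[OF ws(1)] by metis
  also have "\<dots> = (-1) ^ N * (-1) ^ length vs"
    using volume[OF vs(1)]
      wedge_list_map_uminus[of "[]" "foldr hyperplane_reflection vs" "initial unit_vec N" "[]" I] by simp
  finally have "(-1 :: complex) ^ length ws = (-1) ^ N * (-1) ^ length vs" .
  then have parity: "even (length ws) \<or> even (length vs)"
    using odd_N by (auto simp: minus_one_power_iff split: if_splits)
  show thesis
  proof (cases "even (length vs)")
    case True
    show thesis
    proof (rule that[of "clifford_product vs" 1])
      show "clifford_product vs \<in> spin n" using spin_clifford_product vs True by blast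
      show "so_column n (clifford_product vs) i = (\<lambda>k. 1 * L (unit_vec i) k)" if "i \<in> I" for i
        by (rule so_column_clifford[OF vs(1) True])
          (use L supp_unit_vec[OF that] vs(2)[OF supp_unit_vec[OF that]] in \<open>auto simp: orthogonal_map_def\<close>)
    qed simp
  next
    case False
    then have e: "even (length ws)" using parity by simp
    show thesis
    proof (rule that[of "clifford_product ws" "-1"])
      show "clifford_product ws \<in> spin n" using spin_clifford_product ws e by blast
      show "so_column n (clifford_product ws) i = (\<lambda>k. (-1) * L (unit_vec i) k)" if "i \<in> I" for i
        by (rule so_column_clifford[OF ws(1) e])
          (use M supp_unit_vec[OF that] in \<open>auto simp: orthogonal_map_def ws(2)[OF supp_unit_vec[OF that], symmetric]\<close>)
    qed simp
  qed
qed

end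

section \<open>A configuration in general position\<close>

lemma wedge_right_unit_basis:
  assumes "finite T" "m \<notin> T"
  shows "wedge_right (\<lambda>k. c * unit_vec m k) (\<lambda>S. \<sigma> * basis_ext T S) =
    (\<lambda>S. (c * \<sigma> * above_sign (insert m T) m) * basis_ext (insert m T) S)"
proof
  fix S :: "nat set"
  show "wedge_right (\<lambda>k. c * unit_vec m k) (\<lambda>S. \<sigma> * basis_ext T S) S =
    (c * \<sigma> * above_sign (insert m T) m) * basis_ext (insert m T) S"
  proof (cases "S = insert m T")
    case True
    have "wedge_right (\<lambda>k. c * unit_vec m k) (\<lambda>S. \<sigma> * basis_ext T S) S =
        (\<Sum>s\<in>{m}. above_sign S s * (c * unit_vec m s) * (\<sigma> * basis_ext T (S - {s})))"
      unfolding wedge_right_def by (rule sum.mono_neutral_right) (use True assms in \<open>auto simp: unit_vec_def\<close>)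
    then show ?thesis using True assms by (simp add: basis_ext_def unit_vec_def)
  next
    case False
    then have "unit_vec m s * basis_ext T (S - {s}) = 0" if "s \<in> S" for s
      using that by (auto simp: unit_vec_def basis_ext_def split: if_splits)
    then have "above_sign S s * (c * unit_vec m s) * (\<sigma> * basis_ext T (S - {s})) = 0" if "s \<in> S" for s
      using that by auto
    then have "wedge_right (\<lambda>k. c * unit_vec m k) (\<lambda>S. \<sigma> * basis_ext T S) S = 0"
      unfolding wedge_right_def by (rule sum.neutral[OF ballI])
    then show ?thesis using False by (simp add: basis_ext_def)
  qed
qed

text \<open>Cofactor expansion of the minor with rows S and r along the row r: the cofactors \<nu>
  do not depend on r, and the last one is the minor of the first d - 1 columns with rows S.\<close>

lemma contract_initial_expansion:
  assumes "finite S"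
  shows "\<exists>\<nu>. (\<forall>r. contract {r} (\<lambda>_. 1) (wedge_list (initial w d)) S = (\<Sum>c\<in>{1..d}. \<nu> c * w c r)) \<and>
    (1 \<le> d \<longrightarrow> \<nu> d = wedge_list (initial w (d - 1)) S)"
  using assms
proof (induction d arbitrary: S)
  case 0
  then show ?case by (simp add: contract_def basis_ext_def)
next
  case (Suc d)
  let ?y = "wedge_list (initial w d)"
  have "\<forall>s. \<exists>\<mu>. \<forall>r. contract {r} (\<lambda>_. 1) ?y (S - {s}) = (\<Sum>c\<in>{1..d}. \<mu> c * w c r)"
    using Suc.IH Suc.prems by blast
  then obtain \<mu> where \<mu>: "\<And>s r. contract {r} (\<lambda>_. 1) ?y (S - {s}) = (\<Sum>c\<in>{1..d}. \<mu> s c * w c r)"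
    by metis
  define \<nu> where "\<nu> c = (if c = Suc d then ?y S else - (\<Sum>s\<in>S. above_sign S s * w (Suc d) s * \<mu> s c))" for c
  have "contract {r} (\<lambda>_. 1) (wedge_list (initial w (Suc d))) S = (\<Sum>c\<in>{1..Suc d}. \<nu> c * w c r)" for r
  proof -
    have "contract {r} (\<lambda>_. 1) (wedge_list (initial w (Suc d))) S =
        w (Suc d) r * ?y S - (\<Sum>s\<in>S. above_sign S s * w (Suc d) s * (\<Sum>c\<in>{1..d}. \<mu> s c * w c r))"
      unfolding initial_Suc wedge_list_snoc contract_wedge_right[OF finite.insertI[OF finite.emptyI] Suc.prems]
      by (simp add: wedge_right_def \<mu>)
    also have "(\<Sum>s\<in>S. above_sign S s * w (Suc d) s * (\<Sum>c\<in>{1..d}. \<mu> s c * w c r)) =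
        (\<Sum>c\<in>{1..d}. (\<Sum>s\<in>S. above_sign S s * w (Suc d) s * \<mu> s c) * w c r)"
      unfolding sum_distrib_left sum_distrib_right by (subst sum.swap) (simp add: mult.assoc)
    also have "\<dots> = - (\<Sum>c\<in>{1..d}. \<nu> c * w c r)"
      unfolding sum_negf[symmetric] by (rule sum.cong) (auto simp: \<nu>_def)
    finally show ?thesis by (simp add: \<nu>_def mult.commute)
  qed
  then show ?case by (intro exI[of _ \<nu>]) (simp add: \<nu>_def)
qed

text \<open>The product (x - 1) ... (x - m). Its value at k + 1 is k! / (k - m)!, which makes the
  reciprocal factorials of \<open>shift_exp\<close> polynomial in the row index up to a factor
  depending on the row only.\<close>

definition falling_poly :: "nat \<Rightarrow> complex poly" where
  "falling_poly m = (\<Prod>l<m. [:- of_nat (Suc l), 1:])"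

lemma falling_poly_Suc: "falling_poly (Suc m) = falling_poly m * [:- of_nat (Suc m), 1:]"
  by (simp add: falling_poly_def)

lemma falling_poly_monic: "degree (falling_poly m) = m \<and> lead_coeff (falling_poly m) = 1"
proof (induction m)
  case (Suc m)
  then have "falling_poly m \<noteq> 0" by auto
  then have "degree (falling_poly (Suc m)) = Suc m"
    unfolding falling_poly_Suc by (subst degree_mult_eq) (use Suc in auto)
  moreover have "lead_coeff (falling_poly (Suc m)) = 1"
    unfolding falling_poly_Suc lead_coeff_mult using Suc by auto
  ultimately show ?case by simp
qed (simp add: falling_poly_def)

lemma poly_falling_poly:
  "poly (falling_poly m) (of_nat (Suc k)) = (if m \<le> k then fact k / fact (k - m) else 0)"
proof (induction m)
  case (Suc m)
  have "poly (falling_poly (Suc m)) (of_nat (Suc k)) = poly (falling_poly m) (of_nat (Suc k)) * (of_nat k - of_nat m)"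
    by (simp add: falling_poly_Suc algebra_simps)
  moreover have "fact k / fact (k - m) * (of_nat k - of_nat m) = (fact k / fact (k - Suc m) :: complex)" if "Suc m \<le> k"
  proof -
    have "k - m = Suc (k - Suc m)" using that by simp
    then have f: "(fact (k - m) :: complex) = of_nat (k - m) * fact (k - Suc m)" by (metis fact_Suc)
    have d: "of_nat k - of_nat m = (of_nat (k - m) :: complex)" "of_nat (k - m) \<noteq> (0 :: complex)"
      using that by (simp_all add: of_nat_diff)
    have "K / (D * F) * D = K / F" if "D \<noteq> 0" for K D F :: complex using that by simp
    then show ?thesis unfolding f d(1) using d(2) .
  qed
  ultimately show ?case unfolding Suc by auto
qed (simp add: falling_poly_def)

context quadratic_space
begin

text \<open>Entry (k, i) of the exponential of the shift e_i |-> e_(i+1).\<close>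

definition shift_exp :: "nat \<Rightarrow> nat \<Rightarrow> complex" where
  "shift_exp k i = (if i \<le> k then 1 / fact (k - i) else 0)"

text \<open>Expanding a vanishing minor with \<open>d + 1\<close> rows along its last row, one obtains a nonzero polynomial of degree
  at most \<open>d\<close> in the index of that row which vanishes at all the \<open>d + 1\<close> indices.\<close>

lemma shift_exp_flag_nonzero:
  assumes \<kappa>: "\<kappa> \<noteq> 0" and w: "\<And>c k. c \<in> I \<Longrightarrow> k \<in> I \<Longrightarrow> w c k = \<kappa> * shift_exp k c"
  shows "R \<subseteq> I \<Longrightarrow> card R = d \<Longrightarrow> wedge_list (initial w d) R \<noteq> 0"
proof (induction d arbitrary: R)
  case 0
  then have "R = {}" using finite_subset[of R I] by simp
  then show ?case by (simp add: basis_ext_def)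
next
  case (Suc d)
  have finR: "finite R" using Suc.prems(1) finite_subset by blast
  then obtain r0 where r0: "r0 \<in> R" using Suc.prems(2) by (metis card_eq_0_iff equals0I old.nat.distinct(2))
  let ?R = "R - {r0}"
  have fin: "finite ?R" using finR by simp
  have "wedge_list (initial w d) ?R \<noteq> 0" by (rule Suc.IH) (use Suc.prems r0 finR in auto)
  moreover obtain \<nu> where \<nu>: "\<And>r. contract {r} (\<lambda>_. 1) (wedge_list (initial w (Suc d))) ?R = (\<Sum>c\<in>{1..Suc d}. \<nu> c * w c r)"
    "\<nu> (Suc d) = wedge_list (initial w d) ?R"
    using contract_initial_expansion[OF fin, of w "Suc d"] by auto
  ultimately have lead: "\<nu> (Suc d) \<noteq> 0" by simp
  have le: "Suc d \<le> N" using card_mono[OF _ Suc.prems(1)] Suc.prems(2) by simp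
  \<comment> \<open>Up to the factor \<kappa> / (r - 1)!, the expansion along row r is the value of
    p at r. The coefficient of p in degree d is the minor that is nonzero by the induction
    hypothesis.\<close>
  define p where "p = (\<Sum>c\<in>{1..Suc d}. Polynomial.smult (\<nu> c) (falling_poly (c - 1)))"
  have "coeff p d = (\<Sum>c\<in>{1..Suc d}. if c = Suc d then \<nu> c else 0)"
    unfolding p_def coeff_sum
  proof (rule sum.cong[OF refl])
    fix c assume c: "c \<in> {1..Suc d}"
    show "coeff (Polynomial.smult (\<nu> c) (falling_poly (c - 1))) d = (if c = Suc d then \<nu> c else 0)"
      using falling_poly_monic[of "c - 1"] c by (auto simp: coeff_eq_0)
  qed
  then have "coeff p d \<noteq> 0" using lead by simp
  then have p0: "p \<noteq> 0" by auto
  have "degree p \<le> d"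
    unfolding p_def by (rule degree_sum_le) (use falling_poly_monic in \<open>auto intro!: order_trans[OF degree_smult_le]\<close>)
  show ?case
  proof
    assume zero: "wedge_list (initial w (Suc d)) R = 0"
    have root: "poly p (of_nat r) = 0" if r: "r \<in> R" for r
    proof -
      have rI: "r \<in> I" using r Suc.prems by auto
      then obtain k where k: "r = Suc k" by (cases r) auto
      have "contract {r} (\<lambda>_. 1) (wedge_list (initial w (Suc d))) ?R = 0"
      \<comment> \<open>For r = r0 the contraction is the minor assumed to vanish. Any other r lies
        in ?R already, and the contraction sums over the empty set, as for a repeated row.\<close>
      proof (cases "r = r0")
        case True
        have "{r0} - ?R = {r0}" "insert r0 ?R = R" using r0 by auto
        then show ?thesis unfolding contract_def True using zero by (simp only:) simp
      next
        case False
        then have "{r} - ?R = {}" using r by auto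
        then show ?thesis by (simp add: contract_def)
      qed
      then have "0 = (\<Sum>c\<in>{1..Suc d}. \<nu> c * w c r)" using \<nu>(1) by simp
      also have "\<dots> = (\<Sum>c\<in>{1..Suc d}. (\<kappa> / fact k) * (\<nu> c * poly (falling_poly (c - 1)) (of_nat r)))"
      proof (rule sum.cong[OF refl])
        fix c assume c: "c \<in> {1..Suc d}"
        then have "c \<in> I" using le by auto
        moreover have "shift_exp r c = poly (falling_poly (c - 1)) (of_nat r) / fact k"
        proof -
          have e: "c \<le> r \<longleftrightarrow> c - 1 \<le> k" "r - c = k - (c - 1)" using c k by auto
          have "poly (falling_poly (c - 1)) (of_nat r) = (if c - 1 \<le> k then fact k / fact (k - (c - 1)) else 0)"
            unfolding k by (rule poly_falling_poly)
          then show ?thesis unfolding shift_exp_def e by simp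
        qed
        ultimately show "\<nu> c * w c r = (\<kappa> / fact k) * (\<nu> c * poly (falling_poly (c - 1)) (of_nat r))"
          using w[OF _ rI, of c] by simp
      qed
      also have "\<dots> = (\<kappa> / fact k) * poly p (of_nat r)"
        by (simp add: p_def poly_sum sum_distrib_left del: sum.cl_ivl_Suc)
      finally show ?thesis using \<kappa> by simp
    qed
    have "of_nat ` R \<subseteq> {x. poly p x = 0}" using root by auto
    then have "card ((of_nat :: nat \<Rightarrow> complex) ` R) \<le> card {x. poly p x = 0}"
      by (rule card_mono[OF poly_roots_finite[OF p0]])
    also have "\<dots> \<le> degree p" by (rule card_poly_roots_bound[OF p0])
    also have "\<dots> \<le> d" by fact
    finally show False using Suc.prems(2) by (simp add: card_image inj_on_def)
  qed
qed

lemma orthogonal_reversal: "orthogonal_map (\<lambda>z k. if k \<in> I then z (N + 1 - k) else 0)"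
proof -
  have "bform n (\<lambda>k. if k \<in> I then x (N + 1 - k) else 0) (\<lambda>k. if k \<in> I then y (N + 1 - k) else 0) = bform n x y" for x y
  proof -
    have "bform n (\<lambda>k. if k \<in> I then x (N + 1 - k) else 0) (\<lambda>k. if k \<in> I then y (N + 1 - k) else 0) =
        (\<Sum>i\<in>I. (-1) ^ (N + 1 - i - 1) * x (N + 1 - i) * y (N + 1 - (N + 1 - i)))"
      unfolding bform_eq by (rule sum.cong[OF refl]) (use sign_flip in auto)
    also have "\<dots> = bform n x y" unfolding bform_eq by (rule sum_flip[symmetric])
    finally show ?thesis .
  qed
  then show ?thesis by (auto simp: orthogonal_map_def supp_def)
qed

text \<open>The shift is skew for the form, so its exponential is an isometry; in entries this is
  the binomial expansion of (1 - 1)^m / m! with m = N + 1 - i - j.\<close>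

lemma shift_exp_orthogonal:
  assumes i: "i \<in> I" and j: "j \<in> I"
  shows "(\<Sum>k\<in>I. (-1) ^ (k - 1) * shift_exp k i * shift_exp (N + 1 - k) j) =
    (if j = N + 1 - i then (-1) ^ (i - 1) else 0)"
proof (cases "i + j \<le> N + 1")
  case True
  define m where "m = N + 1 - j - i"
  have "(\<Sum>k\<in>I. (-1) ^ (k - 1) * shift_exp k i * shift_exp (N + 1 - k) j) =
      (\<Sum>k\<in>{i..i + m}. (-1) ^ (k - 1) * shift_exp k i * shift_exp (N + 1 - k) j)"
    by (rule sum.mono_neutral_right) (use i j True in \<open>auto simp: shift_exp_def m_def\<close>)
  also have "\<dots> = (\<Sum>l\<le>m. ((-1) ^ (i - 1) / fact m) * ((-1) ^ l * of_nat (m choose l)))"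
  proof (rule sum.reindex_bij_witness[where i="\<lambda>l. i + l" and j="\<lambda>k. k - i"])
    fix k assume k: "k \<in> {i..i + m}"
    then have e: "N + 1 - k - j = m - (k - i)" "j \<le> N + 1 - k" "k - i \<le> m" "i \<le> k"
      using i j True by (auto simp: m_def)
    have "k - 1 = (i - 1) + (k - i)" using i k by auto
    then have s: "(-1 :: complex) ^ (k - 1) = (-1) ^ (i - 1) * (-1) ^ (k - i)" by (metis power_add)
    show "((-1) ^ (i - 1) / fact m) * ((-1) ^ (k - i) * of_nat (m choose (k - i))) =
        (-1) ^ (k - 1) * shift_exp k i * shift_exp (N + 1 - k) j"
      unfolding s shift_exp_def e(1) using e(2-4) by (simp add: binomial_fact)
  qed auto
  also have "\<dots> = ((-1) ^ (i - 1) / fact m) * (if m = 0 then 1 else 0)"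
    unfolding sum_distrib_left[symmetric] using choose_alternating_sum[of m, where 'a=complex] by (cases "m = 0") auto
  finally show ?thesis using i j True by (auto simp: m_def)
next
  case False
  then have "j \<noteq> N + 1 - i" using i by auto
  moreover have "shift_exp k i * shift_exp (N + 1 - k) j = 0" for k
    using False i j by (auto simp: shift_exp_def)
  ultimately show ?thesis by (simp only: mult.assoc mult_zero_right sum.neutral_const if_False)
qed

lemma orthogonal_shift_exp: "orthogonal_map (\<lambda>z k. if k \<in> I then \<Sum>i\<in>I. z i * shift_exp k i else 0)"
proof -
  let ?L = "\<lambda>z k. if k \<in> I then \<Sum>i\<in>I. z i * shift_exp k i else 0"
  have "bform n (?L x) (?L y) = bform n x y" for x y
  proof -
    have "bform n (?L x) (?L y) = (\<Sum>k\<in>I. \<Sum>i\<in>I. \<Sum>j\<in>I. x i * y j * ((-1) ^ (k - 1) * shift_exp k i * shift_exp (N + 1 - k) j))"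
      unfolding bform_eq
    proof (rule sum.cong[OF refl])
      fix k assume "k \<in> I"
      moreover then have "N + 1 - k \<in> I" by auto
      moreover have "a * (\<Sum>i\<in>I. f i) * (\<Sum>j\<in>I. g j) = (\<Sum>i\<in>I. \<Sum>j\<in>I. a * (f i * g j))" for a :: complex and f g
        unfolding mult.assoc[of a "sum f I"] unfolding sum_product unfolding sum_distrib_left ..
      ultimately show "(-1) ^ (k - 1) * ?L x k * ?L y (N + 1 - k) =
          (\<Sum>i\<in>I. \<Sum>j\<in>I. x i * y j * ((-1) ^ (k - 1) * shift_exp k i * shift_exp (N + 1 - k) j))"
        by (simp only: if_True) (intro sum.cong refl, simp only: mult_ac)
    qed
    also have "\<dots> = (\<Sum>i\<in>I. \<Sum>j\<in>I. \<Sum>k\<in>I. x i * y j * ((-1) ^ (k - 1) * shift_exp k i * shift_exp (N + 1 - k) j))"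
      by (subst sum.swap, rule sum.cong[OF refl], rule sum.swap)
    also have "\<dots> = (\<Sum>i\<in>I. \<Sum>j\<in>I. if j = N + 1 - i then (-1) ^ (i - 1) * x i * y j else 0)"
      unfolding sum_distrib_left[symmetric] by (intro sum.cong refl) (simp only: shift_exp_orthogonal, simp)
    also have "\<dots> = bform n x y"
      unfolding bform_eq by (rule sum.cong[OF refl], subst sum.delta) auto
    finally show ?thesis .
  qed
  then show ?thesis by (auto simp: orthogonal_map_def supp_def)
qed

lemma reversed_flag:
  assumes "\<And>i. i \<in> I \<Longrightarrow> u i = (\<lambda>k. c * unit_vec (N + 1 - i) k)" "c \<noteq> 0"
  shows "a \<le> N \<Longrightarrow> \<exists>\<sigma>. \<sigma> \<noteq> 0 \<and> wedge_list (initial u a) = (\<lambda>S. \<sigma> * basis_ext {N + 1 - a..N} S)"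
proof (induction a)
  case 0
  show ?case by (intro exI[of _ 1]) simp
next
  case (Suc a)
  then obtain \<sigma> where \<sigma>: "\<sigma> \<noteq> 0" "wedge_list (initial u a) = (\<lambda>S. \<sigma> * basis_ext {N + 1 - a..N} S)" by auto
  have "u (Suc a) = (\<lambda>k. c * unit_vec (N + 1 - Suc a) k)" using assms(1)[of "Suc a"] Suc.prems by auto
  moreover have "insert (N + 1 - Suc a) {N + 1 - a..N} = {N + 1 - Suc a..N}" using Suc.prems by auto
  moreover have "N + 1 - Suc a \<notin> {N + 1 - a..N}" using Suc.prems by auto
  moreover have "above_sign T m \<noteq> 0" for T m by (simp add: above_sign_def)
  ultimately show ?case using \<sigma> assms(2)
    wedge_right_unit_basis[of "{N + 1 - a..N}" "N + 1 - Suc a" c \<sigma>]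
    by (intro exI[of _ "c * \<sigma> * above_sign {N + 1 - Suc a..N} (N + 1 - Suc a)"])
      (simp only: initial_Suc wedge_list_snoc mult_eq_0_iff finite_atLeastAtMost simp_thms)
qed

lemma shuffle_sign_nonzero: "shuffle_sign S T \<noteq> 0"
  by (simp add: shuffle_sign_def)

text \<open>For two opposite coordinate flags a single pair (S, T) contributes: T is the complement
  of the indices of y, and S is the rest of {1..c}.\<close>

lemma pairing_coordinate_flags:
  assumes y: "y = (\<lambda>S. \<sigma> * basis_ext {N + 1 - a..N} S)" and z: "z = basis_ext {1..c}"
    and \<sigma>: "\<sigma> \<noteq> 0" and le: "a \<le> N" "c \<le> N" "N \<le> a + c" and x: "x (I - {N - a + 1..c}) \<noteq> 0"
  shows "pairing N x y z \<noteq> 0"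
proof -
  let ?S = "{N - a + 1..c}" and ?T = "{1..N - a}"
  let ?t = "\<lambda>S T. (if S \<inter> T = {} then shuffle_sign S T * z (S \<union> T) else 0) *
     (shuffle_sign (I - S) S * x (I - S)) * (shuffle_sign (I - T) T * y (I - T))"
  have sub: "?S \<subseteq> I" "?T \<subseteq> I" using le by auto
  have zero: "?t S T = 0" if ST: "S \<subseteq> I" "T \<subseteq> I" and ne: "(S, T) \<noteq> (?S, ?T)" for S T
  proof (rule ccontr)
    assume "?t S T \<noteq> 0"
    then have *: "S \<inter> T = {}" "S \<union> T = {1..c}" "I - T = {N + 1 - a..N}"
      by (auto simp: y z basis_ext_def split: if_splits)
    have "T = I - {N + 1 - a..N}" using *(3) ST by auto
    also have "\<dots> = ?T" using le by auto
    finally have T: "T = ?T" .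
    have "S = {1..c} - ?T" using *(1,2) T by auto
    also have "\<dots> = ?S" using le by auto
    finally show False using T ne by simp
  qed
  have "pairing N x y z = (\<Sum>(S, T)\<in>Pow I \<times> Pow I. ?t S T)"
    unfolding pairing_def by (rule sum.cartesian_product)
  also have "\<dots> = (\<Sum>(S, T)\<in>{(?S, ?T)}. ?t S T)"
  proof (rule sum.mono_neutral_right)
    show "\<forall>i\<in>Pow I \<times> Pow I - {(?S, ?T)}. (case i of (S, T) \<Rightarrow> ?t S T) = 0"
    proof
      fix i assume i: "i \<in> Pow I \<times> Pow I - {(?S, ?T)}"
      obtain S T where ST: "i = (S, T)" by (cases i)
      show "(case i of (S, T) \<Rightarrow> ?t S T) = 0"
        unfolding ST prod.case by (rule zero) (use i ST in blast)+
    qed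
  qed (use sub in auto)
  also have "\<dots> = ?t ?S ?T" by simp
  finally have "pairing N x y z = ?t ?S ?T" .
  moreover have "?S \<inter> ?T = {}" "?S \<union> ?T = {1..c}" "I - ?T = {N + 1 - a..N}" using le by auto
  ultimately show ?thesis using x \<sigma> by (simp add: shuffle_sign_nonzero y z basis_ext_def)
qed

text \<open>With U reversed and V standard only one index set is left for W_d, so the function is a
  nonzero multiple of a single minor of the shift exponential.\<close>

lemma quad_ordered_nonzero:
  assumes u: "supported N u" "\<And>i. i \<in> I \<Longrightarrow> u i = (\<lambda>k. \<alpha> * unit_vec (N + 1 - i) k)" "\<alpha> \<noteq> 0"
    and v: "supported N v" "\<And>i. i \<in> I \<Longrightarrow> v i = unit_vec i"
    and w: "supported N w" "\<And>c k. c \<in> I \<Longrightarrow> k \<in> I \<Longrightarrow> w c k = \<kappa> * shift_exp k c" "\<kappa> \<noteq> 0"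
    and sum: "a + b + c + d = 2 * N" and le: "a \<le> N" "b + c \<le> N" "N \<le> a + c" "d \<le> N"
  shows "quad_ordered n (wedge_upto n u) (wedge_upto n v) (wedge_upto n w) a b c d \<noteq> 0"
proof -
  have bc: "b \<le> N" "c \<le> N" using le by auto
  obtain \<sigma> where \<sigma>: "\<sigma> \<noteq> 0" "wedge_list (initial u a) = (\<lambda>S. \<sigma> * basis_ext {N + 1 - a..N} S)"
    using reversed_flag[OF u(2,3) le(1)] by blast
  obtain \<tau> where \<tau>: "\<tau> \<noteq> 0" "wedge_list (initial u b) = (\<lambda>S. \<tau> * basis_ext {N + 1 - b..N} S)"
    using reversed_flag[OF u(2,3) bc(1)] by blast
  have "initial v c = initial unit_vec c"
    unfolding initial_def by (rule map_cong) (use v(2) bc in auto)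
  then have V: "wedge_list (initial v c) = basis_ext {1..c}" by (simp add: initial_unit_vec)
  let ?R = "I - {N - a + 1..c}" and ?P = "{N + 1 - b..N}"
  have PR: "?P \<subseteq> ?R" using le by auto
  have "wedge (wedge_list (initial u b)) (wedge_list (initial w d)) ?R =
      (\<Sum>S\<in>{?P}. shuffle_sign S (?R - S) * (\<tau> * basis_ext ?P S) * wedge_list (initial w d) (?R - S))"
    unfolding wedge_def \<tau>(2) by (rule sum.mono_neutral_right) (use PR in \<open>auto simp: basis_ext_def\<close>)
  also have "\<dots> = shuffle_sign ?P (?R - ?P) * \<tau> * wedge_list (initial w d) (?R - ?P)"
    by (simp add: basis_ext_def)
  also have "\<dots> \<noteq> 0"
  proof -
    have "card (?R - ?P) = d"
    proof -
      have "card ?R = N - card {N - a + 1..c}" by (subst card_Diff_subset) (use le bc in auto)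
      then have "card (?R - ?P) = N - (c - (N - a)) - b"
        using PR le bc by (subst card_Diff_subset) auto
      then show ?thesis using sum le by arith
    qed
    then have "wedge_list (initial w d) (?R - ?P) \<noteq> 0"
      by (intro shift_exp_flag_nonzero[OF w(3,2)]) auto
    then show ?thesis using \<tau> by (simp add: shuffle_sign_nonzero)
  qed
  finally have "wedge_list (initial u b @ initial w d) ?R \<noteq> 0" by (simp add: wedge_list_append)
  then have "pairing N (wedge_list (initial u b @ initial w d)) (wedge_list (initial u a)) (wedge_list (initial v c)) \<noteq> 0"
    by (rule pairing_coordinate_flags[OF \<sigma>(2) V \<sigma>(1) le(1) bc(2) le(3)])
  then show ?thesis
    using quad_ordered_pairing[OF u(1)[unfolded N_eq] v(1)[unfolded N_eq] w(1)[unfolded N_eq], folded N_eq, OF sum le(1,3)]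
    by simp
qed

lemma generic_point:
  obtains p where "p \<in> spin3 n"
    "\<And>a b c d. a + b + c + d = 2 * N \<Longrightarrow> a \<le> N \<Longrightarrow> b + c \<le> N \<Longrightarrow> N \<le> a + c \<Longrightarrow> d \<le> N \<Longrightarrow>
      quad_ordered n (flag_form n (component 0 p)) (flag_form n (component 1 p)) (flag_form n (component 2 p)) a b c d \<noteq> 0"
proof -
  obtain g \<alpha> where g: "g \<in> spin n" "\<alpha> = 1 \<or> \<alpha> = -1"
    "\<And>i. i \<in> I \<Longrightarrow> so_column n g i = (\<lambda>k. \<alpha> * (if k \<in> I then unit_vec i (N + 1 - k) else 0))"
    by (rule spin_of_orthogonal[OF orthogonal_reversal]) (rule that; assumption)
  obtain h \<kappa> where h: "h \<in> spin n" "\<kappa> = 1 \<or> \<kappa> = -1"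
    "\<And>i. i \<in> I \<Longrightarrow> so_column n h i = (\<lambda>k. \<kappa> * (if k \<in> I then \<Sum>j\<in>I. unit_vec i j * shift_exp k j else 0))"
    by (rule spin_of_orthogonal[OF orthogonal_shift_exp]) (rule that; assumption)
  have e: "eone n \<in> spin n" by (rule spin.one)
  have ei: "so_column n (eone n) i = unit_vec i" if "i \<in> I" for i
    using so_column_clifford[of "[]" "unit_vec i" i] supp_unit_vec[OF that] by (simp add: unit_list_def)
  show thesis
  proof (rule that[of "(g, eone n, h)"])
    show "(g, eone n, h) \<in> spin3 n" using g h e by (simp add: spin3_def)
    fix a b c d assume "a + b + c + d = 2 * N" "a \<le> N" "b + c \<le> N" "N \<le> a + c" "d \<le> N"
    then have "quad_ordered n (wedge_upto n (so_column n g)) (wedge_upto n (so_column n (eone n))) (wedge_upto n (so_column n h)) a b c d \<noteq> 0"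
    proof (rule quad_ordered_nonzero[rotated -5])
      show "supported N (so_column n g)" "supported N (so_column n (eone n))" "supported N (so_column n h)"
        using spin_flag(1) g h e by auto
      show "so_column n g i = (\<lambda>k. \<alpha> * unit_vec (N + 1 - i) k)" if "i \<in> I" for i
        unfolding g(3)[OF that] by (rule ext) (use that in \<open>auto simp: unit_vec_def\<close>)
      show "so_column n (eone n) i = unit_vec i" if "i \<in> I" for i by (rule ei[OF that])
      show "\<alpha> \<noteq> 0" "\<kappa> \<noteq> 0" using g h by auto
      show "so_column n h c k = \<kappa> * shift_exp k c" if "c \<in> I" "k \<in> I" for c k
      proof -
        have "(\<Sum>j\<in>I. unit_vec c j * shift_exp k j) = (\<Sum>j\<in>I. if j = c then shift_exp k j else 0)"
          by (rule sum.cong) (auto simp: unit_vec_def)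
        then show ?thesis unfolding h(3)[OF that(1)] using that by simp
      qed
    qed
    then show "quad_ordered n (flag_form n (component 0 (g, eone n, h))) (flag_form n (component 1 (g, eone n, h)))
        (flag_form n (component 2 (g, eone n, h))) a b c d \<noteq> 0"
      by (simp add: component_def flag_form_def)
  qed
qed

end

section \<open>Mutation at pairwise non-adjacent vertices\<close>

definition mutation_term :: "rat \<Rightarrow> rat \<Rightarrow> rat" where
  "mutation_term x y = (if x * y \<le> 0 then 0 else \<bar>x\<bar> * y)"

lemma mutation_term_simps [simp]:
  "mutation_term 0 y = 0" "mutation_term x 0 = 0" "mutation_term 1 y = max y 0" "mutation_term (-1) y = min y 0"
  by (auto simp: mutation_term_def)

lemma mutate_along_append: "mutate_along n (ks @ ls) s = mutate_along n ls (mutate_along n ks s)"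
  by (simp add: mutate_along_def)

text \<open>Vertices without arrows between them do not see each other's mutation: the row of a
  vertex still to be mutated is unchanged, and none of the changed functions occurs in its exchange
  relation. Hence all changes refer to the old matrix and add up.\<close>

lemma mutate_along_commuting:
  assumes "distinct ks" "\<And>k l. k \<in> set ks \<Longrightarrow> l \<in> set ks \<Longrightarrow> b k l = 0"
  shows "fst (mutate_along n ks (b, A)) i j =
      (if i \<in> set ks \<or> j \<in> set ks then - b i j else b i j + (\<Sum>k\<in>set ks. mutation_term (b i k) (b k j))) \<and>
    snd (mutate_along n ks (b, A)) v = (if v \<in> set ks then mutate_fun n v b A else A v)"
  using assms
proof (induction ks arbitrary: i j v rule: rev_induct)
  case Nil
  then show ?case by (simp add: mutate_along_def)
next
  case (snoc k ks)
  obtain b1 A1 where s1: "mutate_along n ks (b, A) = (b1, A1)" by fastforce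
  have k: "k \<notin> set ks" and bk: "\<And>l. l \<in> set ks \<Longrightarrow> b k l = 0" "\<And>l. l \<in> set ks \<Longrightarrow> b l k = 0"
    using snoc.prems by auto
  have b1: "b1 i j = (if i \<in> set ks \<or> j \<in> set ks then - b i j else b i j + (\<Sum>k\<in>set ks. mutation_term (b i k) (b k j)))"
    and A1: "A1 v = (if v \<in> set ks then mutate_fun n v b A else A v)" for i j v
    using snoc.IH[of i j v] snoc.prems s1 by auto
  have row: "b1 k = b k" using b1 k bk by (intro ext) simp
  have col: "b1 i k = (if i \<in> set ks then 0 else b i k)" for i using b1 k bk by simp
  have "mutate_fun n k b1 A1 = mutate_fun n k b A"
  proof
    fix p
    have "(\<Prod>j\<in>{j \<in> vertices n. b k j > 0}. A1 j p ^ nat \<lfloor>b k j\<rfloor>) = (\<Prod>j\<in>{j \<in> vertices n. b k j > 0}. A j p ^ nat \<lfloor>b k j\<rfloor>)"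
      by (rule prod.cong[OF refl]) (use A1 bk in auto)
    moreover have "(\<Prod>j\<in>{j \<in> vertices n. b k j < 0}. A1 j p ^ nat \<lfloor>- b k j\<rfloor>) = (\<Prod>j\<in>{j \<in> vertices n. b k j < 0}. A j p ^ nat \<lfloor>- b k j\<rfloor>)"
      by (rule prod.cong[OF refl]) (use A1 bk in auto)
    ultimately show "mutate_fun n k b1 A1 p = mutate_fun n k b A p"
      using A1 k by (simp add: mutate_fun_def row)
  qed
  moreover have "mutate_matrix k b1 i j =
      (if i \<in> set (ks @ [k]) \<or> j \<in> set (ks @ [k]) then - b i j
       else b i j + (\<Sum>k\<in>set (ks @ [k]). mutation_term (b i k) (b k j)))"
  proof (cases "k = i \<or> k = j")
    case True
    then show ?thesis using row col[of i] bk by (auto simp: mutate_matrix_def)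
  next
    case False
    then have "mutate_matrix k b1 i j = b1 i j + mutation_term (b1 i k) (b1 k j)"
      by (simp add: mutate_matrix_def mutation_term_def)
    also have "\<dots> = b1 i j + mutation_term (if i \<in> set ks then 0 else b i k) (b k j)" by (simp add: row col)
    finally show ?thesis using False b1[of i j] bk(1)[of j] k by auto
  qed
  moreover have "mutate_along n (ks @ [k]) (b, A) = (mutate_matrix k b1, A1(k := mutate_fun n k b1 A1))"
    using s1 by (simp add: mutate_along_def mutate_def)
  ultimately show ?case using A1 k by auto
qed

text \<open>An entry 1 lets through the positive part of the row of the mutated vertex, an entry -1
  its negative part.\<close>

lemma mutation_term_sum:
  assumes "finite K" "B \<subseteq> K" "C \<subseteq> K" "B \<inter> C = {}"
    and f: "\<And>k. k \<in> K \<Longrightarrow> f k = (if k \<in> B then 1 else if k \<in> C then -1 else 0)"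
  shows "(\<Sum>k\<in>K. mutation_term (f k) (g k)) = (\<Sum>k\<in>B. max (g k) 0) + (\<Sum>k\<in>C. min (g k) 0)"
proof -
  have fin: "finite B" "finite C" using finite_subset[OF assms(2,1)] finite_subset[OF assms(3,1)] by auto
  have "(\<Sum>k\<in>K. mutation_term (f k) (g k)) = (\<Sum>k\<in>B \<union> C. mutation_term (f k) (g k))"
    by (rule sum.mono_neutral_right) (use assms in auto)
  also have "\<dots> = (\<Sum>k\<in>B. mutation_term (f k) (g k)) + (\<Sum>k\<in>C. mutation_term (f k) (g k))"
    by (rule sum.union_disjoint) (use fin assms in auto)
  also have "\<dots> = (\<Sum>k\<in>B. max (g k) 0) + (\<Sum>k\<in>C. min (g k) 0)"
    by (intro arg_cong2[where f="(+)"] sum.cong refl) (use assms f in \<open>auto simp: subset_iff\<close>)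
  finally show ?thesis .
qed

section \<open>The quiver during the mutation sequence\<close>

text \<open>The exponents with which the cluster variables enter the function at position \<open>(i, j)\<close> and time \<open>t\<close>.
  At \<open>i = 0\<close> or \<open>j = 0\<close> there is no vertex, but the three-flag function factors into two frozen variables;
  at a black vertex the cluster variable is only the square root of the function.\<close>

definition exponent :: "nat \<Rightarrow> nat \<Rightarrow> nat \<Rightarrow> nat \<Rightarrow> vertex \<Rightarrow> nat" where
  "exponent n i j t q =
     (if i = 0 \<or> j = 0 then
        (if q = X 0 (j + t) \<and> 0 < j + t then 1 else 0) + (if q = Y (n - i - t) \<and> 0 < n - i - t then 1 else 0)
      else if q = X i j then (if j = n then 2 else 1) else 0)"

text \<open>Rows between layers that have all been mutated \<open>t\<close> times.\<close>

definition flat_row :: "nat \<Rightarrow> nat \<Rightarrow> nat \<Rightarrow> nat \<Rightarrow> vertex \<Rightarrow> rat" where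
  "flat_row n i j t q =
     of_nat (exponent n (i - 1) j t q) + of_nat (exponent n i (j - 1) t q) + of_nat (exponent n (i + 1) (j + 1) t q)
     - of_nat (exponent n (i + 1) j t q) - of_nat (exponent n i (j + 1) t q) - of_nat (exponent n (i - 1) (j - 1) t q)"

text \<open>\<open>exchange_pos\<close> and \<open>exchange_neg\<close> are the exponents of the two
  monomials in \<open>vertex_function_exchange\<close>. When a vertex passes from time t to t + 1,
  its neighbours in the layer below are already at time t + 1, those in the layer above still at
  time t.\<close>

definition exchange_pos :: "nat \<Rightarrow> nat \<Rightarrow> nat \<Rightarrow> nat \<Rightarrow> vertex \<Rightarrow> nat" where
  "exchange_pos n i j t q = exponent n (i - 1) (j - 1) (t + 1) q + exponent n (i + 1) (j + 1) t q"

definition exchange_neg :: "nat \<Rightarrow> nat \<Rightarrow> nat \<Rightarrow> nat \<Rightarrow> vertex \<Rightarrow> nat" where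
  "exchange_neg n i j t q =
     (if j < i then exponent n (i - 1) j (t + 1) q + exponent n (i + 1) j t q
      else if i = j then exponent n i (j + 1) t q + exponent n (i + 1) j t q
      else exponent n i (j - 1) (t + 1) q + exponent n i (j + 1) t q)"

definition exchange_row :: "nat \<Rightarrow> nat \<Rightarrow> nat \<Rightarrow> nat \<Rightarrow> vertex \<Rightarrow> rat" where
  "exchange_row n i j t q = of_nat (exchange_pos n i j t q) - of_nat (exchange_neg n i j t q)"

text \<open>Row of \<open>X i j\<close> when every layer has been mutated \<open>s\<close> times, and the layers up to \<open>M\<close> once more.\<close>

definition stage_row :: "nat \<Rightarrow> nat \<Rightarrow> nat \<Rightarrow> nat \<Rightarrow> nat \<Rightarrow> vertex \<Rightarrow> rat" where
  "stage_row n s M i j q =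
     (if max i j \<ge> M + 2 then flat_row n i j s q
      else if max i j = M + 1 then exchange_row n i j s q
      else if max i j = M then - exchange_row n i j s q
      else flat_row n i j (s + 1) q)"

lemma exponent_unfrozen:
  "1 \<le> a \<Longrightarrow> a < n \<Longrightarrow> 1 \<le> b \<Longrightarrow> b < n \<Longrightarrow> exponent n i j t (X a b) = (if a = i \<and> b = j then 1 else 0)"
  by (auto simp: exponent_def)

lemma exponent_other: "1 \<le> i \<Longrightarrow> 1 \<le> j \<Longrightarrow> q \<noteq> X i j \<Longrightarrow> exponent n i j t q = 0"
  by (simp add: exponent_def)

text \<open>At a virtual position the exchange relation degenerates to an equality of monomials in
  frozen variables; it takes the place of a mutation there.\<close>

lemma exponent_exchange_column:
  "1 \<le> i \<Longrightarrow> i + t + 1 \<le> n \<Longrightarrow>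
    exponent n i 0 t q + exponent n i 0 (t + 1) q = exponent n (i - 1) 0 (t + 1) q + exponent n (i + 1) 0 t q"
  by (auto simp: exponent_def)

lemma exponent_exchange_row:
  "1 \<le> j \<Longrightarrow>
    exponent n 0 j t q + exponent n 0 j (t + 1) q = exponent n 0 (j - 1) (t + 1) q + exponent n 0 (j + 1) t q"
  by (auto simp: exponent_def)

lemma exponent_disjoint:
  assumes "1 \<le> a" "1 \<le> b" "(i, j) \<noteq> (a, b)"
  shows "exponent n i j t q = 0 \<or> exponent n a b t' q = 0"
proof (cases "q = X a b")
  case True
  then show ?thesis using assms by (auto simp: exponent_def)
qed (use exponent_other[OF assms(1,2)] in auto)

text \<open>No variable occurs in both monomials, so each of them can be recovered from the signs of
  the row.\<close>

lemma exchange_disjoint: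
  assumes "1 \<le> i" "1 \<le> j"
  shows "exchange_pos n i j t q = 0 \<or> exchange_neg n i j t q = 0"
proof -
  have d: "exponent n (i - 1) (j - 1) (t + 1) q = 0 \<or> exponent n a b t' q = 0"
    "exponent n (i + 1) (j + 1) t q = 0 \<or> exponent n a b t' q = 0"
    if "1 \<le> a" "1 \<le> b" "(i - 1, j - 1) \<noteq> (a, b)" "(i + 1, j + 1) \<noteq> (a, b)" for a b t'
    by (rule exponent_disjoint[OF that(1,2,3)], rule exponent_disjoint[OF that(1,2,4)])
  consider "j < i" | "i = j" | "i < j" by linarith
  then show ?thesis
  proof cases
    case 1
    then show ?thesis using d[of "i - 1" j "t + 1"] d[of "i + 1" j t] assms
      by (simp add: exchange_pos_def exchange_neg_def) linarith
  next
    case 2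
    then show ?thesis using d[of i "i + 1" t] d[of "i + 1" i t] assms
      by (simp add: exchange_pos_def exchange_neg_def) linarith
  next
    case 3
    then show ?thesis using d[of i "j - 1" "t + 1"] d[of i "j + 1" t] assms
      by (simp add: exchange_pos_def exchange_neg_def) linarith
  qed
qed

lemma exchange_row_parts:
  assumes "1 \<le> i" "1 \<le> j"
  shows "max (exchange_row n i j t q) 0 = of_nat (exchange_pos n i j t q)"
    and "min (exchange_row n i j t q) 0 = - of_nat (exchange_neg n i j t q)"
  using exchange_disjoint[OF assms, of n t q] by (auto simp: exchange_row_def)

lemma layerE:
  assumes "q \<in> layer n m"
  obtains a b where "q = X a b" "1 \<le> a" "a < n" "1 \<le> b" "b < n" "max a b = m"
  using assms by (auto simp: layer_def)

lemma in_layer: "1 \<le> a \<Longrightarrow> a < n \<Longrightarrow> 1 \<le> b \<Longrightarrow> b < n \<Longrightarrow> X a b \<in> layer n m \<longleftrightarrow> max a b = m"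
  by (auto simp: layer_def)

lemma exponent_layer:
  "k \<in> layer n m \<Longrightarrow> exponent n i j t k = (if k = X i j then 1 else 0)"
  by (erule layerE) (auto simp: exponent_unfrozen)

lemma exponent_layer_below: "k \<in> layer n m \<Longrightarrow> i < m \<Longrightarrow> j < m \<Longrightarrow> exponent n i j t k = 0"
  by (erule layerE) (auto simp: exponent_unfrozen)

lemma exponent_layer_above: "k \<in> layer n m \<Longrightarrow> m < i \<or> m < j \<Longrightarrow> exponent n i j t k = 0"
  by (erule layerE) (auto simp: exponent_unfrozen)

text \<open>All mutable neighbours that will be mutated lie in the two adjacent layers. This is what
  makes the mutations within one layer commute.\<close>

lemma exchange_row_layer:
  assumes k: "k \<in> layer n m" and ij: "1 \<le> i" "1 \<le> j" "max i j = m"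
  shows "exchange_row n i j t k = 0"
proof -
  consider "j < i" "i = m" | "i = j" "i = m" | "i < j" "j = m" using ij(3) by linarith
  then show ?thesis
    by cases (use ij in \<open>simp_all add: exchange_row_def exchange_pos_def exchange_neg_def
      exponent_layer_above[OF k] exponent_layer_below[OF k]\<close>)
qed

lemma finite_layer: "finite (layer n m)"
  by (rule finite_subset[of _ "(\<lambda>(i, j). X i j) ` ({1..n} \<times> {1..n})"]) (auto simp: layer_def)

text \<open>The row of a vertex outside K after mutation at the pairwise non-adjacent vertices of K;
  f is its old row and g the old matrix.\<close>

definition update_row :: "(vertex \<Rightarrow> rat) \<Rightarrow> vertex set \<Rightarrow> (vertex \<Rightarrow> vertex \<Rightarrow> rat) \<Rightarrow> vertex \<Rightarrow> rat" where
  "update_row f K g q = (if q \<in> K then - f q else f q + (\<Sum>k\<in>K. mutation_term (f k) (g k q)))"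

lemma update_row_parts:
  assumes K: "K = layer n m" and B: "B \<subseteq> K" "C \<subseteq> K" "B \<inter> C = {}"
    and f: "\<And>k. k \<in> K \<Longrightarrow> f k = (if k \<in> B then 1 else if k \<in> C then -1 else 0)"
    and g: "\<And>a b. X a b \<in> K \<Longrightarrow> g (X a b) q = exchange_row n a b s q"
  shows "update_row f K g q = (if q \<in> K then - f q
    else f q + (\<Sum>k\<in>B. case k of X a b \<Rightarrow> of_nat (exchange_pos n a b s q) | Y _ \<Rightarrow> 0)
             - (\<Sum>k\<in>C. case k of X a b \<Rightarrow> of_nat (exchange_neg n a b s q) | Y _ \<Rightarrow> 0))"
proof -
  have "(\<Sum>k\<in>K. mutation_term (f k) (g k q)) = (\<Sum>k\<in>B. max (g k q) 0) + (\<Sum>k\<in>C. min (g k q) 0)"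
    by (rule mutation_term_sum) (use finite_layer K B f in auto)
  also have "(\<Sum>k\<in>B. max (g k q) 0) = (\<Sum>k\<in>B. case k of X a b \<Rightarrow> of_nat (exchange_pos n a b s q) | Y _ \<Rightarrow> 0)"
  proof (rule sum.cong[OF refl])
    fix k assume k: "k \<in> B"
    then have "k \<in> layer n m" using B K by auto
    then obtain a b where ab: "k = X a b" "1 \<le> a" "1 \<le> b" by (rule layerE) auto
    then show "max (g k q) 0 = (case k of X a b \<Rightarrow> of_nat (exchange_pos n a b s q) | Y _ \<Rightarrow> 0)"
      using g[of a b] k B exchange_row_parts(1)[of a b] by auto
  qed
  also have "(\<Sum>k\<in>C. min (g k q) 0) = - (\<Sum>k\<in>C. case k of X a b \<Rightarrow> of_nat (exchange_neg n a b s q) | Y _ \<Rightarrow> 0)"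
    unfolding sum_negf[symmetric]
  proof (rule sum.cong[OF refl])
    fix k assume k: "k \<in> C"
    then have "k \<in> layer n m" using B K by auto
    then obtain a b where ab: "k = X a b" "1 \<le> a" "1 \<le> b" by (rule layerE) auto
    then show "min (g k q) 0 = - (case k of X a b \<Rightarrow> of_nat (exchange_neg n a b s q) | Y _ \<Rightarrow> 0)"
      using g[of a b] k B exchange_row_parts(2)[of a b] by auto
  qed
  finally show ?thesis by (simp add: update_row_def)
qed

text \<open>Each entry of the row in layer m brings in one monomial of the exchange relation at that
  neighbour. After cancellation the hexagon has become the exchange row, while the entries in layer
  m have changed sign.\<close>

lemma update_row_above:
  assumes m: "1 \<le> m" "m + 1 < n" and ij: "1 \<le> i" "1 \<le> j" "max i j = m + 1" and s: "m + s + 1 \<le> n"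
    and g: "\<And>a b. X a b \<in> layer n m \<Longrightarrow> g (X a b) q = exchange_row n a b s q"
  shows "update_row (flat_row n i j s) (layer n m) g q = exchange_row n i j s q"
proof -
  let ?K = "layer n m"
  have off: "exponent n a b t q = 0" if "q \<notin> ?K" "1 \<le> a" "1 \<le> b" "max a b = m" for a b t
    using that m in_layer[of a n b m] by (intro exponent_other) auto
  consider "j < i" | "i = j" | "i < j" by linarith
  then show ?thesis
  proof cases
    case 1
    \<comment> \<open>For j = 1 the neighbour (i - 1, 0) is virtual and is not mutated, so ?C is
      empty.\<close>
    let ?B = "{X (i - 1) j}" and ?C = "if j = 1 then {} else {X (i - 1) (j - 1)}"
    have i: "i = m + 1" using 1 ij by simp
    have flat: "flat_row n i j s k = of_bool (k = X (i - 1) j) - of_bool (k = X (i - 1) (j - 1))"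
      and exch: "exchange_row n i j s k = - (of_bool (k = X (i - 1) j) - of_bool (k = X (i - 1) (j - 1)))" if "k \<in> ?K" for k
    proof -
      note off = exponent_layer_above[OF that] exponent_layer_below[OF that]
      have "flat_row n i j s k = of_nat (exponent n (i - 1) j s k) - of_nat (exponent n (i - 1) (j - 1) s k)"
        using i 1 ij unfolding flat_row_def by (simp add: off)
      then show "flat_row n i j s k = of_bool (k = X (i - 1) j) - of_bool (k = X (i - 1) (j - 1))" by (simp add: exponent_layer[OF that])
      have "exchange_row n i j s k = of_nat (exponent n (i - 1) (j - 1) (s + 1) k) - of_nat (exponent n (i - 1) j (s + 1) k)"
        using i 1 ij unfolding exchange_row_def exchange_pos_def exchange_neg_def by (simp add: off)
      then show "exchange_row n i j s k = - (of_bool (k = X (i - 1) j) - of_bool (k = X (i - 1) (j - 1)))" by (simp add: exponent_layer[OF that])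
    qed
    have f: "flat_row n i j s k = (if k \<in> ?B then 1 else if k \<in> ?C then -1 else 0)" if "k \<in> ?K" for k
    proof -
      have "k \<noteq> X (i - 1) 0" "X (i - 1) j \<noteq> X (i - 1) (j - 1)" using that ij by (auto simp: layer_def)
      then show ?thesis unfolding flat[OF that] by (cases "j = 1") auto
    qed
    have "update_row (flat_row n i j s) ?K g q = (if q \<in> ?K then - flat_row n i j s q
      else flat_row n i j s q + (\<Sum>k\<in>?B. case k of X a b \<Rightarrow> of_nat (exchange_pos n a b s q) | Y _ \<Rightarrow> 0)
             - (\<Sum>k\<in>?C. case k of X a b \<Rightarrow> of_nat (exchange_neg n a b s q) | Y _ \<Rightarrow> 0))"
      by (rule update_row_parts[OF refl]) (use f g i 1 ij m in \<open>auto simp: in_layer\<close>)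
    also have "\<dots> = exchange_row n i j s q"
    proof (cases "q \<in> ?K")
      case True
      show ?thesis unfolding if_P[OF True] flat[OF True] exch[OF True] ..
    next
      case False
      have z: "exponent n (i - 1) j t q = 0" for t using off[OF False, of "i - 1" j] i 1 ij m by simp
      have "j = 1 \<or> (\<forall>t. exponent n (i - 1) (j - 1) t q = 0)" using off[OF False, of "i - 1" "j - 1"] i 1 ij m by auto
      \<comment> \<open>Replaces the missing mutation at the virtual neighbour when j = 1.\<close>
      moreover have "exponent n (i - 1) 0 s q + exponent n (i - 1) 0 (s + 1) q =
          exponent n (i - 1 - 1) 0 (s + 1) q + exponent n (i - 1 + 1) 0 s q"
        by (rule exponent_exchange_column) (use i s m in auto)
      then have "(of_nat (exponent n (i - 1) 0 s q) + of_nat (exponent n (i - 1) 0 (s + 1) q) :: rat) =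
          of_nat (exponent n (i - 1 - 1) 0 (s + 1) q) + of_nat (exponent n (i - 1 + 1) 0 s q)"
        by (metis of_nat_add)
      moreover have "i - 1 + 1 = i" "j - 1 + 1 = j" using ij by auto
      ultimately show ?thesis
        using False 1 ij i z
        by (cases "j = 1") (auto simp: flat_row_def exchange_row_def exchange_pos_def exchange_neg_def)
    qed
    finally show ?thesis .
  next
    case 2
    let ?C = "{X (i - 1) (i - 1)}"
    have i: "i = m + 1" using 2 ij by simp
    have flat: "flat_row n i j s k = - of_bool (k = X (i - 1) (i - 1))"
      and exch: "exchange_row n i j s k = - (- of_bool (k = X (i - 1) (i - 1)))" if "k \<in> ?K" for k
    proof -
      note off = exponent_layer_above[OF that] exponent_layer_below[OF that]
      have "flat_row n i j s k = - of_nat (exponent n (i - 1) (i - 1) s k)"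
        using i 2 ij unfolding flat_row_def by (simp add: off)
      then show "flat_row n i j s k = - of_bool (k = X (i - 1) (i - 1))" by (simp add: exponent_layer[OF that])
      have "exchange_row n i j s k = of_nat (exponent n (i - 1) (i - 1) (s + 1) k)"
        using i 2 ij unfolding exchange_row_def exchange_pos_def exchange_neg_def by (simp add: off)
      then show "exchange_row n i j s k = - (- of_bool (k = X (i - 1) (i - 1)))" by (simp add: exponent_layer[OF that])
    qed
    have f: "flat_row n i j s k = (if k \<in> {} then 1 else if k \<in> ?C then -1 else 0)" if "k \<in> ?K" for k
    proof -
      show ?thesis unfolding flat[OF that] by simp
    qed
    have "update_row (flat_row n i j s) ?K g q = (if q \<in> ?K then - flat_row n i j s q
      else flat_row n i j s q + (\<Sum>k\<in>{}. case k of X a b \<Rightarrow> of_nat (exchange_pos n a b s q) | Y _ \<Rightarrow> 0)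
             - (\<Sum>k\<in>?C. case k of X a b \<Rightarrow> of_nat (exchange_neg n a b s q) | Y _ \<Rightarrow> 0))"
      by (rule update_row_parts[OF refl]) (use f g i 2 ij m in \<open>auto simp: in_layer\<close>)
    also have "\<dots> = exchange_row n i j s q"
    proof (cases "q \<in> ?K")
      case True
      show ?thesis unfolding if_P[OF True] flat[OF True] exch[OF True] ..
    next
      case False
      have z: "exponent n (i - 1) (i - 1) t q = 0" for t using off[OF False, of "i - 1" "i - 1"] i m by simp
      have "i - 1 + 1 = i" using ij by auto
      then show ?thesis
        using False 2 ij i z
        by (auto simp: flat_row_def exchange_row_def exchange_pos_def exchange_neg_def)
    qed
    finally show ?thesis .
  next
    case 3
    let ?B = "{X i (j - 1)}" and ?C = "if i = 1 then {} else {X (i - 1) (j - 1)}"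
    have j: "j = m + 1" using 3 ij by simp
    have flat: "flat_row n i j s k = of_bool (k = X i (j - 1)) - of_bool (k = X (i - 1) (j - 1))"
      and exch: "exchange_row n i j s k = - (of_bool (k = X i (j - 1)) - of_bool (k = X (i - 1) (j - 1)))" if "k \<in> ?K" for k
    proof -
      note off = exponent_layer_above[OF that] exponent_layer_below[OF that]
      have "flat_row n i j s k = of_nat (exponent n i (j - 1) s k) - of_nat (exponent n (i - 1) (j - 1) s k)"
        using j 3 ij unfolding flat_row_def by (simp add: off)
      then show "flat_row n i j s k = of_bool (k = X i (j - 1)) - of_bool (k = X (i - 1) (j - 1))" by (simp add: exponent_layer[OF that])
      have "exchange_row n i j s k = of_nat (exponent n (i - 1) (j - 1) (s + 1) k) - of_nat (exponent n i (j - 1) (s + 1) k)"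
        using j 3 ij unfolding exchange_row_def exchange_pos_def exchange_neg_def by (simp add: off)
      then show "exchange_row n i j s k = - (of_bool (k = X i (j - 1)) - of_bool (k = X (i - 1) (j - 1)))" by (simp add: exponent_layer[OF that])
    qed
    have f: "flat_row n i j s k = (if k \<in> ?B then 1 else if k \<in> ?C then -1 else 0)" if "k \<in> ?K" for k
    proof -
      have "k \<noteq> X 0 (j - 1)" "X i (j - 1) \<noteq> X (i - 1) (j - 1)" using that ij by (auto simp: layer_def)
      then show ?thesis unfolding flat[OF that] by (cases "i = 1") auto
    qed
    have "update_row (flat_row n i j s) ?K g q = (if q \<in> ?K then - flat_row n i j s q
      else flat_row n i j s q + (\<Sum>k\<in>?B. case k of X a b \<Rightarrow> of_nat (exchange_pos n a b s q) | Y _ \<Rightarrow> 0)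
             - (\<Sum>k\<in>?C. case k of X a b \<Rightarrow> of_nat (exchange_neg n a b s q) | Y _ \<Rightarrow> 0))"
      by (rule update_row_parts[OF refl]) (use f g j 3 ij m in \<open>auto simp: in_layer\<close>)
    also have "\<dots> = exchange_row n i j s q"
    proof (cases "q \<in> ?K")
      case True
      show ?thesis unfolding if_P[OF True] flat[OF True] exch[OF True] ..
    next
      case False
      have z: "exponent n i (j - 1) t q = 0" for t using off[OF False, of i "j - 1"] j 3 ij m by simp
      have "i = 1 \<or> (\<forall>t. exponent n (i - 1) (j - 1) t q = 0)" using off[OF False, of "i - 1" "j - 1"] j 3 ij m by auto
      moreover have "exponent n 0 (j - 1) s q + exponent n 0 (j - 1) (s + 1) q =
          exponent n 0 (j - 1 - 1) (s + 1) q + exponent n 0 (j - 1 + 1) s q"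
        by (rule exponent_exchange_row) (use j m in auto)
      then have "(of_nat (exponent n 0 (j - 1) s q) + of_nat (exponent n 0 (j - 1) (s + 1) q) :: rat) =
          of_nat (exponent n 0 (j - 1 - 1) (s + 1) q) + of_nat (exponent n 0 (j - 1 + 1) s q)"
        by (metis of_nat_add)
      moreover have "i - 1 + 1 = i" "j - 1 + 1 = j" using ij by auto
      ultimately show ?thesis
        using False 3 ij j z
        by (cases "i = 1") (auto simp: flat_row_def exchange_row_def exchange_pos_def exchange_neg_def)
    qed
    finally show ?thesis .
  qed
qed

text \<open>The counterpart for the layer mutated just before: its negated exchange row becomes a
  hexagon again, now at time s + 1. On the diagonal two entries in layer m are positive, elsewhere
  one.\<close>

lemma update_row_below:
  assumes m: "m < n" and ij: "1 \<le> i" "1 \<le> j" "max i j + 1 = m"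
    and g: "\<And>a b. X a b \<in> layer n m \<Longrightarrow> g (X a b) q = exchange_row n a b s q"
  shows "update_row (\<lambda>q. - exchange_row n i j s q) (layer n m) g q = flat_row n i j (s + 1) q"
proof -
  let ?K = "layer n m"
  have off: "exponent n a b t q = 0" if "q \<notin> ?K" "1 \<le> a" "1 \<le> b" "max a b = m" for a b t
    using that m in_layer[of a n b m] by (intro exponent_other) auto
  define B where "B = (if j < i then {X (i + 1) j} else if i = j then {X i (i + 1), X (i + 1) i} else {X i (j + 1)})"
  let ?C = "{X (i + 1) (j + 1)}"
  have on: "exchange_row n i j s k = of_bool (k \<in> ?C) - of_bool (k \<in> B) \<and>
      flat_row n i j (s + 1) k = of_bool (k \<in> ?C) - of_bool (k \<in> B)" if "k \<in> ?K" for k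
  proof -
    note off = exponent_layer_above[OF that] exponent_layer_below[OF that]
    consider "j < i" "i + 1 = m" | "i = j" "i + 1 = m" | "i < j" "j + 1 = m" using ij(3) by linarith
    then show ?thesis
    proof cases
      case 1
      have "flat_row n i j (s + 1) k = of_nat (exponent n (i + 1) (j + 1) (s + 1) k) - of_nat (exponent n (i + 1) j (s + 1) k)"
        using 1 ij unfolding flat_row_def by (simp add: off)
      moreover have "exchange_row n i j s k = of_nat (exponent n (i + 1) (j + 1) s k) - of_nat (exponent n (i + 1) j s k)"
        using 1 ij unfolding exchange_row_def exchange_pos_def exchange_neg_def by (simp add: off)
      ultimately show ?thesis using 1 by (simp add: exponent_layer[OF that] B_def)
    next
      case 2
      have "flat_row n i j (s + 1) k = of_nat (exponent n (i + 1) (j + 1) (s + 1) k) - of_nat (exponent n i (i + 1) (s + 1) k) - of_nat (exponent n (i + 1) i (s + 1) k)"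
        using 2 ij unfolding flat_row_def by (simp add: off)
      moreover have "exchange_row n i j s k = of_nat (exponent n (i + 1) (j + 1) s k) - of_nat (exponent n i (i + 1) s k) - of_nat (exponent n (i + 1) i s k)"
        using 2 ij unfolding exchange_row_def exchange_pos_def exchange_neg_def by (simp add: off)
      ultimately show ?thesis using 2 by (simp add: exponent_layer[OF that] B_def)
    next
      case 3
      have "flat_row n i j (s + 1) k = of_nat (exponent n (i + 1) (j + 1) (s + 1) k) - of_nat (exponent n i (j + 1) (s + 1) k)"
        using 3 ij unfolding flat_row_def by (simp add: off)
      moreover have "exchange_row n i j s k = of_nat (exponent n (i + 1) (j + 1) s k) - of_nat (exponent n i (j + 1) s k)"
        using 3 ij unfolding exchange_row_def exchange_pos_def exchange_neg_def by (simp add: off)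
      ultimately show ?thesis using 3 by (simp add: exponent_layer[OF that] B_def)
    qed
  qed
  have f: "- exchange_row n i j s k = (if k \<in> B then 1 else if k \<in> ?C then -1 else 0)" if "k \<in> ?K" for k
    using on[OF that] by (auto simp: B_def split: if_splits)
  have "update_row (\<lambda>q. - exchange_row n i j s q) ?K g q = (if q \<in> ?K then - (- exchange_row n i j s q)
      else - exchange_row n i j s q + (\<Sum>k\<in>B. case k of X a b \<Rightarrow> of_nat (exchange_pos n a b s q) | Y _ \<Rightarrow> 0)
             - (\<Sum>k\<in>?C. case k of X a b \<Rightarrow> of_nat (exchange_neg n a b s q) | Y _ \<Rightarrow> 0))"
    by (rule update_row_parts[OF refl]) (use f g ij m in \<open>auto simp: in_layer B_def\<close>)
  also have "\<dots> = flat_row n i j (s + 1) q"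
  proof (cases "q \<in> ?K")
    case True
    show ?thesis unfolding if_P[OF True] using on[OF True] by simp
  next
    case False
    have z: "exponent n (i + 1) (j + 1) t q = 0" "j < i \<longrightarrow> exponent n (i + 1) j t q = 0"
      "i < j \<longrightarrow> exponent n i (j + 1) t q = 0" "i = j \<longrightarrow> exponent n i (i + 1) t q = 0 \<and> exponent n (i + 1) i t q = 0" for t
      using off[OF False] ij by auto
    consider "j < i" | "i = j" | "i < j" by linarith
    then show ?thesis
      by cases (use False z ij in \<open>auto simp: B_def flat_row_def exchange_row_def exchange_pos_def exchange_neg_def\<close>)
  qed
  finally show ?thesis .
qed

text \<open>There is no layer 0 to be mutated: at (1, 1) the three virtual neighbours of the hexagon
  already combine to the single one in the exchange row.\<close>

lemma flat_row_first:
  assumes "s + 1 \<le> n"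
  shows "flat_row n 1 1 s q = exchange_row n 1 1 s q"
  using assms by (auto simp: flat_row_def exchange_row_def exchange_pos_def exchange_neg_def exponent_def)

lemma flat_row_far:
  assumes k: "k \<in> layer n m" and ij: "1 \<le> i" "1 \<le> j" "m + 1 < max i j \<or> max i j + 1 < m"
  shows "flat_row n i j t k = 0"
proof -
  consider "m + 1 < i" "j \<le> i" | "m + 1 < j" "i < j" | "i + 1 < m" "j + 1 < m" using ij(3) by linarith
  then show ?thesis
    by cases (use ij in \<open>simp_all add: flat_row_def exponent_layer_above[OF k] exponent_layer_below[OF k] less_diff_conv\<close>)
qed

lemma update_row_far: "(\<And>k. k \<in> K \<Longrightarrow> f k = 0) \<Longrightarrow> update_row f K g q = f q"
  by (auto simp: update_row_def)

section \<open>The rows of the initial exchange matrix\<close>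

lemma solid_arrows_out:
  assumes "1 \<le> i" "i < n" "1 \<le> j" "j < n"
  shows "(X i j, q) \<in> solid_arrows n \<longleftrightarrow>
    q = X (i - 1) j \<or> (if j = 1 then q = Y (n - i) else q = X i (j - 1)) \<or> q = X (i + 1) (j + 1)"
  using assms by (auto simp: solid_arrows_def)

lemma solid_arrows_in:
  assumes "1 \<le> i" "i < n" "1 \<le> j" "j < n"
  shows "(q, X i j) \<in> solid_arrows n \<longleftrightarrow>
    q = X (i + 1) j \<or> q = X i (j + 1) \<or> (if j = 1 then 2 \<le> i \<and> q = Y (n - i + 1) else q = X (i - 1) (j - 1))"
proof -
  obtain i' j' where ij: "i = Suc i'" "j = Suc j'" using assms by (metis One_nat_def Suc_le_D)
  show ?thesis
  proof (cases "j' = 0")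
    case True
    then show ?thesis using assms unfolding ij by (cases q) (auto simp: solid_arrows_def One_nat_def)
  next
    case False
    then show ?thesis using assms unfolding ij by (cases q) (auto simp: solid_arrows_def One_nat_def)
  qed
qed

text \<open>The quiver of the seed is hexagonal at these vertices. For i = 1 the variable
  \<open>Y n\<close> of the virtual neighbours (0, j) and (0, j - 1) cancels, and the weight 2 of an
  arrow between white and black is the exponent of the black vertex.\<close>

lemma initial_matrix_flat:
  assumes "1 \<le> i" "i < n" "1 \<le> j" "j < n"
  shows "initial_matrix n (X i j) q = flat_row n i j 0 q"
proof -
  obtain i' j' where ij: "i = Suc i'" "j = Suc j'" using assms by (metis One_nat_def Suc_le_D)
  let ?w = "if black n q then 2 else 1 :: rat"
  have "(X i j, q) \<notin> dotted_arrows n" "(q, X i j) \<notin> dotted_arrows n"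
    using assms by (auto simp: dotted_arrows_def)
  moreover have "\<not> black n (X i j)" using assms by (simp add: black_def)
  ultimately have L: "initial_matrix n (X i j) q = (if (X i j, q) \<in> solid_arrows n then ?w
      else if (q, X i j) \<in> solid_arrows n then - ?w else 0)"
    by (simp add: initial_matrix_def arrow_weight_def)
  have Y: "n - i' = n - Suc i' + 1" using assms ij by simp
  show ?thesis
  proof (cases "j = 1")
    case False
    have L': "initial_matrix n (X i j) q =
      (if q = X (i - 1) j \<or> q = X i (j - 1) \<or> q = X (i + 1) (j + 1) then ?w
       else if q = X (i + 1) j \<or> q = X i (j + 1) \<or> q = X (i - 1) (j - 1) then - ?w else 0)"
      unfolding L solid_arrows_out[OF assms] solid_arrows_in[OF assms] if_not_P[OF False] ..
    consider "q = X (i - 1) j" | "q = X i (j - 1)" | "q = X (i + 1) (j + 1)" | "q = X (i + 1) j" | "q = X i (j + 1)"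
      | "q = X (i - 1) (j - 1)" | "q \<noteq> X (i - 1) j" "q \<noteq> X i (j - 1)" "q \<noteq> X (i + 1) (j + 1)"
        "q \<noteq> X (i + 1) j" "q \<noteq> X i (j + 1)" "q \<noteq> X (i - 1) (j - 1)" by blast
    then show ?thesis
    proof cases
      case 1 then show ?thesis unfolding L' using assms False
        by (cases "i = 1") (simp_all add: flat_row_def exponent_def black_def ij One_nat_def)
    next
      case 2 then show ?thesis unfolding L' using assms False
        by (cases "i = 1") (simp_all add: flat_row_def exponent_def black_def ij One_nat_def)
    next
      case 3 then show ?thesis unfolding L' using assms False
        by (cases "i = 1") (simp_all add: flat_row_def exponent_def black_def ij One_nat_def)
    next
      case 4 then show ?thesis unfolding L' using assms False
        by (cases "i = 1") (simp_all add: flat_row_def exponent_def black_def ij One_nat_def)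
    next
      case 5 then show ?thesis unfolding L' using assms False
        by (cases "i = 1") (simp_all add: flat_row_def exponent_def black_def ij One_nat_def)
    next
      case 6 then show ?thesis unfolding L' using assms False
        by (cases "i = 1") (simp_all add: flat_row_def exponent_def black_def ij One_nat_def)
    next
      case 7 then show ?thesis unfolding L' using assms False
        by (cases "i = 1") (simp_all add: flat_row_def exponent_def black_def ij One_nat_def)
    qed
  next
    case True
    have L': "initial_matrix n (X i j) q =
      (if q = X (i - 1) 1 \<or> q = Y (n - i) \<or> q = X (i + 1) 2 then ?w
       else if q = X (i + 1) 1 \<or> q = X i 2 \<or> 2 \<le> i \<and> q = Y (n - i + 1) then - ?w else 0)"
      unfolding L solid_arrows_out[OF assms] solid_arrows_in[OF assms] using True by simp
    consider "q = X (i - 1) 1" | "q = Y (n - i)" | "q = X (i + 1) 2" | "q = X (i + 1) 1" | "q = X i 2"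
      | "q = Y (n - i + 1)" | "q \<noteq> X (i - 1) 1" "q \<noteq> Y (n - i)" "q \<noteq> X (i + 1) 2"
        "q \<noteq> X (i + 1) 1" "q \<noteq> X i 2" "q \<noteq> Y (n - i + 1)" by blast
    then show ?thesis
    proof cases
      case 1 then show ?thesis unfolding L' using assms True
        by (cases "i = 1") (simp_all add: flat_row_def exponent_def black_def ij Y One_nat_def numeral_2_eq_2)
    next
      case 2 then show ?thesis unfolding L' using assms True
        by (cases "i = 1") (simp_all add: flat_row_def exponent_def black_def ij Y One_nat_def numeral_2_eq_2)
    next
      case 3 then show ?thesis unfolding L' using assms True
        by (cases "i = 1") (simp_all add: flat_row_def exponent_def black_def ij Y One_nat_def numeral_2_eq_2)
    next
      case 4 then show ?thesis unfolding L' using assms True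
        by (cases "i = 1") (simp_all add: flat_row_def exponent_def black_def ij Y One_nat_def numeral_2_eq_2)
    next
      case 5 then show ?thesis unfolding L' using assms True
        by (cases "i = 1") (simp_all add: flat_row_def exponent_def black_def ij Y One_nat_def numeral_2_eq_2)
    next
      case 6 then show ?thesis unfolding L' using assms True
        by (cases "i = 1") (simp_all add: flat_row_def exponent_def black_def ij Y One_nat_def numeral_2_eq_2)
    next
      case 7 then show ?thesis unfolding L' using assms True
        by (cases "i = 1") (simp_all add: flat_row_def exponent_def black_def ij Y One_nat_def numeral_2_eq_2)
    qed
  qed
qed

section \<open>The functions attached to the vertices\<close>

text \<open>One formula for both cases of the theorem: the truncated differences j - i and i - j
  each vanish on one side of the diagonal. The larger of the two U indices always comes
  first.\<close>

definition vertex_function :: "nat \<Rightarrow> nat \<Rightarrow> nat \<Rightarrow> nat \<Rightarrow> point \<Rightarrow> complex" where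
  "vertex_function n i j t p =
     quad_ordered n (flag_form n (component 0 p)) (flag_form n (component 1 p)) (flag_form n (component 2 p))
       (NN n - t - (j - i)) (n - i - t) (n + 1 + t + (i - j)) (j + t)"

lemma vertex_function_eq:
  assumes "a + t + (j - i) = NN n" "b + i + t = n" "c = n + 1 + t + (i - j)" "d = j + t"
  shows "vertex_function n i j t p =
    quad_ordered n (flag_form n (component 0 p)) (flag_form n (component 1 p)) (flag_form n (component 2 p)) a b c d"
proof -
  have "NN n - t - (j - i) = a" "n - i - t = b" using assms(1,2) by arith+
  then show ?thesis by (simp only: vertex_function_def assms(3,4))
qed

lemma flag_facts:
  assumes "p \<in> spin3 n"
  shows "supported (NN n) (so_column n (component m p))" "self_dual (NN n) (so_column n (component m p))"
    "wedge_list (initial (so_column n (component m p)) (NN n)) {1..NN n} = 1"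
proof -
  interpret quadratic_space n "NN n" by unfold_locales simp
  show "supported (NN n) (so_column n (component m p))" "self_dual (NN n) (so_column n (component m p))"
    "wedge_list (initial (so_column n (component m p)) (NN n)) {1..NN n} = 1"
    using spin_flag[OF component_spin[OF assms]] by auto
qed

text \<open>An instance of \<open>octahedron\<close>. Only the identification of the neighbours with
  pairs of raised indices depends on the position relative to the diagonal.\<close>

lemma vertex_function_exchange:
  assumes p: "p \<in> spin3 n" and ij: "1 \<le> i" "1 \<le> j" and t: "max i j + t + 1 \<le> n"
  defines "F \<equiv> \<lambda>i j t. vertex_function n i j t p"
  shows "F i j t * F i j (t + 1) = F (i - 1) (j - 1) (t + 1) * F (i + 1) (j + 1) t +
    (if j < i then F (i - 1) j (t + 1) * F (i + 1) j t
     else if i = j then F i (j + 1) t * F (i + 1) j t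
     else F i (j - 1) (t + 1) * F i (j + 1) t)"
proof -
  \<comment> \<open>\<open>octahedron\<close> is stated at the lowest values of the four indices.
    Time lowers the two U indices and raises the other two, so only a and b are diminished by
    1.\<close>
  define a where "a = NN n - t - (j - i) - 1"
  define b where "b = n - i - t - 1"
  define c where "c = n + 1 + t + (i - j)"
  define d where "d = j + t"
  have a: "Suc a + t + (j - i) = NN n" and b: "Suc b + i + t = n" using t ij by (auto simp: a_def b_def)
  let ?Q = "quad_ordered n (flag_form n (component 0 p)) (flag_form n (component 1 p)) (flag_form n (component 2 p))"
  have oct: "?Q (Suc a) (Suc b) c d * ?Q a b (Suc c) (Suc d) =
    ?Q a (Suc b) c (Suc d) * ?Q (Suc a) b (Suc c) d + ?Q a (Suc b) (Suc c) d * ?Q (Suc a) b c (Suc d)"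
    unfolding flag_form_def
  proof (rule octahedron[OF flag_facts(1)[OF p] flag_facts(1)[OF p] flag_facts(1)[OF p]])
    show "a + b + c + d + 2 = 2 * NN n" using a b unfolding c_def d_def by arith
    show "a < NN n" "NN n \<le> a + c" using a b t unfolding c_def by arith+
  qed
  have 1: "F i j t = ?Q (Suc a) (Suc b) c d" unfolding F_def
    by (rule vertex_function_eq) (use a b c_def d_def in auto)
  have 2: "F i j (t + 1) = ?Q a b (Suc c) (Suc d)" unfolding F_def
    by (rule vertex_function_eq) (use a b c_def d_def in auto)
  have 3: "F (i - 1) (j - 1) (t + 1) = ?Q a (Suc b) (Suc c) d" unfolding F_def
    by (rule vertex_function_eq; use a b c_def d_def ij in arith)
  have 4: "F (i + 1) (j + 1) t = ?Q (Suc a) b c (Suc d)" unfolding F_def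
    by (rule vertex_function_eq) (use a b c_def d_def in auto)
  consider "j < i" | "i = j" | "i < j" by linarith
  then show ?thesis
  proof cases
    case c1: 1
    have 5: "F (i - 1) j (t + 1) = ?Q a (Suc b) c (Suc d)" unfolding F_def
      by (rule vertex_function_eq; use a b c_def d_def ij c1 in arith)
    have 6: "F (i + 1) j t = ?Q (Suc a) b (Suc c) d" unfolding F_def
      by (rule vertex_function_eq; use a b c_def d_def ij c1 in arith)
    show ?thesis using c1 oct by (simp add: 1 2 3 4 5 6)
  next
    case c2: 2
    have 5: "F i (j + 1) t = ?Q a (Suc b) c (Suc d)" unfolding F_def
      by (rule vertex_function_eq; use a b c_def d_def ij c2 in arith)
    have 6: "F (i + 1) j t = ?Q (Suc a) b (Suc c) d" unfolding F_def
      by (rule vertex_function_eq; use a b c_def d_def ij c2 in arith)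
    show ?thesis unfolding if_P[OF c2] using c2 oct unfolding 1 2 3 4 5 6 by simp
  next
    case c3: 3
    have 5: "F i (j + 1) t = ?Q a (Suc b) c (Suc d)" unfolding F_def
      by (rule vertex_function_eq; use a b c_def d_def ij c3 in arith)
    have 6: "F i (j - 1) (t + 1) = ?Q (Suc a) b (Suc c) d" unfolding F_def
      by (rule vertex_function_eq; use a b c_def d_def ij c3 in arith)
    show ?thesis using c3 oct by (simp add: 1 2 3 4 5 6)
  qed
qed

lemma triple_fun_component:
  "triple_fun n a b c p = triple n (flag_form n (component 0 p)) (flag_form n (component 1 p)) (flag_form n (component 2 p)) a b c"
  by (simp add: triple_fun_def component_def case_prod_unfold)

lemma quad_fun_component:
  "quad_fun n a b c d p = quad n (flag_form n (component 0 p)) (flag_form n (component 1 p)) (flag_form n (component 2 p)) a b c d"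
  by (simp add: quad_fun_def component_def case_prod_unfold)

lemma vertex_function_full:
  assumes p: "p \<in> spin3 n" and "j \<le> i" "i \<le> n"
  shows "vertex_function n i j 0 p = triple_fun n (n - i) (n + 1 + i - j) j p"
proof -
  have "vertex_function n i j 0 p = quad_ordered n (flag_form n (component 0 p)) (flag_form n (component 1 p))
      (flag_form n (component 2 p)) (NN n) (n - i) (n + 1 + i - j) j"
    by (rule vertex_function_eq) (use assms in auto)
  then show ?thesis
    unfolding triple_fun_component flag_form_def
    using quad_ordered_full[OF flag_facts(1)[OF p] flag_facts(1)[OF p] flag_facts(1)[OF p] _ flag_facts(3)[OF p]] assms
    by simp
qed

lemma vertex_function_end:
  assumes p: "p \<in> spin3 n" and "1 \<le> j" "j \<le> i" "i \<le> n"
  shows "vertex_function n i j (n - i) p = triple_fun n (n + i + 1) (2 * n + 1 - j) (n - i + j) p"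
proof -
  have "vertex_function n i j (n - i) p = quad_ordered n (flag_form n (component 0 p)) (flag_form n (component 1 p))
      (flag_form n (component 2 p)) (n + i + 1) 0 (2 * n + 1 - j) (n - i + j)"
    by (rule vertex_function_eq) (use assms in auto)
  also have "\<dots> = triple_fun n (n + i + 1) (2 * n + 1 - j) (n - i + j) p"
    unfolding triple_fun_component flag_form_def
    by (rule quad_ordered_0[OF flag_facts(1)[OF p] flag_facts(1)[OF p] flag_facts(1)[OF p]]) (use assms in auto)
  finally show ?thesis .
qed

text \<open>\<open>quad\<close> falls back on triples at t = 0, where one index is N, and at t = n -
  i, where one is 0; in between the ordering conditions select \<open>quad_ordered\<close>.\<close>

lemma quad_fun_lower:
  assumes p: "p \<in> spin3 n" and ij: "1 \<le> j" "j \<le> i" "i < n" and t: "t \<le> n - i"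
  shows "quad_fun n (2 * n + 1 - t) (n - i - t) (n + 1 + i - j + t) (j + t) p = vertex_function n i j t p"
proof -
  consider "t = 0" | "t = n - i" "t \<noteq> 0" | "t \<noteq> 0" "t \<noteq> n - i" by blast
  then show ?thesis
  proof cases
    case 1
    then show ?thesis using vertex_function_full[OF p] ij
      by (simp add: quad_fun_component quad_def triple_fun_component)
  next
    case 2
    have "quad_fun n (2 * n + 1 - t) (n - i - t) (n + 1 + i - j + t) (j + t) p =
        triple_fun n (2 * n + 1 - t) (n + 1 + i - j + t) (j + t) p"
      using 2 ij by (simp add: quad_fun_component quad_def triple_fun_component)
    also have "\<dots> = triple_fun n (n + i + 1) (2 * n + 1 - j) (n - i + j) p"
    proof -
      have e: "2 * n + 1 - t = n + i + 1" "n + 1 + i - j + t = 2 * n + 1 - j" "j + t = n - i + j"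
        using 2 ij by auto
      show ?thesis by (simp only: e)
    qed
    also have "\<dots> = vertex_function n i j t p"
      unfolding 2(1) by (rule vertex_function_end[OF p ij(1,2) less_imp_le[OF ij(3)], symmetric])
    finally show ?thesis .
  next
    case 3
    have "vertex_function n i j t p = quad_ordered n (flag_form n (component 0 p)) (flag_form n (component 1 p))
      (flag_form n (component 2 p)) (2 * n + 1 - t) (n - i - t) (n + 1 + i - j + t) (j + t)"
      by (rule vertex_function_eq) (use ij t in auto)
    moreover have "2 * n + 1 - t \<noteq> NN n" "n - i - t \<noteq> NN n" "n - i - t \<noteq> 0" "2 * n + 1 - t \<noteq> 0"
      "(2 * n + 1 - t) + (n - i - t) + (n + 1 + i - j + t) + (j + t) = 2 * NN n"
      "n - i - t \<le> NN n - (n + 1 + i - j + t)" "n - i - t \<le> NN n - (j + t)"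
      "NN n - (n + 1 + i - j + t) \<le> 2 * n + 1 - t" "NN n - (j + t) \<le> 2 * n + 1 - t"
      using 3 ij t by auto
    ultimately show ?thesis unfolding quad_fun_component quad_def by simp
  qed
qed

lemma quad_fun_upper:
  assumes p: "p \<in> spin3 n" and ij: "1 \<le> i" "i < j" "j \<le> n" and t: "t \<le> n - j"
  shows "quad_fun n (n - i - t) (2 * n + 1 + i - j - t) (n + 1 + t) (j + t) p = vertex_function n i j t p"
proof -
  have "vertex_function n i j t p = quad_ordered n (flag_form n (component 0 p)) (flag_form n (component 1 p))
      (flag_form n (component 2 p)) (2 * n + 1 + i - j - t) (n - i - t) (n + 1 + t) (j + t)"
    by (rule vertex_function_eq) (use ij t in auto)
  moreover have "n - i - t \<noteq> NN n" "2 * n + 1 + i - j - t \<noteq> NN n" "2 * n + 1 + i - j - t \<noteq> 0" "n - i - t \<noteq> 0"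
      "(n - i - t) + (2 * n + 1 + i - j - t) + (n + 1 + t) + (j + t) = 2 * NN n"
      "\<not> 2 * n + 1 + i - j - t \<le> NN n - (n + 1 + t)"
      "n - i - t \<le> NN n - (n + 1 + t)" "n - i - t \<le> NN n - (j + t)"
      "NN n - (n + 1 + t) \<le> 2 * n + 1 + i - j - t" "NN n - (j + t) \<le> 2 * n + 1 + i - j - t"
    using ij t by auto
  ultimately show ?thesis unfolding quad_fun_component quad_def by simp
qed

lemma vertex_function_factor:
  assumes p: "p \<in> spin3 n" and ij: "i = 0 \<or> j = 0" "i + t \<le> n" "j + t \<le> n"
  shows "vertex_function n i j t p =
    vol n (wedge (flag_form n (component 0 p) (n - i - t)) (flag_form n (component 1 p) (2 * n + 1 - (n - i - t)))) *
    vol n (wedge (flag_form n (component 0 p) (2 * n + 1 - (j + t))) (flag_form n (component 2 p) (j + t)))"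
proof -
  have "vertex_function n i j t p = quad_ordered n (flag_form n (component 0 p)) (flag_form n (component 1 p))
      (flag_form n (component 2 p)) (2 * n + 1 - (j + t)) (n - i - t) (2 * n + 1 - (n - i - t)) (j + t)"
    by (rule vertex_function_eq) (use ij in auto)
  then show ?thesis unfolding flag_form_def
    using quad_ordered_factor[OF flag_facts(1)[OF p] flag_facts(1)[OF p] flag_facts(1)[OF p]] ij by simp
qed

lemma regular_vertex_function:
  assumes "1 \<le> i" "1 \<le> j" "max i j + t \<le> n"
  shows "regular_fun n (vertex_function n i j t)"
  unfolding vertex_function_def by (rule regular_quad_ordered) (use assms in auto)

lemma generic_vertex_functions:
  obtains p where "p \<in> spin3 n" "\<And>i j t. 1 \<le> i \<Longrightarrow> 1 \<le> j \<Longrightarrow> max i j + t \<le> n \<Longrightarrow> vertex_function n i j t p \<noteq> 0"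
proof -
  interpret quadratic_space n "NN n" by unfold_locales simp
  obtain p where p: "p \<in> spin3 n"
    "\<And>a b c d. a + b + c + d = 2 * NN n \<Longrightarrow> a \<le> NN n \<Longrightarrow> b + c \<le> NN n \<Longrightarrow> NN n \<le> a + c \<Longrightarrow> d \<le> NN n \<Longrightarrow>
      quad_ordered n (flag_form n (component 0 p)) (flag_form n (component 1 p)) (flag_form n (component 2 p)) a b c d \<noteq> 0"
    by (rule generic_point) (rule that; assumption)
  show thesis
  proof (rule that[OF p(1)])
    fix i j t assume "1 \<le> i" "1 \<le> j" "max i j + t \<le> n"
    then show "vertex_function n i j t p \<noteq> 0"
      unfolding vertex_function_def by (intro p(2)) (cases "j \<le> i", auto)+
  qed
qed

section \<open>Exchange monomials\<close>

definition monomial :: "nat \<Rightarrow> (vertex \<Rightarrow> point \<Rightarrow> complex) \<Rightarrow> point \<Rightarrow> (vertex \<Rightarrow> nat) \<Rightarrow> complex" where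
  "monomial n A p e = (\<Prod>v\<in>vertices n. A v p ^ e v)"

lemma finite_vertices: "finite (vertices n)"
proof -
  have "vertices n \<subseteq> (\<lambda>(i, j). X i j) ` ({0..n} \<times> {1..n}) \<union> Y ` {1..n}" by (auto simp: vertices_def)
  then show ?thesis by (rule finite_subset) auto
qed

lemma monomial_add: "monomial n A p (\<lambda>v. e v + f v) = monomial n A p e * monomial n A p f"
  by (simp add: monomial_def power_add prod.distrib)

lemma monomial_single:
  "monomial n A p (\<lambda>v. if v = w then k else 0) = (if w \<in> vertices n then A w p ^ k else 1)"
proof -
  have "monomial n A p (\<lambda>v. if v = w then k else 0) = (\<Prod>v\<in>vertices n. if v = w then A v p ^ k else 1)"
    unfolding monomial_def by (rule prod.cong) auto
  then show ?thesis by (simp add: finite_vertices)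
qed

text \<open>Since the two monomials share no variable, the positive and the negative part of the row
  are exactly their exponents.\<close>

lemma mutate_fun_exchange:
  assumes b: "\<And>q. b k q = exchange_row n i j t q" and ij: "1 \<le> i" "1 \<le> j"
  shows "mutate_fun n k b A p =
    (monomial n A p (exchange_pos n i j t) + monomial n A p (exchange_neg n i j t)) / A k p"
proof -
  note disj = exchange_disjoint[OF ij, of n t]
  have "(\<Prod>q\<in>{q \<in> vertices n. b k q > 0}. A q p ^ nat \<lfloor>b k q\<rfloor>) = monomial n A p (exchange_pos n i j t)"
    unfolding monomial_def
  proof (rule prod.mono_neutral_cong_left)
    show "\<forall>q\<in>vertices n - {q \<in> vertices n. b k q > 0}. A q p ^ exchange_pos n i j t q = 1"
    proof
      fix q assume "q \<in> vertices n - {q \<in> vertices n. b k q > 0}"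
      then have "exchange_pos n i j t q = 0" using disj[of q] by (auto simp: b exchange_row_def)
      then show "A q p ^ exchange_pos n i j t q = 1" by simp
    qed
    fix q assume "q \<in> {q \<in> vertices n. b k q > 0}"
    then have "b k q = of_nat (exchange_pos n i j t q)" using disj[of q] by (auto simp: b exchange_row_def)
    then show "A q p ^ nat \<lfloor>b k q\<rfloor> = A q p ^ exchange_pos n i j t q" by simp
  qed (auto simp: finite_vertices)
  moreover have "(\<Prod>q\<in>{q \<in> vertices n. b k q < 0}. A q p ^ nat \<lfloor>- b k q\<rfloor>) = monomial n A p (exchange_neg n i j t)"
    unfolding monomial_def
  proof (rule prod.mono_neutral_cong_left)
    show "\<forall>q\<in>vertices n - {q \<in> vertices n. b k q < 0}. A q p ^ exchange_neg n i j t q = 1"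
    proof
      fix q assume "q \<in> vertices n - {q \<in> vertices n. b k q < 0}"
      then have "exchange_neg n i j t q = 0" using disj[of q] by (auto simp: b exchange_row_def)
      then show "A q p ^ exchange_neg n i j t q = 1" by simp
    qed
    fix q assume "q \<in> {q \<in> vertices n. b k q < 0}"
    then have "- b k q = of_nat (exchange_neg n i j t q)" using disj[of q] by (auto simp: b exchange_row_def)
    then show "A q p ^ nat \<lfloor>- b k q\<rfloor> = A q p ^ exchange_neg n i j t q" by simp
  qed (auto simp: finite_vertices)
  ultimately show ?thesis by (simp add: mutate_fun_def)
qed

definition unfrozen_agree :: "nat \<Rightarrow> point \<Rightarrow> (vertex \<Rightarrow> point \<Rightarrow> complex) \<Rightarrow> (vertex \<Rightarrow> point \<Rightarrow> complex) \<Rightarrow> bool" where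
  "unfrozen_agree n p A A' \<longleftrightarrow> (\<forall>v. (\<forall>i j. v = X i j \<longrightarrow> \<not> (1 \<le> i \<and> i < n \<and> 1 \<le> j \<and> j < n)) \<longrightarrow> A' v p = A v p)"

text \<open>With the point fixed, the functions of a seed become numbers and mutation becomes a
  computation with them.\<close>

locale seed_point =
  fixes n :: nat and A :: "vertex \<Rightarrow> point \<Rightarrow> complex" and p :: point
  assumes n_pos: "1 \<le> n" and seed: "initial_functions n A" and p: "p \<in> spin3 n"
begin

abbreviation "F \<equiv> \<lambda>i j t. vertex_function n i j t p"

lemma white_value: "v \<in> vertices n \<Longrightarrow> \<not> black n v \<Longrightarrow> A v p = base_fun n v p"
  using seed p unfolding initial_functions_def by auto

lemma black_value: "v \<in> vertices n \<Longrightarrow> black n v \<Longrightarrow> A v p ^ 2 = base_fun n v p"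
  using seed p unfolding initial_functions_def is_sqrt_fun_def by auto

lemma base_function:
  assumes "1 \<le> i" "i \<le> n" "1 \<le> j" "j \<le> n"
  shows "base_fun n (X i j) p = F i j 0"
proof (cases "j \<le> i")
  case True
  then show ?thesis using vertex_function_full[OF p True] assms by (simp add: base_fun_def)
next
  case False
  then show ?thesis using quad_fun_upper[OF p, of i j 0] assms by (simp add: base_fun_def)
qed

lemma initial_value:
  assumes "1 \<le> i" "i \<le> n" "1 \<le> j" "j < n"
  shows "A (X i j) p = F i j 0"
  using white_value[of "X i j"] base_function[of i j] assms by (simp add: vertices_def black_def)

lemma volume_zero: "vol n (wedge (flag_form n (component m p) (2 * n + 1)) (flag_form n (component m' p) 0)) = 1"
  "vol n (wedge (flag_form n (component m' p) 0) (flag_form n (component m p) (2 * n + 1))) = 1"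
proof -
  let ?u = "so_column n (component m p)" and ?v = "so_column n (component m' p)"
  have "wedge_list (initial ?u (NN n)) {1..NN n} = 1" by (rule flag_facts(3)[OF p])
  then show "vol n (wedge (flag_form n (component m p) (2 * n + 1)) (flag_form n (component m' p) 0)) = 1"
    "vol n (wedge (flag_form n (component m' p) 0) (flag_form n (component m p) (2 * n + 1))) = 1"
    unfolding flag_form_def wedge_upto_eq[OF flag_facts(1)[OF p]] vol_def wedge_list_append[symmetric] by simp_all
qed

text \<open>The bounds keep two black vertices out: 0 < i + t excludes \<open>Y n\<close>, and j + t
  < n excludes \<open>X 0 n\<close>. If j + t or n - i - t is 0 there is no corresponding vertex,
  and the factor of the function is a volume equal to 1.\<close>

lemma monomial_virtual:
  assumes A': "unfrozen_agree n p A A'" and ij: "i = 0 \<or> j = 0" "i + t \<le> n" "0 < i + t" "j + t < n"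
  shows "monomial n A' p (exponent n i j t) = F i j t"
proof -
  let ?x = "X 0 (j + t)" and ?y = "Y (n - i - t)"
  have e: "exponent n i j t = (\<lambda>q. (if q = ?x then of_bool (0 < j + t) else 0) + (if q = ?y then of_bool (0 < n - i - t) else 0))"
    using ij by (auto simp: exponent_def fun_eq_iff)
  have fixed: "A' ?x p = A ?x p" "A' ?y p = A ?y p" using A' by (auto simp: unfrozen_agree_def)
  have "(if ?x \<in> vertices n then A' ?x p ^ of_bool (0 < j + t) else 1) =
      vol n (wedge (flag_form n (component 0 p) (2 * n + 1 - (j + t))) (flag_form n (component 2 p) (j + t)))"
  proof (cases "j + t = 0")
    case False
    then have v: "?x \<in> vertices n" "\<not> black n ?x" using ij by (auto simp: vertices_def black_def)
    have "A ?x p = triple_fun n (2 * n + 1 - (j + t)) 0 (j + t) p"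
      using white_value[OF v] by (simp add: base_fun_def)
    also have "\<dots> = vol n (wedge (flag_form n (component 0 p) (2 * n + 1 - (j + t))) (flag_form n (component 2 p) (j + t)))"
    proof -
      have "2 * n + 1 - (j + t) + 0 + (j + t) = NN n" using ij by simp
      then show ?thesis
        unfolding triple_fun_component flag_form_def
        using triple_vol[OF flag_facts(1)[OF p] flag_facts(1)[OF p] flag_facts(1)[OF p]]
        by (simp only: wedge_upto_eq[OF flag_facts(1)[OF p]] wedge_list_append[symmetric] initial_0 append_Nil)
    qed
    finally show ?thesis using v False fixed by simp
  qed (use volume_zero(1)[of 0 2] ij in \<open>auto simp: vertices_def\<close>)
  moreover have "(if ?y \<in> vertices n then A' ?y p ^ of_bool (0 < n - i - t) else 1) =
      vol n (wedge (flag_form n (component 0 p) (n - i - t)) (flag_form n (component 1 p) (2 * n + 1 - (n - i - t))))"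
  proof (cases "n - i - t = 0")
    case False
    then have v: "?y \<in> vertices n" "\<not> black n ?y" using ij by (auto simp: vertices_def black_def)
    have "A ?y p = vol n (wedge (flag_form n (component 0 p) (n - i - t)) (flag_form n (component 1 p) (2 * n + 1 - (n - i - t))))"
      using white_value[OF v] by (simp add: base_fun_def component_def case_prod_unfold)
    then show ?thesis using v False fixed by simp
  qed (use volume_zero(2)[of 0 1] in \<open>auto simp: vertices_def\<close>)
  ultimately show ?thesis
    unfolding e monomial_add monomial_single vertex_function_factor[OF p ij(1,2) less_imp_le[OF ij(4)]] by simp
qed

lemma monomial_unfrozen:
  assumes "1 \<le> i" "i < n" "1 \<le> j" "j < n"
  shows "monomial n A' p (exponent n i j t) = A' (X i j) p"
proof -
  have "exponent n i j t = (\<lambda>q. if q = X i j then 1 else 0)" using assms by (auto simp: exponent_def fun_eq_iff)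
  then show ?thesis using assms by (simp add: monomial_single vertices_def)
qed

text \<open>A black variable enters squared, which undoes its square root. Layer n is never mutated,
  so the value is that of time 0 for every t.\<close>

lemma monomial_boundary:
  assumes A': "unfrozen_agree n p A A'" and ij: "1 \<le> i" "i \<le> n" "1 \<le> j" "j \<le> n" "max i j = n"
  shows "monomial n A' p (exponent n i j t) = F i j 0"
proof -
  have fixed: "A' (X i j) p = A (X i j) p" using A' ij by (auto simp: unfrozen_agree_def)
  have v: "X i j \<in> vertices n" using ij by (simp add: vertices_def)
  show ?thesis
  proof (cases "j = n")
    case True
    have "exponent n i j t = (\<lambda>q. if q = X i j then 2 else 0)" using ij True by (auto simp: exponent_def fun_eq_iff)
    moreover have "black n (X i j)" using True by (simp add: black_def)
    ultimately show ?thesis using v black_value[OF v] base_function[OF ij(1-4)] fixed by (simp add: monomial_single)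
  next
    case False
    have "exponent n i j t = (\<lambda>q. if q = X i j then 1 else 0)" using ij False by (auto simp: exponent_def fun_eq_iff)
    then show ?thesis using v initial_value[of i j] ij False fixed by (simp add: monomial_single)
  qed
qed

lemma stage_value_below:
  assumes A': "unfrozen_agree n p A A'"
    and vals: "\<And>i j. 1 \<le> i \<Longrightarrow> i < n \<Longrightarrow> 1 \<le> j \<Longrightarrow> j < n \<Longrightarrow>
      A' (X i j) p = F i j (min (n - max i j) (if max i j \<le> M then s + 1 else s))"
    and M: "max i j = M" "M + 1 + s < n"
  shows "monomial n A' p (exponent n i j (s + 1)) = F i j (s + 1)"
proof (cases "i = 0 \<or> j = 0")
  case True
  show ?thesis by (rule monomial_virtual[OF A' True]) (use M in auto)
next
  case False
  then have "min (n - max i j) (if max i j \<le> M then s + 1 else s) = s + 1" using M by auto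
  then show ?thesis using vals[of i j] monomial_unfrozen[of i j A' "s + 1"] False M by auto
qed

lemma stage_value_above:
  assumes A': "unfrozen_agree n p A A'"
    and vals: "\<And>i j. 1 \<le> i \<Longrightarrow> i < n \<Longrightarrow> 1 \<le> j \<Longrightarrow> j < n \<Longrightarrow>
      A' (X i j) p = F i j (min (n - max i j) (if max i j \<le> M then s + 1 else s))"
    and M: "max i j = M + 2" "M + 1 + s < n" "1 \<le> i" "1 \<le> j"
  shows "monomial n A' p (exponent n i j s) = F i j s"
\<comment> \<open>Layer n is adjacent to the mutated layer only in the first round, where s = 0, so
  its value at time 0 is the required one.\<close>
proof (cases "M + 2 = n")
  case True
  then have "s = 0" using M by simp
  moreover have "monomial n A' p (exponent n i j s) = F i j 0"
    by (rule monomial_boundary[OF A']) (use M True in auto)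
  ultimately show ?thesis by simp
next
  case False
  then have "min (n - max i j) (if max i j \<le> M then s + 1 else s) = s" using M by auto
  then show ?thesis using vals[of i j] monomial_unfrozen[of i j A' s] False M by auto
qed

lemma stage_mutation:
  assumes A': "unfrozen_agree n p A A'"
    and vals: "\<And>i j. 1 \<le> i \<Longrightarrow> i < n \<Longrightarrow> 1 \<le> j \<Longrightarrow> j < n \<Longrightarrow>
      A' (X i j) p = F i j (min (n - max i j) (if max i j \<le> M then s + 1 else s))"
    and M: "M + 1 + s < n" and ij: "1 \<le> i" "1 \<le> j" "max i j = M + 1"
    and row: "\<And>q. b (X i j) q = exchange_row n i j s q"
    and nz: "F i j s \<noteq> 0"
  shows "mutate_fun n (X i j) b A' p = F i j (s + 1)"
proof -
  note below = stage_value_below[OF A' vals _ M] and above = stage_value_above[OF A' vals _ M]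
  have "monomial n A' p (exchange_pos n i j s) = F (i - 1) (j - 1) (s + 1) * F (i + 1) (j + 1) s"
  proof -
    have "exchange_pos n i j s = (\<lambda>q. exponent n (i - 1) (j - 1) (s + 1) q + exponent n (i + 1) (j + 1) s q)"
      by (simp add: exchange_pos_def fun_eq_iff)
    moreover have "max (i - 1) (j - 1) = M" "max (i + 1) (j + 1) = M + 2" using ij by auto
    ultimately show ?thesis using below[of "i - 1" "j - 1"] above[of "i + 1" "j + 1"] by (simp add: monomial_add)
  qed
  moreover have "monomial n A' p (exchange_neg n i j s) =
    (if j < i then F (i - 1) j (s + 1) * F (i + 1) j s
     else if i = j then F i (j + 1) s * F (i + 1) j s
     else F i (j - 1) (s + 1) * F i (j + 1) s)"
  proof -
    consider "j < i" | "i = j" | "i < j" by linarith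
    then show ?thesis
    proof cases
      case 1
      then have "exchange_neg n i j s = (\<lambda>q. exponent n (i - 1) j (s + 1) q + exponent n (i + 1) j s q)"
        by (simp add: exchange_neg_def fun_eq_iff)
      moreover have "max (i - 1) j = M" "max (i + 1) j = M + 2" using ij 1 by auto
      ultimately show ?thesis using below[of "i - 1" j] above[of "i + 1" j] 1 ij by (simp add: monomial_add)
    next
      case 2
      then have "exchange_neg n i j s = (\<lambda>q. exponent n i (j + 1) s q + exponent n (i + 1) j s q)"
        by (simp add: exchange_neg_def fun_eq_iff)
      moreover have "max i (j + 1) = M + 2" "max (i + 1) j = M + 2" using ij 2 by auto
      ultimately show ?thesis using above[of i "j + 1"] above[of "i + 1" j] 2 ij by (simp add: monomial_add)
    next
      case 3
      then have "exchange_neg n i j s = (\<lambda>q. exponent n i (j - 1) (s + 1) q + exponent n i (j + 1) s q)"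
        by (simp add: exchange_neg_def fun_eq_iff)
      moreover have "max i (j - 1) = M" "max i (j + 1) = M + 2" using ij 3 by auto
      ultimately show ?thesis using below[of i "j - 1"] above[of i "j + 1"] 3 ij by (simp add: monomial_add)
    qed
  qed
  moreover have "A' (X i j) p = F i j s"
  proof -
    have "min (n - max i j) (if max i j \<le> M then s + 1 else s) = s" using M ij by auto
    then show ?thesis using vals[of i j] ij M by auto
  qed
  moreover have "F i j s * F i j (s + 1) = F (i - 1) (j - 1) (s + 1) * F (i + 1) (j + 1) s +
    (if j < i then F (i - 1) j (s + 1) * F (i + 1) j s
     else if i = j then F i (j + 1) s * F (i + 1) j s
     else F i (j - 1) (s + 1) * F i (j + 1) s)"
    by (rule vertex_function_exchange[OF p ij(1,2)]) (use ij M in simp)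
  ultimately show ?thesis
    unfolding mutate_fun_exchange[where k = "X i j" and b = b and i = i and j = j and t = s, OF row ij(1,2)] using nz by (simp add: field_simps)
qed

section \<open>The invariant of the mutation sequence\<close>

definition state :: "vertex list \<Rightarrow> seed" where
  "state ks = mutate_along n ks (initial_matrix n, A)"

text \<open>After s complete rounds and M layers of the next one. Rows are recorded only for layers
  with max i j + s < n, which are those belonging to the present round; the layers beyond have
  reached their final count n - max i j.\<close>

definition stage :: "nat \<Rightarrow> nat \<Rightarrow> vertex list \<Rightarrow> bool" where
  "stage s M ks \<longleftrightarrow> M + s < n \<and> unfrozen_agree n p A (snd (state ks)) \<and>
     (\<forall>i j q. 1 \<le> i \<longrightarrow> 1 \<le> j \<longrightarrow> max i j + s < n \<longrightarrow> fst (state ks) (X i j) q = stage_row n s M i j q) \<and>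
     (\<forall>i j. 1 \<le> i \<longrightarrow> i < n \<longrightarrow> 1 \<le> j \<longrightarrow> j < n \<longrightarrow>
        snd (state ks) (X i j) p = F i j (count_list ks (X i j)) \<and>
        count_list ks (X i j) = min (n - max i j) (if max i j \<le> M then s + 1 else s))"

lemma count_list_distinct: "distinct ks \<Longrightarrow> count_list ks v = (if v \<in> set ks then 1 else 0)"
  by (induction ks) auto

lemma stage_initial: "stage 0 0 []"
proof -
  have "initial_matrix n (X i j) q = stage_row n 0 0 i j q" if "1 \<le> i" "1 \<le> j" "max i j < n" for i j q
  proof (cases "max i j = 1")
    case True
    then have "i = 1" "j = 1" using that by auto
    then show ?thesis using initial_matrix_flat[of i n j q] flat_row_first[of 0 n q] that by (simp add: stage_row_def)
  next
    case False
    then have "2 \<le> max i j" using that by auto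
    then show ?thesis using initial_matrix_flat[of i n j q] that by (simp add: stage_row_def)
  qed
  moreover have "A (X i j) p = F i j 0" if "1 \<le> i" "i < n" "1 \<le> j" "j < n" for i j
    using initial_value[of i j] that by simp
  ultimately show ?thesis using n_pos by (simp add: stage_def state_def mutate_along_def unfrozen_agree_def)
qed

text \<open>At the end of a round the rows of the layers that continue are flat at time s + 1. Only
  (1, 1) has to be read as an exchange row, which is \<open>flat_row_first\<close>.\<close>

lemma stage_next_round:
  assumes "stage s M ks" "M + s + 1 = n" "s + 1 < n"
  shows "stage (s + 1) 0 ks"
proof -
  have "stage_row n s M i j q = stage_row n (s + 1) 0 i j q" if "1 \<le> i" "1 \<le> j" "max i j + (s + 1) < n" for i j q
  proof (cases "max i j = 1")
    case True
    then have "i = 1" "j = 1" using that by auto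
    then show ?thesis using flat_row_first[of "s + 1" n q] that assms by (simp add: stage_row_def)
  next
    case False
    then have "2 \<le> max i j" using that by auto
    then show ?thesis using that assms by (simp add: stage_row_def)
  qed
  moreover have "min (n - max i j) (if max i j \<le> M then s + 1 else s) = min (n - max i j) (s + 1)" for i j
    using assms by auto
  ultimately show ?thesis using assms unfolding stage_def by (auto simp: max_def)
qed

context
  assumes nonzero: "\<And>i j t. 1 \<le> i \<Longrightarrow> 1 \<le> j \<Longrightarrow> max i j + t \<le> n \<Longrightarrow> F i j t \<noteq> 0"
begin

text \<open>Allows for a layer of which only some vertices have been mutated, so that prefixes
  ending inside a layer are covered.\<close>

lemma stage_partial:
  assumes st: "stage s M ks" and M: "M + 1 + s < n" and ls: "distinct ls" "set ls \<subseteq> layer n (M + 1)"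
  shows "unfrozen_agree n p A (snd (state (ks @ ls)))"
    and "\<And>i j. 1 \<le> i \<Longrightarrow> i < n \<Longrightarrow> 1 \<le> j \<Longrightarrow> j < n \<Longrightarrow>
      snd (state (ks @ ls)) (X i j) p = F i j (count_list (ks @ ls) (X i j))"
    and "\<And>i j. 1 \<le> i \<Longrightarrow> i < n \<Longrightarrow> 1 \<le> j \<Longrightarrow> j < n \<Longrightarrow>
      count_list (ks @ ls) (X i j) = (if X i j \<in> set ls then s + 1 else min (n - max i j) (if max i j \<le> M then s + 1 else s))"
    and "fst (state (ks @ ls)) i j = (if i \<in> set ls \<or> j \<in> set ls then - fst (state ks) i j
      else update_row (fst (state ks) i) (set ls) (fst (state ks)) j)"
proof -
  obtain b A' where bA: "state ks = (b, A')" by fastforce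
  have rows: "b (X i j) q = stage_row n s M i j q" if "1 \<le> i" "1 \<le> j" "max i j + s < n" for i j q
    using st that unfolding stage_def bA by simp
  have agree: "unfrozen_agree n p A A'" using st unfolding stage_def bA by simp
  have vals: "A' (X i j) p = F i j (count_list ks (X i j))"
      "count_list ks (X i j) = min (n - max i j) (if max i j \<le> M then s + 1 else s)"
    if "1 \<le> i" "i < n" "1 \<le> j" "j < n" for i j
    using st that unfolding stage_def bA by simp_all
  have exch: "b (X i j) q = exchange_row n i j s q" if "X i j \<in> layer n (M + 1)" for i j q
  proof -
    have "1 \<le> i" "1 \<le> j" "max i j = M + 1" using that by (auto simp: layer_def)
    then show ?thesis using rows[of i j q] M by (simp add: stage_row_def)
  qed
  have comm: "b k l = 0" if kl: "k \<in> set ls" "l \<in> set ls" for k l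
  proof -
    have kl': "k \<in> layer n (M + 1)" "l \<in> layer n (M + 1)" using kl ls by auto
    then obtain i j where ij: "k = X i j" "1 \<le> i" "1 \<le> j" "max i j = M + 1"
      unfolding layer_def by blast
    show ?thesis unfolding ij(1) exch[OF kl'(1)[unfolded ij(1)]]
      by (rule exchange_row_layer[OF kl'(2)]) (use ij in auto)
  qed
  have new: "state (ks @ ls) = mutate_along n ls (b, A')" using bA by (simp add: state_def mutate_along_append)
  note step = mutate_along_commuting[where ks = ls and b = b and A = A' and n = n, OF ls(1) comm, folded new]
  have funs: "snd (state (ks @ ls)) v = (if v \<in> set ls then mutate_fun n v b A' else A' v)" for v
    using step by blast
  show "fst (state (ks @ ls)) i j = (if i \<in> set ls \<or> j \<in> set ls then - fst (state ks) i j
      else update_row (fst (state ks) i) (set ls) (fst (state ks)) j)"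
    using step[of i j] bA by (simp add: update_row_def)
  have unf: "\<exists>i j. v = X i j \<and> 1 \<le> i \<and> i < n \<and> 1 \<le> j \<and> j < n" if "v \<in> set ls" for v
    using that ls(2) by (auto elim!: layerE)
  show "unfrozen_agree n p A (snd (state (ks @ ls)))"
    using agree unf unfolding unfrozen_agree_def funs by auto
  fix i j assume ij: "1 \<le> i" "i < n" "1 \<le> j" "j < n"
  show count: "count_list (ks @ ls) (X i j) = (if X i j \<in> set ls then s + 1 else min (n - max i j) (if max i j \<le> M then s + 1 else s))"
  proof (cases "X i j \<in> set ls")
    case True
    then have "max i j = M + 1" using ls(2) by (auto simp: layer_def)
    then show ?thesis using True M vals(2)[OF ij] by (simp add: count_list_distinct[OF ls(1)])
  qed (simp add: count_list_distinct[OF ls(1)] vals(2)[OF ij])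
  show "snd (state (ks @ ls)) (X i j) p = F i j (count_list (ks @ ls) (X i j))"
  proof (cases "X i j \<in> set ls")
    case True
    then have L: "X i j \<in> layer n (M + 1)" using ls(2) by auto
    then have m: "max i j = M + 1" by (auto simp: layer_def)
    have "mutate_fun n (X i j) b A' p = F i j (s + 1)"
      by (rule stage_mutation[where M = M and b = b and s = s and A' = A' and i = i and j = j])
        (use agree vals nonzero[of i j s] ij m M exch[OF L] in auto)
    then show ?thesis using True by (simp only: funs count if_True)
  next
    case False
    then show ?thesis using vals[OF ij] by (simp add: funs count_list_distinct[OF ls(1)])
  qed
qed

text \<open>With respect to the mutated layer M + 1 a row is either negated (in the layer),
  transformed (in an adjacent layer) or unaffected, because rows further away have no entries in the
  layer.\<close>

lemma stage_next_layer:
  assumes st: "stage s M ks" and M: "M + 1 + s < n" and ls: "distinct ls" "set ls = layer n (M + 1)"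
  shows "stage s (M + 1) (ks @ ls)"
proof -
  note part = stage_partial[OF st M ls(1) equalityD1[OF ls(2)]]
  have rows: "fst (state ks) (X i j) = stage_row n s M i j" if "1 \<le> i" "1 \<le> j" "max i j + s < n" for i j
    using st that unfolding stage_def by blast
  have exch: "fst (state ks) (X a b) = exchange_row n a b s" if "X a b \<in> layer n (M + 1)" for a b
  proof -
    have "1 \<le> a" "1 \<le> b" "max a b = M + 1" using that by (auto simp: layer_def)
    then show ?thesis using rows[of a b] M by (simp add: stage_row_def fun_eq_iff)
  qed
  have "fst (state (ks @ ls)) (X i j) q = stage_row n s (M + 1) i j q"
    if ij: "1 \<le> i" "1 \<le> j" "max i j + s < n" for i j q
  proof (cases "max i j = M + 1")
    case True
    then have "X i j \<in> layer n (M + 1)" using ij by (auto simp: layer_def)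
    then show ?thesis unfolding part(4) ls(2) rows[OF ij] using True by (simp add: stage_row_def)
  next
    case False
    then have "X i j \<notin> layer n (M + 1)" by (auto simp: layer_def)
    then have eq: "fst (state (ks @ ls)) (X i j) q = update_row (stage_row n s M i j) (layer n (M + 1)) (fst (state ks)) q"
      unfolding part(4) ls(2) rows[OF ij] by (auto simp: update_row_def)
    consider "M + 3 \<le> max i j" | "max i j = M + 1 + 1" | "max i j = M" | "max i j < M" using False by linarith
    then show ?thesis
    proof cases
      case 1
      then have "stage_row n s M i j = flat_row n i j s" by (simp add: stage_row_def fun_eq_iff)
      moreover have "update_row (flat_row n i j s) (layer n (M + 1)) (fst (state ks)) q = flat_row n i j s q"
        by (rule update_row_far, erule flat_row_far) (use ij 1 in auto)
      ultimately show ?thesis unfolding eq using 1 by (simp add: stage_row_def)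
    next
      case 2
      then have "stage_row n s M i j = flat_row n i j s" by (simp add: stage_row_def fun_eq_iff)
      moreover have "update_row (flat_row n i j s) (layer n (M + 1)) (fst (state ks)) q = exchange_row n i j s q"
        by (rule update_row_above) (use ij 2 M exch in auto)
      ultimately show ?thesis unfolding eq using 2 by (simp add: stage_row_def)
    next
      case 3
      then have "stage_row n s M i j = (\<lambda>q. - exchange_row n i j s q)" by (simp add: stage_row_def fun_eq_iff)
      moreover have "update_row (\<lambda>q. - exchange_row n i j s q) (layer n (M + 1)) (fst (state ks)) q = flat_row n i j (s + 1) q"
        by (rule update_row_below) (use ij 3 M exch in auto)
      ultimately show ?thesis unfolding eq using 3 by (simp add: stage_row_def)
    next
      case 4
      have ne: "\<not> M + 2 \<le> max i j" "max i j \<noteq> M" "\<not> M + 1 + 2 \<le> max i j" "\<not> M + 3 \<le> max i j" "max i j \<noteq> M + 1"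
          "max i j \<noteq> M + 1 + 1" "max i j \<noteq> M + 2"
        using 4 by linarith+
      have "stage_row n s M i j = flat_row n i j (s + 1)"
        by (rule ext) (simp only: stage_row_def ne if_False)
      moreover have "update_row (flat_row n i j (s + 1)) (layer n (M + 1)) (fst (state ks)) q = flat_row n i j (s + 1) q"
        by (rule update_row_far, erule flat_row_far) (use ij 4 in auto)
      ultimately show ?thesis unfolding eq by (simp only: stage_row_def ne if_False)
    qed
  qed
  moreover have "count_list (ks @ ls) (X i j) = min (n - max i j) (if max i j \<le> M + 1 then s + 1 else s)"
    if ij: "1 \<le> i" "i < n" "1 \<le> j" "j < n" for i j
  proof (cases "max i j = M + 1")
    case True
    then have "X i j \<in> layer n (M + 1)" using ij by (auto simp: layer_def)
    then show ?thesis using part(3)[OF ij] ls(2) True M by simp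
  next
    case False
    then have "X i j \<notin> layer n (M + 1)" by (auto simp: layer_def)
    moreover have "max i j \<le> M + 1 \<longleftrightarrow> max i j \<le> M" using False by linarith
    ultimately show ?thesis using part(3)[OF ij] ls(2) by simp
  qed
  ultimately show ?thesis using part(1,2) M unfolding stage_def by simp
qed

end

end

section \<open>Whole rounds, and prefixes that end inside a round\<close>

lemma take_concat:
  "\<exists>i\<le>length xss. \<exists>l'. take l (concat xss) = concat (take i xss) @ (if i < length xss then take l' (xss ! i) else [])"
proof (induction xss arbitrary: l)
  case (Cons xs xss)
  show ?case
  proof (cases "l \<le> length xs")
    case True
    then show ?thesis by (intro exI[of _ 0] conjI exI[of _ l]) auto
  next
    case False
    obtain i l' where "i \<le> length xss"
      "take (l - length xs) (concat xss) = concat (take i xss) @ (if i < length xss then take l' (xss ! i) else [])"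
      using Cons[of "l - length xs"] by blast
    then show ?thesis using False by (intro exI[of _ "Suc i"] conjI exI[of _ l']) auto
  qed
qed simp

context seed_point
begin

definition round_list :: "(nat \<Rightarrow> nat \<Rightarrow> vertex list) \<Rightarrow> nat \<Rightarrow> vertex list" where
  "round_list L r = concat (map (L r) [1..<Suc r])"

lemma mutation_sequence_rounds: "mutation_sequence n L = concat (map (round_list L) (rev [1..<n]))"
  by (simp add: mutation_sequence_def round_list_def[abs_def])

context
  fixes L :: "nat \<Rightarrow> nat \<Rightarrow> vertex list"
  assumes orders: "layer_orders n L"
    and nonzero: "\<And>i j t. 1 \<le> i \<Longrightarrow> 1 \<le> j \<Longrightarrow> max i j + t \<le> n \<Longrightarrow> F i j t \<noteq> 0"
begin

lemma layer_list:
  assumes "M + 1 + s < n"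
  shows "distinct (L (n - 1 - s) (M + 1))" "set (L (n - 1 - s) (M + 1)) = layer n (M + 1)"
proof -
  have "1 \<le> M + 1" "M + 1 \<le> n - 1 - s" "n - 1 - s \<le> n - 1" using assms by auto
  then show "distinct (L (n - 1 - s) (M + 1))" "set (L (n - 1 - s) (M + 1)) = layer n (M + 1)"
    using orders unfolding layer_orders_def by blast+
qed

lemma stage_layers:
  "stage s 0 ks \<Longrightarrow> M + s < n \<Longrightarrow> stage s M (ks @ concat (map (L (n - 1 - s)) [1..<Suc M]))"
proof (induction M)
  case (Suc M)
  have M: "M + 1 + s < n" using Suc.prems by simp
  have "stage s (M + 1) ((ks @ concat (map (L (n - 1 - s)) [1..<Suc M])) @ L (n - 1 - s) (M + 1))"
    by (rule stage_next_layer[OF nonzero Suc.IH M layer_list[OF M]]) (use Suc.prems in auto)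
  moreover have "(ks @ concat (map f [1..<Suc M])) @ f (M + 1) = ks @ concat (map f [1..<Suc (Suc M)])" for f
    by (simp add: One_nat_def)
  ultimately show ?case by (simp only: Suc_eq_plus1)
qed simp

lemma stage_rounds: "s < n \<Longrightarrow> stage s 0 (concat (map (round_list L) (take s (rev [1..<n]))))"
proof (induction s)
  case 0
  then show ?case by (simp add: stage_initial)
next
  case (Suc s)
  let ?ks = "concat (map (round_list L) (take s (rev [1..<n])))"
  have "rev [1..<n] ! s = n - 1 - s" using Suc.prems by (simp add: rev_nth)
  then have "take (Suc s) (rev [1..<n]) = take s (rev [1..<n]) @ [n - 1 - s]"
    using Suc.prems by (simp add: take_Suc_conv_app_nth)
  moreover have "stage s (n - 1 - s) (?ks @ concat (map (L (n - 1 - s)) [1..<Suc (n - 1 - s)]))"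
    by (rule stage_layers) (use Suc in auto)
  then have "stage (s + 1) 0 (?ks @ round_list L (n - 1 - s))"
    unfolding round_list_def by (rule stage_next_round) (use Suc.prems in auto)
  ultimately show ?case by (simp only: map_append concat_append list.map concat.simps append_Nil2 Suc_eq_plus1)
qed

text \<open>A prefix ends inside some round and there inside some layer. \<open>take_concat\<close>,
  used once for the rounds and once for the layers, finds the place, and the invariant is available
  up to that layer.\<close>

lemma function_at_count:
  assumes ij: "1 \<le> i" "i < n" "1 \<le> j" "j < n"
  shows "function_at n A L l (X i j) p = F i j (times_mutated n L l (X i j))"
proof -
  let ?seq = "map (round_list L) (rev [1..<n])"
  have whole: "snd (state ks) (X i j) p = F i j (count_list ks (X i j))" if "stage s M ks" for s M ks
    using that ij unfolding stage_def by blast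
  obtain a l' where a: "a \<le> length ?seq"
    "take l (concat ?seq) = concat (take a ?seq) @ (if a < length ?seq then take l' (?seq ! a) else [])"
    using take_concat[of ?seq l] by blast
  have len: "length ?seq = n - 1" by simp
  have pre: "concat (take a ?seq) = concat (map (round_list L) (take a (rev [1..<n])))" by (simp add: take_map)
  have st: "stage a 0 (concat (take a ?seq))" unfolding pre by (rule stage_rounds) (use a len n_pos in auto)
  have "snd (state (take l (concat ?seq))) (X i j) p = F i j (count_list (take l (concat ?seq)) (X i j))"
  proof (cases "a < length ?seq")
    case False
    then show ?thesis using a(2) whole[OF st] by simp
  next
    case True
    define r where "r = n - 1 - a"
    have r: "?seq ! a = concat (map (L r) [1..<Suc r])"
      using True by (simp add: round_list_def rev_nth r_def)
    obtain k l'' where k: "k \<le> r"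
      "take l' (?seq ! a) = concat (take k (map (L r) [1..<Suc r])) @
        (if k < r then take l'' (map (L r) [1..<Suc r] ! k) else [])"
      using take_concat[of "map (L r) [1..<Suc r]" l'] unfolding r by (auto simp del: upt_Suc)
    have tk: "take k (map (L r) [1..<Suc r]) = map (L r) [1..<Suc k]"
      using k(1) take_upt[of 1 k "Suc r"] plus_1_eq_Suc by (simp add: take_map del: upt_Suc)
    let ?ks = "concat (take a ?seq) @ concat (map (L r) [1..<Suc k])"
    have sk: "stage a k ?ks" unfolding r_def by (rule stage_layers[OF st]) (use k(1) True in \<open>auto simp: r_def\<close>)
    show ?thesis
    proof (cases "k < r")
      case False
      then have "take l (concat ?seq) = ?ks" using a(2) True k(2) tk by simp
      then show ?thesis using whole[OF sk] by simp
    next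
      case kr: True
      have nth: "map (L r) [1..<Suc r] ! k = L r (k + 1)" using kr by (simp add: add.commute del: upt_Suc)
      have seq: "take l (concat ?seq) = ?ks @ take l'' (L r (k + 1))" using a(2) True k(2) tk nth kr by simp
      have M: "k + 1 + a < n" using kr by (simp add: r_def)
      note ll = layer_list[OF M, folded r_def]
      show ?thesis unfolding seq
      proof (rule stage_partial(2)[OF nonzero sk M _ _ ij])
        show "distinct (take l'' (L r (k + 1)))" using ll(1) by simp
        show "set (take l'' (L r (k + 1))) \<subseteq> layer n (k + 1)" using ll(2) set_take_subset by fastforce
      qed
    qed
  qed
  then show ?thesis by (simp add: function_at_def times_mutated_def state_def mutation_sequence_rounds)
qed

lemma total_count:
  assumes ij: "1 \<le> i" "i < n" "1 \<le> j" "j < n"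
  shows "times_mutated n L (length (mutation_sequence n L)) (X i j) = n - max i j"
proof -
  have "stage (n - 1) 0 (concat (map (round_list L) (take (n - 1) (rev [1..<n]))))"
    by (rule stage_rounds) (use n_pos in simp)
  moreover have "take (n - 1) (rev [1..<n]) = rev [1..<n]" by (rule take_all) simp
  ultimately have "count_list (mutation_sequence n L) (X i j) = min (n - max i j) (if max i j \<le> 0 then n - 1 + 1 else n - 1)"
    using ij unfolding stage_def mutation_sequence_rounds by simp
  then show ?thesis using ij by (auto simp: times_mutated_def)
qed

end

end

section \<open>The dualities at the end of the sequence, the nonvanishing locus, and the
  conclusion\<close>

lemma triple_fun_dual:
  assumes p: "p \<in> spin3 n" and "1 \<le> j" "j \<le> i" "i \<le> n"
  shows "triple_fun n (n + i + 1) (2 * n + 1 - j) (n - i + j) p = triple_fun n (n - i) j (n + 1 + i - j) p"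
proof -
  have "NN n - (n + i + 1) = n - i" "NN n - (2 * n + 1 - j) = j" "NN n - (n - i + j) = n + 1 + i - j"
    using assms by auto
  then show ?thesis
    unfolding triple_fun_component flag_form_def
    using triple_dual[OF flag_facts(1)[OF p, of 0] flag_facts(1)[OF p, of 1] flag_facts(1)[OF p, of 2]
        flag_facts(2)[OF p] flag_facts(2)[OF p] flag_facts(2)[OF p],
        of "n + i + 1" "2 * n + 1 - j" "n - i + j"] assms
    by simp
qed

lemma quad_fun_dual:
  assumes p: "p \<in> spin3 n" and ij: "1 \<le> i" "i < j" "j \<le> n"
  shows "quad_fun n (j - i) (n + i + 1) (2 * n + 1 - j) n p = quad_fun n (n - i) (2 * n + 1 + i - j) j (n + 1) p"
proof -
  let ?Q = "quad_ordered n (flag_form n (component 0 p)) (flag_form n (component 1 p)) (flag_form n (component 2 p))"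
  have "quad_fun n (j - i) (n + i + 1) (2 * n + 1 - j) n p = ?Q (n + i + 1) (j - i) (2 * n + 1 - j) n"
  proof -
    have "j - i \<noteq> NN n" "n + i + 1 \<noteq> NN n" "n + i + 1 \<noteq> 0" "j - i \<noteq> 0"
      "j - i + (n + i + 1) + (2 * n + 1 - j) + n = 2 * NN n"
      "\<not> n + i + 1 \<le> NN n - n"
      "j - i \<le> NN n - (2 * n + 1 - j)" "j - i \<le> NN n - n" "NN n - (2 * n + 1 - j) \<le> n + i + 1" "NN n - n \<le> n + i + 1"
      using ij by auto
    then show ?thesis unfolding quad_fun_component quad_def by simp
  qed
  also have "\<dots> = ?Q (2 * n + 1 + i - j) (n - i) j (n + 1)"
  proof -
    have "NN n - (j - i) = 2 * n + 1 + i - j" "NN n - (n + i + 1) = n - i" "NN n - (2 * n + 1 - j) = j" "NN n - n = n + 1"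
      using ij by auto
    then show ?thesis
      unfolding flag_form_def
      using quad_ordered_dual[OF flag_facts(1)[OF p, of 0] flag_facts(1)[OF p, of 1] flag_facts(1)[OF p, of 2]
          flag_facts(2)[OF p] flag_facts(2)[OF p] flag_facts(2)[OF p],
          of "n + i + 1" "j - i" "2 * n + 1 - j" n] ij
      by simp
  qed
  also have "\<dots> = quad_fun n (n - i) (2 * n + 1 + i - j) j (n + 1) p"
  proof -
    have "n - i \<noteq> NN n" "2 * n + 1 + i - j \<noteq> NN n" "2 * n + 1 + i - j \<noteq> 0" "n - i \<noteq> 0"
      "n - i + (2 * n + 1 + i - j) + j + (n + 1) = 2 * NN n"
      "\<not> 2 * n + 1 + i - j \<le> NN n - j"
      "n - i \<le> NN n - j" "n - i \<le> NN n - (n + 1)" "NN n - j \<le> 2 * n + 1 + i - j" "NN n - (n + 1) \<le> 2 * n + 1 + i - j"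
      using ij by auto
    then show ?thesis unfolding quad_fun_component quad_def by simp
  qed
  finally show ?thesis .
qed

text \<open>A finite product of regular functions, so that a single regular function controls all
  the divisions in the sequence.\<close>

definition nonvanishing_locus :: "nat \<Rightarrow> point \<Rightarrow> complex" where
  "nonvanishing_locus n p = (\<Prod>(i, j, t)\<in>{(i, j, t). 1 \<le> i \<and> 1 \<le> j \<and> max i j + t \<le> n}. vertex_function n i j t p)"

lemma nonvanishing_locus_nz:
  "nonvanishing_locus n p \<noteq> 0 \<longleftrightarrow> (\<forall>i j t. 1 \<le> i \<longrightarrow> 1 \<le> j \<longrightarrow> max i j + t \<le> n \<longrightarrow> vertex_function n i j t p \<noteq> 0)"
proof -
  have "finite {(i, j, t). 1 \<le> i \<and> 1 \<le> j \<and> max i j + t \<le> n}"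
    by (rule finite_subset[of _ "{..n} \<times> {..n} \<times> {..n}"]) auto
  then show ?thesis unfolding nonvanishing_locus_def by (auto simp: prod_zero_iff)
qed

lemma regular_nonvanishing_locus: "regular_fun n (nonvanishing_locus n)"
  unfolding nonvanishing_locus_def[abs_def] case_prod_unfold
  by (rule regular_prod) (auto intro: regular_vertex_function)

theorem theorem4p8:
  fixes n :: nat
    and A :: "vertex \<Rightarrow> point \<Rightarrow> complex"
    and L :: "nat \<Rightarrow> nat \<Rightarrow> vertex list"
  assumes n: "1 \<le> n"
    and seed: "initial_functions n A"
    and orders: "layer_orders n L"
  shows
    "(\<forall>i\<in>{1..n-1}. \<forall>j\<in>{1..n-1}.
        times_mutated n L (length (mutation_sequence n L)) (X i j) = n - max i j) \<and>
     (\<forall>i\<in>{1..n-1}. \<forall>j\<in>{1..n-1}. j \<le> i \<longrightarrow>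
        (\<forall>t \<le> n - i. \<forall>l \<le> length (mutation_sequence n L). times_mutated n L l (X i j) = t \<longrightarrow>
           rat_eq n (function_at n A L l (X i j))
             (quad_fun n (2*n+1-t) (n-i-t) (n+1+i-j+t) (j+t))) \<and>
        rat_eq n (function_at n A L 0 (X i j)) (triple_fun n (n-i) (n+1+i-j) j) \<and>
        rat_eq n (function_at n A L (length (mutation_sequence n L)) (X i j))
          (triple_fun n (n+i+1) (2*n+1-j) (n-i+j)) \<and>
        (\<forall>p\<in>spin3 n. triple_fun n (n+i+1) (2*n+1-j) (n-i+j) p = triple_fun n (n-i) j (n+1+i-j) p)) \<and>
     (\<forall>i\<in>{1..n-1}. \<forall>j\<in>{1..n-1}. i < j \<longrightarrow>
        (\<forall>t \<le> n - j. \<forall>l \<le> length (mutation_sequence n L). times_mutated n L l (X i j) = t \<longrightarrow>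
           rat_eq n (function_at n A L l (X i j))
             (quad_fun n (n-i-t) (2*n+1+i-j-t) (n+1+t) (j+t))) \<and>
        rat_eq n (function_at n A L 0 (X i j)) (quad_fun n (n-i) (2*n+1+i-j) (n+1) j) \<and>
        rat_eq n (function_at n A L (length (mutation_sequence n L)) (X i j))
          (quad_fun n (j-i) (n+i+1) (2*n+1-j) n) \<and>
        (\<forall>p\<in>spin3 n. quad_fun n (j-i) (n+i+1) (2*n+1-j) n p = quad_fun n (n-i) (2*n+1+i-j) j (n+1) p))"
proof -
  obtain p0 where p0: "p0 \<in> spin3 n" "nonvanishing_locus n p0 \<noteq> 0"
    using generic_vertex_functions[of n] unfolding nonvanishing_locus_nz by metis
  have nz: "vertex_function n i j t p \<noteq> 0"
    if "nonvanishing_locus n p \<noteq> 0" "1 \<le> i" "1 \<le> j" "max i j + t \<le> n" for p i j t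
    using that unfolding nonvanishing_locus_nz by blast
  have rat: "rat_eq n f g" if "\<And>p. p \<in> spin3 n \<Longrightarrow> nonvanishing_locus n p \<noteq> 0 \<Longrightarrow> f p = g p" for f g
    unfolding rat_eq_def using regular_nonvanishing_locus p0 that by blast
  \<comment> \<open>The locale is instantiated at each point of the locus separately;
    \<open>rat\<close> then collects the pointwise equalities.\<close>
  have value_at: "function_at n A L l (X i j) p = vertex_function n i j (times_mutated n L l (X i j)) p"
    if "p \<in> spin3 n" "nonvanishing_locus n p \<noteq> 0" "i \<in> {1..n-1}" "j \<in> {1..n-1}" for l i j p
  proof -
    interpret seed_point n A p by unfold_locales (use n seed that in auto)
    show ?thesis by (rule function_at_count[OF orders nz[OF that(2)]]) (use that in auto)
  qed
  have count: "times_mutated n L (length (mutation_sequence n L)) (X i j) = n - max i j"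
    if "i \<in> {1..n-1}" "j \<in> {1..n-1}" for i j
  proof -
    interpret seed_point n A p0 by unfold_locales (use n seed p0 in auto)
    show ?thesis by (rule total_count[OF orders nz[OF p0(2)]]) (use that in auto)
  qed
  have start: "times_mutated n L 0 v = 0" for v by (simp add: times_mutated_def)
  have lower: "rat_eq n (function_at n A L l (X i j)) f"
    if "i \<in> {1..n-1}" "j \<in> {1..n-1}" "times_mutated n L l (X i j) = t"
      "\<And>p. p \<in> spin3 n \<Longrightarrow> vertex_function n i j t p = f p" for i j l t f
    using that value_at[of _ i j l] by (intro rat) simp
  show ?thesis
  proof (intro conjI ballI impI allI)
    fix i j assume "i \<in> {1..n-1}" "j \<in> {1..n-1}"
    then show "times_mutated n L (length (mutation_sequence n L)) (X i j) = n - max i j" by (rule count)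
  next
    fix i j t l assume ij: "i \<in> {1..n-1}" "j \<in> {1..n-1}" "j \<le> i" and t: "t \<le> n - i" "times_mutated n L l (X i j) = t"
    show "rat_eq n (function_at n A L l (X i j)) (quad_fun n (2*n+1-t) (n-i-t) (n+1+i-j+t) (j+t))"
      by (rule lower[OF ij(1,2) t(2)], rule quad_fun_lower[symmetric]) (use ij t in auto)
  next
    fix i j assume ij: "i \<in> {1..n-1}" "j \<in> {1..n-1}" "j \<le> i"
    show "rat_eq n (function_at n A L 0 (X i j)) (triple_fun n (n-i) (n+1+i-j) j)"
      by (rule lower[OF ij(1,2) start], rule vertex_function_full) (use ij in auto)
    have end_count: "times_mutated n L (length (mutation_sequence n L)) (X i j) = n - i"
      using count[OF ij(1,2)] ij(3) by (simp add: max_absorb1)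
    show "rat_eq n (function_at n A L (length (mutation_sequence n L)) (X i j)) (triple_fun n (n+i+1) (2*n+1-j) (n-i+j))"
      by (rule lower[OF ij(1,2) end_count], rule vertex_function_end) (use ij in auto)
    fix p assume "p \<in> spin3 n"
    then show "triple_fun n (n+i+1) (2*n+1-j) (n-i+j) p = triple_fun n (n-i) j (n+1+i-j) p"
      by (rule triple_fun_dual) (use ij in auto)
  next
    fix i j t l assume ij: "i \<in> {1..n-1}" "j \<in> {1..n-1}" "i < j" and t: "t \<le> n - j" "times_mutated n L l (X i j) = t"
    show "rat_eq n (function_at n A L l (X i j)) (quad_fun n (n-i-t) (2*n+1+i-j-t) (n+1+t) (j+t))"
      by (rule lower[OF ij(1,2) t(2)], rule quad_fun_upper[symmetric]) (use ij t in auto)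
  next
    fix i j assume ij: "i \<in> {1..n-1}" "j \<in> {1..n-1}" "i < j"
    have ij': "1 \<le> i" "i < j" "j \<le> n" using ij by auto
    show "rat_eq n (function_at n A L 0 (X i j)) (quad_fun n (n-i) (2*n+1+i-j) (n+1) j)"
      by (rule lower[OF ij(1,2) start]) (use quad_fun_upper[OF _ ij', of _ 0] in simp)
    have end_count: "times_mutated n L (length (mutation_sequence n L)) (X i j) = n - j"
      using count[OF ij(1,2)] ij(3) by (simp add: max_absorb2)
    have e: "n - i - (n - j) = j - i" "2*n+1+i-j-(n-j) = n+i+1" "n+1+(n-j) = 2*n+1-j" "j+(n-j) = n"
      using ij' by auto
    show "rat_eq n (function_at n A L (length (mutation_sequence n L)) (X i j)) (quad_fun n (j-i) (n+i+1) (2*n+1-j) n)"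
      by (rule lower[OF ij(1,2) end_count], rule quad_fun_upper[OF _ ij' order_refl, unfolded e, symmetric])
    fix p assume "p \<in> spin3 n"
    then show "quad_fun n (j-i) (n+i+1) (2*n+1-j) n p = quad_fun n (n-i) (2*n+1+i-j) j (n+1) p"
      by (rule quad_fun_dual[OF _ ij'])
  qed
qed

end
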